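(* Let $(M,\xi,\eta,\Phi,g)$ be a compact connected Sasakian manifold of dimension $2n+1$, let $\varphi_0,\varphi_1\in\mathcal H$, let $\varphi_t$, $t\in[0,1]$, be a smooth path of basic functions on $M$, and define $\psi$ on $\overline M=M\times[1,\frac32]$ by $\psi(\cdot,r)=\varphi_{2(r-1)}(\cdot)+4\log r$. Then $\varphi_t$ is a path in $\mathcal H$ which connects $\varphi_0$ and $\varphi_1$ and satisfies the geodesic equation $$\frac{\partial^2\varphi}{\partial t^2}-\frac14\Big|d_B\frac{\partial\varphi}{\partial t}\Big|^2_{g_\varphi}=0\quad\text{on } M\times(0,1)$$ if and only if $\psi$ satisfies $$(\Omega_\psi)^{n+1}=0\quad\text{on } M\times(1,\tfrac32),$$ $\Omega_\psi|_{\mathcal D^{\mathbb C}}$ is positive, $\psi|_{M\times\{1\}}=\varphi_0$ and $\psi|_{M\times\{\frac32\}}=\varphi_1+4\log\frac32$.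
   Context: Sasakian setting. $(M,g)$ is Sasakian if the cone $(C(M),\bar g)=(M\times\mathbb R^+,dr^2+r^2g)$ is Kähler; $\xi$ is the unit Reeb field, $\eta$ its dual contact $1$-form, $\Phi(X)=\nabla_X\xi$. The complex structure of the cone is $J(Y)=\Phi(Y)-\eta(Y)r\partial_r$ for $Y\in TM$ and $J(r\partial_r)=\xi$. $\mathcal D=\ker\eta$ has complex structure $\Phi|_{\mathcal D}$, $\mathcal D^{\mathbb C}=\mathcal D\otimes\mathbb C=\mathcal D^{1,0}\oplus\mathcal D^{0,1}$. Basic forms $\theta$ satisfy $i_\xi\theta=0$, $L_\xi\theta=0$ and have a type decomposition with operators $\partial_B,\bar\partial_B$, $d_B=\partial_B+\bar\partial_B$, $d_B^c=\frac{\sqrt{-1}}2(\bar\partial_B-\partial_B)$. $C_B^\infty(M)$ is the space of smooth real basic functions; $\mathcal H=\{\varphi\in C_B^\infty(M):\eta_\varphi\wedge(d\eta_\varphi)^n\ne0\}$, $\eta_\varphi=\eta+d_B^c\varphi$, $d\eta_\varphi=d\eta+\sqrt{-1}\partial_B\bar\partial_B\varphi$. For $\varphi\in\mathcal H$: $\Phi_\varphi=\Phi-\xi\otimes(d^c_B\varphi)\circ\Phi$, $g_\varphi=\frac12d\eta_\varphi\circ(\mathrm{Id}\otimes\Phi_\varphi)+\eta_\varphi\otimes\eta_\varphi$; $|\cdot|_{g_\varphi}$ is the Riemannian norm on covectors. Cone. $\overline M=M\times[1,\frac32]\subset C(M)$, $\bar\omega=\frac12d(r^2\eta)$ is the Kähler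 form of $\bar g$, and $$\Omega_\psi=\bar\omega+\frac{r^2}2\sqrt{-1}\Big(\partial\bar\partial\psi-\frac{\partial\psi}{\partial r}\partial\bar\partial r\Big).$$ $\Omega_\psi|_{\mathcal D^{\mathbb C}}$ positive means that $-\sqrt{-1}\,\Omega_\psi(X,\bar X)>0$ for all nonzero $X\in\mathcal D^{1,0}$ at every point of $\overline M$. *)

theory Defs
  imports "HOL-Analysis.Analysis" "HOL-Combinatorics.Permutations"
begin

section \<open>Smooth maps between Euclidean spaces\<close>

text \<open>Only used on open sets of Euclidean spaces, where it is the usual notion of a
  \<open>C\<^sup>k\<close> map.\<close>

primrec Ck_on :: "nat \<Rightarrow> 'a::euclidean_space set \<Rightarrow> ('a \<Rightarrow> 'b::real_normed_vector) \<Rightarrow> bool" where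
  "Ck_on 0 S = (\<lambda>f. continuous_on S f)"
| "Ck_on (Suc k) S =
     (\<lambda>f. (\<forall>x\<in>S. f differentiable (at x)) \<and> (\<forall>v. Ck_on k S (\<lambda>x. frechet_derivative f (at x) v)))"

definition smooth_on :: "'a::euclidean_space set \<Rightarrow> ('a \<Rightarrow> 'b::real_normed_vector) \<Rightarrow> bool" where
  "smooth_on S f \<longleftrightarrow> (\<forall>k. Ck_on k S f)"


section \<open>Manifolds\<close>

text \<open>A manifold with underlying set \<open>pts\<close> is given by an atlas in which every point \<open>p\<close> has a
  designated chart \<open>crd p : nbh p \<rightarrow> 'e\<close> around it. Every smooth manifold has such an atlas.

  The tangent space at \<open>p\<close> is the model space \<open>'e\<close>, identified by means of the designated chart
  at \<open>p\<close>; that is, a tangent vector at \<open>p\<close> is represented by its derivative of the map \<open>crd p\<close>.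
  Since the designated chart need not vary continuously with \<open>p\<close>, smoothness of tensor fields is
  tested after transforming to a fixed chart.\<close>

record ('m, 'e) mfd =
  pts :: "'m set"
  nbh :: "'m \<Rightarrow> 'm set"
  crd :: "'m \<Rightarrow> 'm \<Rightarrow> 'e"

definition crd_inv :: "('m, 'e) mfd \<Rightarrow> 'm \<Rightarrow> 'e \<Rightarrow> 'm" where
  "crd_inv W p = inv_into (nbh W p) (crd W p)"

definition smooth_in :: "('m, 'e::euclidean_space) mfd \<Rightarrow> 'm \<Rightarrow> ('m \<Rightarrow> 'b::real_normed_vector) \<Rightarrow> bool" where
  "smooth_in W p f \<longleftrightarrow> smooth_on (crd W p ` nbh W p) (\<lambda>x. f (crd_inv W p x))"

definition smooth_manifold :: "('m::t2_space, 'e::euclidean_space) mfd \<Rightarrow> bool" where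
  "smooth_manifold W \<longleftrightarrow>
     (\<forall>p\<in>pts W. p \<in> nbh W p \<and> nbh W p \<subseteq> pts W \<and> open (nbh W p) \<and> open (crd W p ` nbh W p) \<and>
        homeomorphism (nbh W p) (crd W p ` nbh W p) (crd W p) (crd_inv W p)) \<and>
     (\<forall>p\<in>pts W. \<forall>q\<in>pts W.
        smooth_on (crd W p ` (nbh W p \<inter> nbh W q)) (\<lambda>x. crd W q (crd_inv W p x)))"

definition smooth_fun :: "('m, 'e::euclidean_space) mfd \<Rightarrow> ('m \<Rightarrow> 'b::real_normed_vector) \<Rightarrow> bool" where
  "smooth_fun W f \<longleftrightarrow> (\<forall>p\<in>pts W. smooth_in W p f)"

text \<open>Smoothness up to the boundary, for functions on \<open>M \<times> [a,b]\<close>: existence of a smooth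
  extension across the boundary.\<close>

definition smooth_ext :: "('m, 'e::euclidean_space) mfd \<Rightarrow> 'm set \<Rightarrow> ('m \<Rightarrow> real) \<Rightarrow> ('m \<Rightarrow> real) \<Rightarrow> bool" where
  "smooth_ext W A f F \<longleftrightarrow> smooth_fun W F \<and> (\<forall>a\<in>A. F a = f a)"

text \<open>The differential of \<open>f\<close> at \<open>p\<close>, applied to the tangent vector \<open>v\<close>.\<close>

definition tdiff :: "('m, 'e::euclidean_space) mfd \<Rightarrow> ('m \<Rightarrow> 'b::real_normed_vector) \<Rightarrow> 'm \<Rightarrow> 'e \<Rightarrow> 'b" where
  "tdiff W f p v = frechet_derivative (\<lambda>x. f (crd_inv W p x)) (at (crd W p p)) v"

text \<open>The coordinate vector field on \<open>nbh p\<close> with constant components \<open>v\<close> in the chart at \<open>p\<close>;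
  its value at \<open>p\<close> is \<open>v\<close>.\<close>

definition coord_field :: "('m, 'e::euclidean_space) mfd \<Rightarrow> 'm \<Rightarrow> 'e \<Rightarrow> 'm \<Rightarrow> 'e" where
  "coord_field W p v q = frechet_derivative (\<lambda>x. crd W q (crd_inv W p x)) (at (crd W p q)) v"

text \<open>The components of the vector field \<open>X\<close> at \<open>q \<in> nbh p\<close> in the chart at \<open>p\<close>.\<close>

definition components :: "('m, 'e::euclidean_space) mfd \<Rightarrow> 'm \<Rightarrow> ('m \<Rightarrow> 'e) \<Rightarrow> 'm \<Rightarrow> 'e" where
  "components W p X q = tdiff W (crd W p) q (X q)"

definition smooth_field :: "('m, 'e::euclidean_space) mfd \<Rightarrow> ('m \<Rightarrow> 'e) \<Rightarrow> bool" where
  "smooth_field W X \<longleftrightarrow> (\<forall>p\<in>pts W. smooth_in W p (components W p X))"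

definition smooth_endo :: "('m, 'e::euclidean_space) mfd \<Rightarrow> ('m \<Rightarrow> 'e \<Rightarrow> 'e) \<Rightarrow> bool" where
  "smooth_endo W J \<longleftrightarrow> (\<forall>p\<in>pts W. linear (J p) \<and>
     (\<forall>v. smooth_in W p (components W p (\<lambda>q. J q (coord_field W p v q)))))"

text \<open>The product of a manifold with an open set of reals. A tangent vector of the product is a
  pair \<open>(Y, s)\<close>, standing for \<open>Y + s \<partial>/\<partial>r\<close>.\<close>

definition cylinder :: "('m, 'e) mfd \<Rightarrow> real set \<Rightarrow> ('m \<times> real, 'e \<times> real) mfd" where
  "cylinder W I = \<lparr> pts = pts W \<times> I, nbh = (\<lambda>(p, s). nbh W p \<times> I),
                    crd = (\<lambda>(p, s) (q, u). (crd W p q, u)) \<rparr>"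


section \<open>Differential forms\<close>

text \<open>Exterior derivative of a 1-form, with the convention
  \<open>d\<alpha>(X,Y) = X(\<alpha>(Y)) - Y(\<alpha>(X)) - \<alpha>([X,Y])\<close>, evaluated on commuting coordinate vector fields.\<close>

definition ext_deriv ::
    "('m, 'e::euclidean_space) mfd \<Rightarrow> ('m \<Rightarrow> 'e \<Rightarrow> 'b::real_normed_vector) \<Rightarrow> 'm \<Rightarrow> 'e \<Rightarrow> 'e \<Rightarrow> 'b" where
  "ext_deriv W \<alpha> p v w =
     tdiff W (\<lambda>q. \<alpha> q (coord_field W p w q)) p v - tdiff W (\<lambda>q. \<alpha> q (coord_field W p v q)) p w"

text \<open>For wedge products, \<open>k\<close>-forms on a vector space \<open>'v\<close> are functions of sequences of vectors
  that only depend on the first \<open>k\<close> entries.\<close>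

type_synonym ('v, 'b) form = "(nat \<Rightarrow> 'v) \<Rightarrow> 'b"

definition form1 :: "('v \<Rightarrow> 'b) \<Rightarrow> ('v, 'b) form" where
  "form1 \<alpha> v = \<alpha> (v 0)"

definition form2 :: "('v \<Rightarrow> 'v \<Rightarrow> 'b) \<Rightarrow> ('v, 'b) form" where
  "form2 \<beta> v = \<beta> (v 0) (v 1)"

definition wedge :: "nat \<Rightarrow> nat \<Rightarrow> ('v, 'b) form \<Rightarrow> ('v, 'b) form \<Rightarrow> ('v, 'b::field_char_0) form" where
  "wedge k l \<alpha> \<beta> v =
     (\<Sum>\<sigma> | \<sigma> permutes {..<k + l}. of_int (sign \<sigma>) * \<alpha> (\<lambda>i. v (\<sigma> i)) * \<beta> (\<lambda>i. v (\<sigma> (k + i))))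
       / (fact k * fact l)"

text \<open>The \<open>m\<close>-fold wedge power of a 2-form.\<close>

primrec wedge_power :: "nat \<Rightarrow> ('v, 'b::field_char_0) form \<Rightarrow> ('v, 'b) form" where
  "wedge_power 0 \<beta> = (\<lambda>v. 1)"
| "wedge_power (Suc m) \<beta> = wedge 2 (2 * m) \<beta> (wedge_power m \<beta>)"


section \<open>Complexification and types\<close>

text \<open>Complex-valued real-multilinear forms on \<open>'v\<close> stand for their complex-multilinear extensions
  to the complexification of \<open>'v\<close>. Elements \<open>a + \<i> b\<close> of the complexification are pairs \<open>(a, b)\<close>.\<close>

type_synonym 'v cvec = "'v \<times> 'v"

definition cvec_i :: "'v::real_vector cvec \<Rightarrow> 'v cvec" where
  "cvec_i X = (- snd X, fst X)"

definition cvec_cnj :: "'v::real_vector cvec \<Rightarrow> 'v cvec" where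
  "cvec_cnj X = (fst X, - snd X)"

definition cext2 :: "('v \<Rightarrow> 'v \<Rightarrow> complex) \<Rightarrow> 'v cvec \<Rightarrow> 'v cvec \<Rightarrow> complex" where
  "cext2 \<beta> X Y = \<beta> (fst X) (fst Y) - \<beta> (snd X) (snd Y) + \<i> * (\<beta> (fst X) (snd Y) + \<beta> (snd X) (fst Y))"

text \<open>Components of type \<open>(1,0)\<close>, \<open>(0,1)\<close> and \<open>(1,1)\<close> with respect to \<open>J\<close>. These are applied to a
  complex structure \<open>J\<close>, or to \<open>J = \<Phi>\<close> and a form annihilated by \<open>\<xi>\<close>, where \<open>\<Phi>\<close> is a complex
  structure on \<open>ker \<eta>\<close> and \<open>\<Phi> \<xi> = 0\<close>.\<close>

definition part10 :: "('v \<Rightarrow> 'v) \<Rightarrow> ('v \<Rightarrow> complex) \<Rightarrow> 'v \<Rightarrow> complex" where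
  "part10 J \<alpha> v = (\<alpha> v - \<i> * \<alpha> (J v)) / 2"

definition part01 :: "('v \<Rightarrow> 'v) \<Rightarrow> ('v \<Rightarrow> complex) \<Rightarrow> 'v \<Rightarrow> complex" where
  "part01 J \<alpha> v = (\<alpha> v + \<i> * \<alpha> (J v)) / 2"

definition part11 :: "('v \<Rightarrow> 'v) \<Rightarrow> ('v \<Rightarrow> 'v \<Rightarrow> complex) \<Rightarrow> 'v \<Rightarrow> 'v \<Rightarrow> complex" where
  "part11 J \<beta> v w = (\<beta> v w + \<beta> (J v) (J w)) / 2"

definition del :: "('m, 'e::euclidean_space) mfd \<Rightarrow> ('m \<Rightarrow> 'e \<Rightarrow> 'e) \<Rightarrow> ('m \<Rightarrow> real) \<Rightarrow> 'm \<Rightarrow> 'e \<Rightarrow> complex" where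
  "del W J f p = part10 (J p) (\<lambda>v. complex_of_real (tdiff W f p v))"

definition delbar :: "('m, 'e::euclidean_space) mfd \<Rightarrow> ('m \<Rightarrow> 'e \<Rightarrow> 'e) \<Rightarrow> ('m \<Rightarrow> real) \<Rightarrow> 'm \<Rightarrow> 'e \<Rightarrow> complex" where
  "delbar W J f p = part01 (J p) (\<lambda>v. complex_of_real (tdiff W f p v))"

text \<open>On forms of type \<open>(0,1)\<close> the operator \<open>\<partial>\<close> is the \<open>(1,1)\<close>-component of \<open>d\<close>.\<close>

definition del_delbar ::
    "('m, 'e::euclidean_space) mfd \<Rightarrow> ('m \<Rightarrow> 'e \<Rightarrow> 'e) \<Rightarrow> ('m \<Rightarrow> real) \<Rightarrow> 'm \<Rightarrow> 'e \<Rightarrow> 'e \<Rightarrow> complex" where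
  "del_delbar W J f p = part11 (J p) (ext_deriv W (delbar W J f) p)"


section \<open>Riemannian and Kaehler metrics\<close>

definition riemannian_metric :: "('m, 'e::euclidean_space) mfd \<Rightarrow> ('m \<Rightarrow> 'e \<Rightarrow> 'e \<Rightarrow> real) \<Rightarrow> bool" where
  "riemannian_metric W g \<longleftrightarrow>
     (\<forall>p\<in>pts W. bilinear (g p) \<and> (\<forall>v w. g p v w = g p w v) \<and> (\<forall>v. v \<noteq> 0 \<longrightarrow> g p v v > 0) \<and>
        (\<forall>v w. smooth_in W p (\<lambda>q. g q (coord_field W p v q) (coord_field W p w q))))"

text \<open>The Riemannian norm on covectors, by means of the vector \<open>u\<close> dual to \<open>\<alpha>\<close>.\<close>

definition covector_norm :: "('e \<Rightarrow> 'e \<Rightarrow> real) \<Rightarrow> ('e \<Rightarrow> real) \<Rightarrow> real" where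
  "covector_norm h \<alpha> = (let u = (THE u. \<forall>v. h u v = \<alpha> v) in sqrt (h u u))"

text \<open>Christoffel symbols at \<open>p\<close> in the chart at \<open>p\<close>.\<close>

definition christoffel ::
    "('m, 'e::euclidean_space) mfd \<Rightarrow> ('m \<Rightarrow> 'e \<Rightarrow> 'e \<Rightarrow> real) \<Rightarrow> 'm \<Rightarrow> 'e \<Rightarrow> 'e \<Rightarrow> 'e" where
  "christoffel W g p v w =
     (let G = (\<lambda>a b q. g q (coord_field W p a q) (coord_field W p b q))
      in THE z. \<forall>u. g p z u = (tdiff W (G w u) p v + tdiff W (G v u) p w - tdiff W (G v w) p u) / 2)"

text \<open>The Levi-Civita covariant derivative of the vector field \<open>Y\<close> in direction \<open>v\<close> at \<open>p\<close>.\<close>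

definition levi_civita ::
    "('m, 'e::euclidean_space) mfd \<Rightarrow> ('m \<Rightarrow> 'e \<Rightarrow> 'e \<Rightarrow> real) \<Rightarrow> ('m \<Rightarrow> 'e) \<Rightarrow> 'm \<Rightarrow> 'e \<Rightarrow> 'e" where
  "levi_civita W g Y p v = tdiff W (components W p Y) p v + christoffel W g p v (Y p)"

text \<open>A Hermitian structure is Kaehler if the complex structure is parallel; the last clause is
  \<open>(\<nabla>\<^sub>v J) w = \<nabla>\<^sub>v (J w) - J (\<nabla>\<^sub>v w) = 0\<close>.\<close>

definition kaehler ::
    "('m, 'e::euclidean_space) mfd \<Rightarrow> ('m \<Rightarrow> 'e \<Rightarrow> 'e \<Rightarrow> real) \<Rightarrow> ('m \<Rightarrow> 'e \<Rightarrow> 'e) \<Rightarrow> bool" where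
  "kaehler W g J \<longleftrightarrow> riemannian_metric W g \<and> smooth_endo W J \<and>
     (\<forall>p\<in>pts W. (\<forall>v. J p (J p v) = - v) \<and> (\<forall>v w. g p (J p v) (J p w) = g p v w) \<and>
        (\<forall>v w. levi_civita W g (\<lambda>q. J q (coord_field W p w q)) p v
               = J p (levi_civita W g (coord_field W p w) p v)))"


section \<open>Sasakian manifolds\<close>

definition cone :: "('m, 'e) mfd \<Rightarrow> ('m \<times> real, 'e \<times> real) mfd" where
  "cone M = cylinder M {0<..}"

definition cone_metric :: "('m \<Rightarrow> 'e \<Rightarrow> 'e \<Rightarrow> real) \<Rightarrow> 'm \<times> real \<Rightarrow> 'e \<times> real \<Rightarrow> 'e \<times> real \<Rightarrow> real" where
  "cone_metric g = (\<lambda>(p, r) (Y, s) (Z, u). s * u + r\<^sup>2 * g p Y Z)"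

text \<open>\<open>J(Y) = \<Phi>(Y) - \<eta>(Y) r \<partial>/\<partial>r\<close> for \<open>Y\<close> tangent to \<open>M\<close>, and \<open>J(r \<partial>/\<partial>r) = \<xi>\<close>.\<close>

definition cone_J ::
    "('m \<Rightarrow> 'e::real_vector) \<Rightarrow> ('m \<Rightarrow> 'e \<Rightarrow> real) \<Rightarrow> ('m \<Rightarrow> 'e \<Rightarrow> 'e) \<Rightarrow> 'm \<times> real \<Rightarrow> 'e \<times> real \<Rightarrow> 'e \<times> real" where
  "cone_J \<xi> \<eta> \<Phi> = (\<lambda>(p, r) (Y, s). (\<Phi> p Y + (s / r) *\<^sub>R \<xi> p, - (\<eta> p Y * r)))"

definition sasakian ::
    "('m, 'e::euclidean_space) mfd \<Rightarrow> ('m \<Rightarrow> 'e) \<Rightarrow> ('m \<Rightarrow> 'e \<Rightarrow> real) \<Rightarrow> ('m \<Rightarrow> 'e \<Rightarrow> 'e)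
      \<Rightarrow> ('m \<Rightarrow> 'e \<Rightarrow> 'e \<Rightarrow> real) \<Rightarrow> bool" where
  "sasakian M \<xi> \<eta> \<Phi> g \<longleftrightarrow>
     riemannian_metric M g \<and> smooth_field M \<xi> \<and>
     (\<forall>p\<in>pts M. g p (\<xi> p) (\<xi> p) = 1 \<and> (\<forall>v. \<eta> p v = g p (\<xi> p) v) \<and>
        (\<forall>v. \<Phi> p v = levi_civita M g \<xi> p v)) \<and>
     kaehler (cone M) (cone_metric g) (cone_J \<xi> \<eta> \<Phi>)"


section \<open>Deformations by basic functions\<close>

text \<open>The space of smooth real basic functions; for functions, \<open>i\<^sub>\<xi> f = 0\<close> is void and
  \<open>L\<^sub>\<xi> f = df(\<xi>)\<close>. On basic functions \<open>d\<^sub>B\<close> is \<open>d\<close>.\<close>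

definition basic_funs :: "('m, 'e::euclidean_space) mfd \<Rightarrow> ('m \<Rightarrow> 'e) \<Rightarrow> ('m \<Rightarrow> real) set" where
  "basic_funs M \<xi> = {f. smooth_fun M f \<and> (\<forall>p\<in>pts M. tdiff M f p (\<xi> p) = 0)}"

text \<open>The form \<open>\<i>/2 (\<partial>bar\<^sub>B - \<partial>\<^sub>B) \<phi>\<close> is real-valued; \<open>Re\<close> only converts the type.\<close>

definition dcB :: "('m, 'e::euclidean_space) mfd \<Rightarrow> ('m \<Rightarrow> 'e \<Rightarrow> 'e) \<Rightarrow> ('m \<Rightarrow> real) \<Rightarrow> 'm \<Rightarrow> 'e \<Rightarrow> real" where
  "dcB M \<Phi> \<phi> p v = Re (\<i> / 2 * (delbar M \<Phi> \<phi> p v - del M \<Phi> \<phi> p v))"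

definition eta_pot ::
    "('m, 'e::euclidean_space) mfd \<Rightarrow> ('m \<Rightarrow> 'e \<Rightarrow> real) \<Rightarrow> ('m \<Rightarrow> 'e \<Rightarrow> 'e) \<Rightarrow> ('m \<Rightarrow> real) \<Rightarrow> 'm \<Rightarrow> 'e \<Rightarrow> real" where
  "eta_pot M \<eta> \<Phi> \<phi> p v = \<eta> p v + dcB M \<Phi> \<phi> p v"

definition Phi_pot ::
    "('m, 'e::euclidean_space) mfd \<Rightarrow> ('m \<Rightarrow> 'e) \<Rightarrow> ('m \<Rightarrow> 'e \<Rightarrow> 'e) \<Rightarrow> ('m \<Rightarrow> real) \<Rightarrow> 'm \<Rightarrow> 'e \<Rightarrow> 'e" where
  "Phi_pot M \<xi> \<Phi> \<phi> p v = \<Phi> p v - dcB M \<Phi> \<phi> p (\<Phi> p v) *\<^sub>R \<xi> p"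

definition metric_pot ::
    "('m, 'e::euclidean_space) mfd \<Rightarrow> ('m \<Rightarrow> 'e) \<Rightarrow> ('m \<Rightarrow> 'e \<Rightarrow> real) \<Rightarrow> ('m \<Rightarrow> 'e \<Rightarrow> 'e)
      \<Rightarrow> ('m \<Rightarrow> real) \<Rightarrow> 'm \<Rightarrow> 'e \<Rightarrow> 'e \<Rightarrow> real" where
  "metric_pot M \<xi> \<eta> \<Phi> \<phi> p v w =
     ext_deriv M (eta_pot M \<eta> \<Phi> \<phi>) p v (Phi_pot M \<xi> \<Phi> \<phi> p w) / 2
       + eta_pot M \<eta> \<Phi> \<phi> p v * eta_pot M \<eta> \<Phi> \<phi> p w"

text \<open>The space \<open>\<H>\<close> of potentials on a manifold of dimension \<open>2n+1\<close>: the form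
  \<open>\<eta>\<^sub>\<phi> \<and> (d\<eta>\<^sub>\<phi>)\<^sup>n\<close> vanishes nowhere.\<close>

definition potentials ::
    "nat \<Rightarrow> ('m, 'e::euclidean_space) mfd \<Rightarrow> ('m \<Rightarrow> 'e) \<Rightarrow> ('m \<Rightarrow> 'e \<Rightarrow> real) \<Rightarrow> ('m \<Rightarrow> 'e \<Rightarrow> 'e)
      \<Rightarrow> ('m \<Rightarrow> real) set" where
  "potentials n M \<xi> \<eta> \<Phi> =
     {\<phi> \<in> basic_funs M \<xi>. \<forall>p\<in>pts M. \<exists>v.
        wedge 1 (2 * n) (form1 (eta_pot M \<eta> \<Phi> \<phi> p))
          (wedge_power n (form2 (ext_deriv M (eta_pot M \<eta> \<Phi> \<phi>) p))) v \<noteq> 0}"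

text \<open>A smooth path \<open>\<phi>\<^sub>t\<close>, \<open>t \<in> [0,1]\<close>, of basic functions; values for other \<open>t\<close> are irrelevant.\<close>

definition smooth_basic_path :: "('m, 'e::euclidean_space) mfd \<Rightarrow> ('m \<Rightarrow> 'e) \<Rightarrow> (real \<Rightarrow> 'm \<Rightarrow> real) \<Rightarrow> bool" where
  "smooth_basic_path M \<xi> \<phi> \<longleftrightarrow>
     (\<exists>F. smooth_ext (cylinder M UNIV) (pts M \<times> {0..1}) (\<lambda>(p, t). \<phi> t p) F) \<and>
     (\<forall>t\<in>{0..1}. \<phi> t \<in> basic_funs M \<xi>)"

definition geodesic_equation ::
    "('m, 'e::euclidean_space) mfd \<Rightarrow> ('m \<Rightarrow> 'e) \<Rightarrow> ('m \<Rightarrow> 'e \<Rightarrow> real) \<Rightarrow> ('m \<Rightarrow> 'e \<Rightarrow> 'e)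
      \<Rightarrow> (real \<Rightarrow> 'm \<Rightarrow> real) \<Rightarrow> bool" where
  "geodesic_equation M \<xi> \<eta> \<Phi> \<phi> \<longleftrightarrow>
     (\<forall>p\<in>pts M. \<forall>t\<in>{0<..<1}.
        deriv (\<lambda>s. deriv (\<lambda>u. \<phi> u p) s) t
          - 1 / 4 * (covector_norm (metric_pot M \<xi> \<eta> \<Phi> (\<phi> t) p)
                       (tdiff M (\<lambda>q. deriv (\<lambda>u. \<phi> u q) t) p))\<^sup>2 = 0)"


section \<open>The degenerate equation on the cone\<close>

definition cone_omega :: "('m, 'e::euclidean_space) mfd \<Rightarrow> ('m \<Rightarrow> 'e \<Rightarrow> real) \<Rightarrow> 'm \<times> real \<Rightarrow> 'e \<times> real \<Rightarrow> 'e \<times> real \<Rightarrow> real" where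
  "cone_omega M \<eta> x v w = ext_deriv (cone M) (\<lambda>(p, r) (Y, s). r\<^sup>2 * \<eta> p Y) x v w / 2"

definition Mbar :: "('m, 'e) mfd \<Rightarrow> ('m \<times> real) set" where
  "Mbar M = pts M \<times> {1..3/2}"

text \<open>\<open>Omega\<close> is the form \<open>\<Omega>\<^sub>\<psi>\<close> for a smooth function \<open>\<psi>\<close> on \<open>M \<times> [1,3/2]\<close>. To differentiate at
  the boundary, \<open>\<psi>\<close> is extended smoothly to the cone; at points of \<open>M \<times> [1,3/2]\<close>, which is the
  closure of its interior, the result does not depend on the choice of the extension.\<close>

definition Omega ::
    "('m, 'e::euclidean_space) mfd \<Rightarrow> ('m \<Rightarrow> 'e) \<Rightarrow> ('m \<Rightarrow> 'e \<Rightarrow> real) \<Rightarrow> ('m \<Rightarrow> 'e \<Rightarrow> 'e)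
      \<Rightarrow> ('m \<times> real \<Rightarrow> real) \<Rightarrow> 'm \<times> real \<Rightarrow> 'e \<times> real \<Rightarrow> 'e \<times> real \<Rightarrow> complex" where
  "Omega M \<xi> \<eta> \<Phi> \<psi> x v w =
     (let F = (SOME F. smooth_ext (cone M) (Mbar M) \<psi> F); J = cone_J \<xi> \<eta> \<Phi>
      in complex_of_real (cone_omega M \<eta> x v w)
         + complex_of_real ((snd x)\<^sup>2 / 2) * \<i> *
           (del_delbar (cone M) J F x v w
            - complex_of_real (tdiff (cone M) F x (0, 1)) * del_delbar (cone M) J snd x v w))"

definition D10 :: "('m \<Rightarrow> 'e \<Rightarrow> real) \<Rightarrow> ('m \<Rightarrow> 'e \<Rightarrow> 'e) \<Rightarrow> 'm \<Rightarrow> 'e::euclidean_space cvec set" where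
  "D10 \<eta> \<Phi> p = {X. \<eta> p (fst X) = 0 \<and> \<eta> p (snd X) = 0 \<and> (\<Phi> p (fst X), \<Phi> p (snd X)) = cvec_i X}"

text \<open>Vectors in \<open>\<D>\<close> are tangent to \<open>M\<close>, so have no \<open>\<partial>/\<partial>r\<close> component.\<close>

definition Omega_positive ::
    "('m, 'e::euclidean_space) mfd \<Rightarrow> ('m \<Rightarrow> 'e) \<Rightarrow> ('m \<Rightarrow> 'e \<Rightarrow> real) \<Rightarrow> ('m \<Rightarrow> 'e \<Rightarrow> 'e)
      \<Rightarrow> ('m \<times> real \<Rightarrow> real) \<Rightarrow> bool" where
  "Omega_positive M \<xi> \<eta> \<Phi> \<psi> \<longleftrightarrow>
     (\<forall>x\<in>Mbar M. \<forall>X\<in>D10 \<eta> \<Phi> (fst x). X \<noteq> 0 \<longrightarrow>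
        (let z = - \<i> * cext2 (\<lambda>a b. Omega M \<xi> \<eta> \<Phi> \<psi> x (a, 0) (b, 0)) X (cvec_cnj X)
         in z \<in> \<real> \<and> Re z > 0))"

end

theory Submission
  imports Defs
begin

text \<open>
  Write \<open>\<eta>\<^sub>\<phi> = \<eta> - d\<phi> \<circ> \<Phi> / 2\<close>. Since \<open>\<partial>\<partial>bar F = (\<i>/2) d(dF \<circ> J)\<close> on the cone, a computation at
  \<open>(p, r)\<close> with \<open>t = 2(r - 1)\<close> gives
  \<open>\<Omega>\<^sub>\<psi> = (r\<^sup>2/2) (d\<eta>\<^sub>\<phi> + 2r \<phi>'' dr \<and> \<eta> + r d\<phi>' \<and> \<eta> - dr \<and> (d\<phi>' \<circ> \<Phi>))\<close>,
  where primes are derivatives in \<open>t\<close>. On \<open>\<D>\<close> only \<open>d\<eta>\<^sub>\<phi>\<close> survives, so positivity of \<open>\<Omega>\<^sub>\<psi>\<close> on \<open>\<D>\<close> means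
  that \<open>g\<^sub>\<phi>\<close> is positive definite for all \<open>t\<close>. Membership in \<open>\<H>\<close> is nondegeneracy of \<open>g\<^sub>\<phi>\<close>, which
  implies positivity: \<open>g\<^sub>\<phi>\<close> is positive at a minimum of \<open>\<phi>\<close>, and \<open>M\<close> is connected.
  Finally \<open>(\<Omega>\<^sub>\<psi>)\<^bsup>n+1\<^esup> = 0\<close> iff \<open>\<Omega>\<^sub>\<psi>\<close> has a kernel vector, and with \<open>g\<^sub>\<phi>\<close> positive such a vector exists
  iff \<open>\<phi>'' = |d\<phi>'|\<^sup>2/4\<close>.
\<close>

section \<open>Wedge powers of two-forms\<close>

text \<open>Transverse Kaehler geometry is never set up on M. Its identities are read off on the
  cone, where \<open>J\<close> is parallel: the covariant Hessian shows that d(dF o J) is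
  J-invariant, and pulling back a basic function, or taking F = r, carries this over to d(df o
  \<Phi>) and d\<eta>. The shape of \<psi> is what makes the equation exact. With t = 2(r - 1) the
  second r-derivative gives 4 \<phi>'', while 4 log r adds -4/r^2, which removes precisely the term
  r dr \<and> \<eta> of the Kaehler form of the cone; the summand of \<Omega> with the r-derivative
  of \<psi> removes every term containing that derivative itself. Two obstacles shape the rest.
  Tangent vectors at q are written in the chart designated for q, which may jump with q, so
  differentiating or proving continuity means first passing to one fixed chart. And wedge powers are
  sums over permutations, so vanishing in top degree is derived from a kernel vector and
  nonvanishing from a symplectic sequence, for which no summand is negative.\<close>

lemma wedge_permute:
  fixes \<alpha> :: "('v, 'b::field_char_0) form"
  assumes "\<tau> permutes {..<k + l}"
  shows "wedge k l \<alpha> \<beta> (\<lambda>i. v (\<tau> i)) = of_int (sign \<tau>) * wedge k l \<alpha> \<beta> v"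
proof -
  let ?S = "{..<k + l}"
  let ?F = "\<lambda>\<sigma>. of_int (sign \<sigma>) * \<alpha> (\<lambda>i. v (\<sigma> i)) * \<beta> (\<lambda>i. v (\<sigma> (k + i)))"
  have pt: "permutation \<tau>" using assms by (auto simp: permutation_permutes)
  have "(\<Sum>\<sigma> | \<sigma> permutes ?S. of_int (sign \<sigma>) * \<alpha> (\<lambda>i. v (\<tau> (\<sigma> i))) * \<beta> (\<lambda>i. v (\<tau> (\<sigma> (k + i)))))
      = (\<Sum>\<sigma> | \<sigma> permutes ?S. of_int (sign \<tau>) * ?F (\<tau> \<circ> \<sigma>))"
  proof (rule sum.cong[OF refl])
    fix \<sigma> assume "\<sigma> \<in> {\<sigma>. \<sigma> permutes ?S}"
    then have "permutation \<sigma>" by (auto simp: permutation_permutes)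
    then have "sign (\<tau> \<circ> \<sigma>) = sign \<tau> * sign \<sigma>" using pt by (simp add: sign_compose)
    moreover have "of_int (sign \<tau>) * (of_int (sign \<tau>) * of_int (sign \<sigma>)) = (of_int (sign \<sigma>) :: 'b)"
      by (metis of_int_mult sign_left_idempotent)
    ultimately show "of_int (sign \<sigma>) * \<alpha> (\<lambda>i. v (\<tau> (\<sigma> i))) * \<beta> (\<lambda>i. v (\<tau> (\<sigma> (k + i))))
        = of_int (sign \<tau>) * ?F (\<tau> \<circ> \<sigma>)"
      by (simp add: mult.assoc[symmetric])
  qed
  also have "\<dots> = of_int (sign \<tau>) * (\<Sum>\<sigma> | \<sigma> permutes ?S. ?F \<sigma>)"
    unfolding sum_distrib_left[symmetric]
    by (rule arg_cong[where f="\<lambda>x. of_int (sign \<tau>) * x"])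
       (rule setum_permutations_compose_left[OF assms, symmetric])
  finally show ?thesis
    by (simp add: wedge_def)
qed

lemma wedge_power_permute:
  assumes "\<tau> permutes {..<2 * m}"
  shows "wedge_power m \<beta> (\<lambda>i. v (\<tau> i)) = of_int (sign \<tau>) * wedge_power m \<beta> v"
proof (cases m)
  case 0
  then show ?thesis using assms by (simp add: permutes_empty)
next
  case (Suc k)
  then show ?thesis using wedge_permute[of \<tau> 2 "2 * k" \<beta> "wedge_power k \<beta>" v] assms by simp
qed

section \<open>Alternating forms of top degree with a kernel vector\<close>

definition multilinear_form :: "nat \<Rightarrow> ('v::real_vector, real) form \<Rightarrow> bool" where
  "multilinear_form k f \<longleftrightarrow> (\<forall>j<k. \<forall>v. linear (\<lambda>x. f (v(j := x))))"

definition alternating_form :: "nat \<Rightarrow> ('v, real) form \<Rightarrow> bool" where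
  "alternating_form k f \<longleftrightarrow> (\<forall>\<tau> v. \<tau> permutes {..<k} \<longrightarrow> f (\<lambda>i. v (\<tau> i)) = of_int (sign \<tau>) * f v)"

text \<open>Slot \<open>j\<close> sits either in the \<alpha>-block or in the \<beta>-block of a
  summand. \<open>dep\<close> settles the second case: \<alpha> is applied to the whole sequence
  \<open>\<lambda>i. v (\<sigma> i)\<close>, which still contains slot \<open>j\<close> beyond the
  first \<open>k\<close> places.\<close>

lemma multilinear_form_wedge:
  assumes "multilinear_form k \<alpha>" "multilinear_form l \<beta>"
    and dep: "\<And>v w. (\<And>i. i < k \<Longrightarrow> v i = w i) \<Longrightarrow> \<alpha> v = \<alpha> w"
  shows "multilinear_form (k + l) (wedge k l \<alpha> \<beta>)"
  unfolding multilinear_form_def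
proof (intro allI impI)
  fix j v assume j: "j < k + l"
  have *: "linear (\<lambda>x. of_int (sign \<sigma>) * \<alpha> (\<lambda>i. (v(j := x)) (\<sigma> i)) * \<beta> (\<lambda>i. (v(j := x)) (\<sigma> (k + i))))"
    if s: "\<sigma> permutes {..<k + l}" for \<sigma>
  proof -
    have inj: "\<sigma> a = \<sigma> b \<longleftrightarrow> a = b" for a b using s by (metis permutes_inj inj_eq)
    obtain i0 where i0: "i0 < k + l" "\<sigma> i0 = j"
      using s j by (metis lessThan_iff permutes_in_image permutes_inverses(1))
    show ?thesis
    proof (cases "i0 < k")
      case True
      have "(\<lambda>i. (v(j := x)) (\<sigma> i)) = (\<lambda>i. v (\<sigma> i))(i0 := x)" for x
        using i0 inj by (auto simp: fun_eq_iff)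
      moreover have "(\<lambda>i. (v(j := x)) (\<sigma> (k + i))) = (\<lambda>i. v (\<sigma> (k + i)))" for x
        using i0 inj True by (auto simp: fun_eq_iff)
      moreover have "linear (\<lambda>x. \<alpha> ((\<lambda>i. v (\<sigma> i))(i0 := x)))"
        using assms(1) True by (simp add: multilinear_form_def)
      ultimately show ?thesis
        by (simp add: linear_iff algebra_simps)
    next
      case False
      then obtain i1 where i1: "i0 = k + i1" "i1 < l" using i0(1) by (metis add_less_cancel_left le_Suc_ex not_less)
      have "(\<lambda>i. (v(j := x)) (\<sigma> (k + i))) = (\<lambda>i. v (\<sigma> (k + i)))(i1 := x)" for x
        using i0 i1 inj by (auto simp: fun_eq_iff)
      moreover have "linear (\<lambda>x. \<beta> ((\<lambda>i. v (\<sigma> (k + i)))(i1 := x)))"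
        using assms(2) i1 by (simp add: multilinear_form_def)
      moreover have "\<alpha> (\<lambda>i. (v(j := x)) (\<sigma> i)) = \<alpha> (\<lambda>i. v (\<sigma> i))" for x
        using False i0 inj by (intro dep) (auto simp: fun_eq_iff)
      ultimately have "(\<lambda>x. of_int (sign \<sigma>) * \<alpha> (\<lambda>i. (v(j := x)) (\<sigma> i)) * \<beta> (\<lambda>i. (v(j := x)) (\<sigma> (k + i))))
          = (\<lambda>x. of_int (sign \<sigma>) * \<alpha> (\<lambda>i. v (\<sigma> i)) * \<beta> ((\<lambda>i. v (\<sigma> (k + i)))(i1 := x)))"
        by (simp only:)
      then show ?thesis
        using \<open>linear (\<lambda>x. \<beta> ((\<lambda>i. v (\<sigma> (k + i)))(i1 := x)))\<close>
        by (simp only: linear_iff) (simp add: algebra_simps)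
    qed
  qed
  have "linear (\<lambda>x. \<Sum>\<sigma> | \<sigma> permutes {..<k + l}. of_int (sign \<sigma>) * \<alpha> (\<lambda>i. (v(j := x)) (\<sigma> i)) *
      \<beta> (\<lambda>i. (v(j := x)) (\<sigma> (k + i))))" (is "linear ?G")
    by (rule linear_compose_sum) (use * in blast)
  then have "linear (\<lambda>x. ?G x / (fact k * fact l))"
    by (simp only: linear_iff) (simp add: add_divide_distrib)
  then show "linear (\<lambda>x. wedge k l \<alpha> \<beta> (v(j := x)))"
    by (simp only: wedge_def)
qed

lemma multilinear_form2:
  assumes "bilinear \<beta>"
  shows "multilinear_form 2 (form2 \<beta>)"
  unfolding multilinear_form_def
proof (intro allI impI)
  fix j :: nat and v :: "nat \<Rightarrow> 'a" assume "j < 2"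
  then have "j = 0 \<or> j = 1" by auto
  then show "linear (\<lambda>x. form2 \<beta> (v(j := x)))"
    using assms by (auto simp: form2_def bilinear_def)
qed

lemma multilinear_wedge_power:
  assumes "bilinear \<beta>"
  shows "multilinear_form (2 * m) (wedge_power m (form2 \<beta>))"
proof (induction m)
  case 0
  then show ?case by (simp add: multilinear_form_def)
next
  case (Suc m)
  have "multilinear_form (2 + 2 * m) (wedge 2 (2 * m) (form2 \<beta>) (wedge_power m (form2 \<beta>)))"
    by (rule multilinear_form_wedge[OF multilinear_form2[OF assms] Suc]) (simp add: form2_def)
  then show ?case by simp
qed

text \<open>In every summand \<open>\<sigma>\<close> puts \<open>z\<close> either among the two
  arguments of \<open>\<beta>\<close> or among those of the smaller power, so by induction all
  summands vanish.\<close>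

lemma wedge_power_kernel:
  assumes "\<And>x. \<beta> z x = 0" "\<And>x. \<beta> x z = 0" "j < 2 * m" "v j = z"
  shows "wedge_power m (form2 \<beta>) v = 0"
  using assms(3,4)
proof (induction m arbitrary: j v)
  case 0
  then show ?case by simp
next
  case (Suc m)
  have *: "of_int (sign \<sigma>) * form2 \<beta> (\<lambda>i. v (\<sigma> i)) * wedge_power m (form2 \<beta>) (\<lambda>i. v (\<sigma> (2 + i))) = 0"
    if s: "\<sigma> permutes {..<2 + 2 * m}" for \<sigma>
  proof -
    obtain i0 where i0: "i0 < 2 + 2 * m" "\<sigma> i0 = j"
      using s Suc.prems(1) permutes_in_image[OF s, of "inv \<sigma> j"]
      by (metis add.commute lessThan_iff mult_Suc_right permutes_inverses(1))
    consider "i0 = 0" | "i0 = 1" | i1 where "i0 = 2 + i1" "i1 < 2 * m"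
      using i0(1) by (metis One_nat_def add_2_eq_Suc less_2_cases_iff add_less_cancel_left le_Suc_ex not_less)
    then show ?thesis
    proof cases
      case 3
      have "wedge_power m (form2 \<beta>) (\<lambda>i. v (\<sigma> (2 + i))) = 0"
        by (rule Suc.IH[where j=i1]) (use 3 i0 Suc.prems in auto)
      then show ?thesis by simp
    qed (use i0 Suc.prems assms(1,2) in \<open>auto simp: form2_def\<close>)
  qed
  have "(\<Sum>\<sigma> | \<sigma> permutes {..<2 + 2 * m}.
      of_int (sign \<sigma>) * form2 \<beta> (\<lambda>i. v (\<sigma> i)) * wedge_power m (form2 \<beta>) (\<lambda>i. v (\<sigma> (2 + i)))) = 0"
    by (intro sum.neutral ballI) (use * in blast)
  then show ?case
    by (simp only: wedge_power.simps wedge_def div_0)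
qed

lemma wedge_contact_kernel:
  assumes "\<And>x. \<beta> z x = 0" "\<And>x. \<beta> x z = 0" "\<alpha> z = 0" "j < 1 + 2 * m" "v j = z"
  shows "wedge 1 (2 * m) (form1 \<alpha>) (wedge_power m (form2 \<beta>)) v = 0"
proof -
  have *: "of_int (sign \<sigma>) * form1 \<alpha> (\<lambda>i. v (\<sigma> i)) * wedge_power m (form2 \<beta>) (\<lambda>i. v (\<sigma> (1 + i))) = 0"
    if s: "\<sigma> permutes {..<1 + 2 * m}" for \<sigma>
  proof -
    obtain i0 where i0: "i0 < 1 + 2 * m" "\<sigma> i0 = j"
      using s assms(4) permutes_in_image[OF s, of "inv \<sigma> j"] by (metis lessThan_iff permutes_inverses(1))
    show ?thesis
    proof (cases i0)
      case 0
      then show ?thesis using i0 assms by (auto simp: form1_def)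
    next
      case (Suc i1)
      then have "wedge_power m (form2 \<beta>) (\<lambda>i. v (\<sigma> (1 + i))) = 0"
        by (intro wedge_power_kernel[where z=z and j=i1]) (use i0 assms in auto)
      then show ?thesis by simp
    qed
  qed
  have "(\<Sum>\<sigma> | \<sigma> permutes {..<1 + 2 * m}.
      of_int (sign \<sigma>) * form1 \<alpha> (\<lambda>i. v (\<sigma> i)) * wedge_power m (form2 \<beta>) (\<lambda>i. v (\<sigma> (1 + i)))) = 0"
    by (intro sum.neutral ballI) (use * in blast)
  then show ?thesis
    by (simp only: wedge_def div_0)
qed

lemma alternating_form_repeat:
  assumes "alternating_form k f" "i < k" "j < k" "i \<noteq> j" "v i = v j"
  shows "f v = 0"
proof -
  have "Transposition.transpose i j permutes {..<k}"
    using assms by (intro permutes_swap_id) auto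
  then have "f (\<lambda>l. v (Transposition.transpose i j l)) = of_int (sign (Transposition.transpose i j)) * f v"
    using assms(1) by (simp add: alternating_form_def)
  moreover have "(\<lambda>l. v (Transposition.transpose i j l)) = v"
    using assms(5) by (auto simp: fun_eq_iff Transposition.transpose_def)
  ultimately show ?thesis using assms(4) by (simp add: sign_swap_id)
qed

text \<open>After expanding slot \<open>j\<close>, every term with \<open>i \<noteq> j\<close>
  repeats a vector. A linear relation with nonzero coefficient \<open>c j\<close> can thus decide
  whether \<open>f v\<close> vanishes.\<close>

lemma multilinear_form_sum:
  assumes "multilinear_form k f" "alternating_form k f" "j < k"
  shows "f (v(j := \<Sum>i<k. c i *\<^sub>R v i)) = c j * f v"
proof -
  have lin: "linear (\<lambda>x. f (v(j := x)))" using assms by (simp add: multilinear_form_def)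
  have "f (v(j := v i)) = 0" if "i < k" "i \<noteq> j" for i
    by (rule alternating_form_repeat[OF assms(2) that(1) assms(3)]) (use that in auto)
  then have "c i * f (v(j := v i)) = (if i = j then c j * f v else 0)" if "i < k" for i
    using that by (cases "i = j") auto
  then show ?thesis
    using assms(3) by (simp add: linear_sum[OF lin] linear_scale[OF lin])
qed

text \<open>Distinct entries are \<open>k\<close> vectors in dimension \<open>k\<close>. If they are
  independent, \<open>z\<close> is a combination of them; if not, 0 is a nontrivial combination.
  Either way \<open>f\<close> vanishes once a slot \<open>j\<close> with nonzero coefficient is
  replaced by the combination, and \<open>multilinear_form_sum\<close> gives
  \<open>c j * f v = 0\<close>.\<close>

lemma alternating_form_top_degree_eq_0:
  fixes f :: "('v::euclidean_space, real) form"
  assumes ml: "multilinear_form k f" and alt: "alternating_form k f" and k: "DIM('v) = k"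
    and z: "z \<noteq> 0" and ker: "\<And>v j. j < k \<Longrightarrow> v j = z \<Longrightarrow> f v = 0"
  shows "f v = 0"
proof (cases "inj_on v {..<k}")
  case False
  then obtain i j where "i < k" "j < k" "i \<noteq> j" "v i = v j" by (auto simp: inj_on_def)
  then show ?thesis by (rule alternating_form_repeat[OF alt])
next
  case inj: True
  let ?B = "v ` {..<k}"
  have sum: "(\<Sum>b\<in>?B. u b *\<^sub>R b) = (\<Sum>i<k. u (v i) *\<^sub>R v i)" for u
    using sum.reindex[OF inj] by (simp add: o_def)
  have "\<exists>c j. j < k \<and> c j \<noteq> 0 \<and> f (v(j := \<Sum>i<k. c i *\<^sub>R v i)) = 0"
  proof (cases "independent ?B")
    case True
    have "card ?B = k" using inj by (simp add: card_image)
    then have "span ?B = UNIV"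
      using True k by (metis card_eq_dim dim_UNIV independent_imp_finite order_refl span_UNIV
          subset_UNIV top.extremum_uniqueI)
    then obtain u where u: "z = (\<Sum>b\<in>?B. u b *\<^sub>R b)"
      using span_finite[of ?B] by (auto simp: set_eq_iff)
    then have "(\<Sum>i<k. u (v i) *\<^sub>R v i) \<noteq> 0" using z sum by metis
    then obtain j where "j < k" "u (v j) \<noteq> 0"
      by (metis (no_types, lifting) lessThan_iff scaleR_eq_0_iff sum.neutral)
    moreover have "f (v(j := \<Sum>i<k. u (v i) *\<^sub>R v i)) = 0"
      by (rule ker[OF \<open>j < k\<close>]) (simp add: u sum)
    ultimately show ?thesis by (intro exI[of _ "\<lambda>i. u (v i)"] exI[of _ j]) auto
  next
    case False
    then obtain u b where u: "b \<in> ?B" "u b \<noteq> 0" "(\<Sum>b\<in>?B. u b *\<^sub>R b) = 0"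
      by (auto simp: dependent_finite)
    then obtain j where j: "j < k" "u (v j) \<noteq> 0" by auto
    have "linear (\<lambda>x. f (v(j := x)))" using ml j by (simp add: multilinear_form_def)
    from linear_0[OF this] show ?thesis
      using j u(3) by (intro exI[of _ "\<lambda>i. u (v i)"] exI[of _ j]) (auto simp: sum)
  qed
  then show ?thesis using multilinear_form_sum[OF ml alt] by auto
qed

lemma wedge_power_degenerate:
  fixes \<beta> :: "'v::euclidean_space \<Rightarrow> 'v \<Rightarrow> real"
  assumes "bilinear \<beta>" "\<And>x. \<beta> z x = 0" "\<And>x. \<beta> x z = 0" "z \<noteq> 0" "DIM('v) = 2 * m"
  shows "wedge_power m (form2 \<beta>) v = 0"
  by (rule alternating_form_top_degree_eq_0[OF multilinear_wedge_power[OF assms(1)] _ assms(5,4)])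
     (auto simp: alternating_form_def wedge_power_permute intro!: wedge_power_kernel[where z=z] assms(2,3))

lemma wedge_contact_degenerate:
  fixes \<beta> :: "'v::euclidean_space \<Rightarrow> 'v \<Rightarrow> real"
  assumes "bilinear \<beta>" "linear \<alpha>" "\<And>x. \<beta> z x = 0" "\<And>x. \<beta> x z = 0" "\<alpha> z = 0" "z \<noteq> 0"
    and "DIM('v) = 2 * m + 1"
  shows "wedge 1 (2 * m) (form1 \<alpha>) (wedge_power m (form2 \<beta>)) v = 0"
proof (rule alternating_form_top_degree_eq_0[where k="1 + 2 * m" and z=z])
  have "multilinear_form 1 (form1 \<alpha>)"
    using assms(2) by (auto simp: multilinear_form_def form1_def)
  then show "multilinear_form (1 + 2 * m) (wedge 1 (2 * m) (form1 \<alpha>) (wedge_power m (form2 \<beta>)))"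
    by (intro multilinear_form_wedge multilinear_wedge_power assms) (auto simp: form1_def)
  show "alternating_form (1 + 2 * m) (wedge 1 (2 * m) (form1 \<alpha>) (wedge_power m (form2 \<beta>)))"
    by (simp add: alternating_form_def wedge_permute[where k=1, simplified])
  show "wedge 1 (2 * m) (form1 \<alpha>) (wedge_power m (form2 \<beta>)) v = 0"
    if "j < 1 + 2 * m" "v j = z" for v j
    by (rule wedge_contact_kernel[where \<beta>=\<beta> and z=z and j=j]) (use assms that in auto)
qed (use assms in auto)

text \<open>Peels off the head of a permutation, so that summands of a wedge whose
  \<open>\<sigma>\<close> fixes the first slots reduce to \<open>wedge_power_permute\<close> on the
  rest. The signs agree because \<open>\<tau>\<close> is the image of \<open>\<rho>\<close> under
  the shift \<open>(+) k\<close>.\<close>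

lemma permutes_fixing_initial_segment:
  fixes \<tau> :: "nat \<Rightarrow> nat"
  assumes \<tau>: "\<tau> permutes {..<k + l}" and fix_k: "\<And>i. i < k \<Longrightarrow> \<tau> i = i"
  obtains \<rho> where "\<rho> permutes {..<l}" "sign \<rho> = sign \<tau>" "\<And>i. \<tau> (k + i) = k + \<rho> i"
proof -
  let ?\<rho> = "\<lambda>i. \<tau> (k + i) - k"
  have inj: "\<tau> a = \<tau> b \<longleftrightarrow> a = b" for a b using \<tau> by (metis permutes_inj inj_eq)
  have ge: "\<tau> (k + i) \<ge> k" for i
    by (metis fix_k inj leI le_add1 not_less)
  have \<rho>: "\<tau> (k + i) = k + ?\<rho> i" for i using ge[of i] by simp
  have perm: "?\<rho> permutes {..<l}"
  proof (rule bij_imp_permutes)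
    have "inj_on ?\<rho> {..<l}"
      by (rule inj_onI) (metis \<rho> inj add_left_cancel)
    moreover have "?\<rho> ` {..<l} \<subseteq> {..<l}"
    proof safe
      fix i assume "i < l"
      then have "\<tau> (k + i) < k + l" using permutes_in_image[OF \<tau>, of "k + i"] by simp
      then show "?\<rho> i < l" using ge[of i] by linarith
    qed
    ultimately show "bij_betw ?\<rho> {..<l} {..<l}"
      by (simp add: bij_betw_def endo_inj_surj)
    fix i assume "i \<notin> {..<l}"
    then show "?\<rho> i = i" using permutes_not_in[OF \<tau>, of "k + i"] by simp
  qed
  have "map_permutation {..<l} ((+) k) ?\<rho> = \<tau>"
  proof
    fix x
    have im: "x \<in> (+) k ` {..<l} \<longleftrightarrow> k \<le> x \<and> x < k + l"
      by (auto intro!: image_eqI[of _ _ "x - k"])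
    show "map_permutation {..<l} ((+) k) ?\<rho> x = \<tau> x"
    proof (cases "x \<in> (+) k ` {..<l}")
      case True
      then obtain i where i: "i < l" "x = k + i" by auto
      then have "inv_into {..<l} ((+) k) x = i" by (simp add: inv_into_f_f)
      then show ?thesis using True i by (simp add: map_permutation_def restrict_id_def ge)
    next
      case False
      then have "\<tau> x = x" using im fix_k permutes_not_in[OF \<tau>, of x] by (cases "x < k") auto
      then show ?thesis using False by (simp add: map_permutation_def restrict_id_def)
    qed
  qed
  then have "sign ?\<rho> = sign \<tau>"
    using sign_map_permutation[OF _ perm, of "(+) k"] by simp
  then show ?thesis using that[of ?\<rho>] perm \<rho> by blast
qed

text \<open>A symplectic basis up to positive rescaling: the entries \<open>2 * i\<close> and
  \<open>2 * i + 1\<close> span hyperbolic planes, and distinct planes are orthogonal.\<close>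

definition symplectic_seq :: "nat \<Rightarrow> ('v \<Rightarrow> 'v \<Rightarrow> real) \<Rightarrow> (nat \<Rightarrow> 'v) \<Rightarrow> bool" where
  "symplectic_seq m \<beta> v \<longleftrightarrow> (\<forall>i<m. \<beta> (v (2 * i)) (v (2 * i + 1)) > 0) \<and>
     (\<forall>i<2 * m. \<forall>j<2 * m. i div 2 \<noteq> j div 2 \<longrightarrow> \<beta> (v i) (v j) = 0)"

text \<open>The reindexing exchanges pair 0 with pair \<open>k\<close> and keeps the position inside
  each pair.\<close>

lemma symplectic_seq_swap_pairs:
  assumes "symplectic_seq m \<beta> v" "0 < m" "k < m"
  shows "symplectic_seq m \<beta> (\<lambda>i. v (2 * Transposition.transpose 0 k (i div 2) + i mod 2))"
proof -
  have t: "Transposition.transpose 0 k i < m" if "i < m" for i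
    using that assms by (auto simp: Transposition.transpose_def)
  have inj: "Transposition.transpose 0 k i = Transposition.transpose 0 k j \<longleftrightarrow> i = j" for i j
    by (auto simp: Transposition.transpose_def split: if_splits)
  have lt: "2 * Transposition.transpose 0 k (i div 2) + i mod 2 < 2 * m" if "i < 2 * m" for i
    using t[of "i div 2"] that mod_less_divisor[of 2 i] by linarith
  show ?thesis
    using assms(1) t lt unfolding symplectic_seq_def by (auto simp: inj)
qed

text \<open>No summand is negative. It vanishes unless \<open>\<sigma>\<close> sends 0 and 1 into
  one pair; reversing that pair flips both the sign of \<open>\<sigma>\<close> and the value of
  \<open>\<beta>\<close>, so the ordered case suffices. There the remaining factor is
  \<open>sign \<sigma>\<close> times its value on a symplectic sequence of the other pairs, and the
  two signs cancel. The identity contributes a strictly positive summand.\<close>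

lemma wedge_power_symplectic_pos:
  assumes anti: "\<And>x y. \<beta> x y = - \<beta> y x" and "symplectic_seq m \<beta> v"
  shows "wedge_power m (form2 \<beta>) v > 0"
  using assms(2)
proof (induction m arbitrary: v)
  case 0
  then show ?case by simp
next
  case (Suc m)
  note sv = Suc.prems
  let ?S = "{..<2 + 2 * m}"
  let ?T = "\<lambda>\<sigma>. of_int (sign \<sigma>) * \<beta> (v (\<sigma> 0)) (v (\<sigma> 1)) * wedge_power m (form2 \<beta>) (\<lambda>i. v (\<sigma> (2 + i)))"
  have main: "?T \<sigma> > 0" if s: "\<sigma> permutes ?S" and k: "\<sigma> 0 = 2 * k" "\<sigma> 1 = 2 * k + 1" for \<sigma> k
  proof -
    have "\<sigma> 0 < 2 + 2 * m" using permutes_in_image[OF s, of 0] by simp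
    then have km: "k < Suc m" using k by simp
    \<comment> \<open>\<open>\<rho>\<close> moves pair \<open>k\<close> to the front. By
      \<open>\<rho>'\<close> it is a product of two transpositions (both trivial for
      \<open>k = 0\<close>), hence even, so composing with it preserves the sign of
      \<open>\<sigma>\<close>.\<close>
    define \<rho> where "\<rho> = (\<lambda>i. 2 * Transposition.transpose 0 k (i div 2) + i mod 2)"
    define \<rho>' where "\<rho>' = Transposition.transpose 0 (2 * k) \<circ> Transposition.transpose 1 (2 * k + 1)"
    have \<rho>: "\<rho> = \<rho>'"
    proof
      fix i show "\<rho> i = \<rho>' i"
        unfolding \<rho>_def \<rho>'_def Transposition.transpose_def o_def
        by (cases "even i") (auto elim!: evenE oddE)
    qed
    have \<rho>S: "\<rho> permutes ?S" unfolding \<rho> \<rho>'_def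
      using km by (intro permutes_compose permutes_swap_id) auto
    have \<rho>\<rho>: "\<rho> (\<rho> i) = i" for i by (simp add: \<rho>_def)
    have "sign \<rho> = 1" unfolding \<rho> \<rho>'_def
      by (subst sign_compose) (auto simp: sign_swap_id permutation_swap_id)
    define \<tau> where "\<tau> = \<rho> \<circ> \<sigma>"
    have \<tau>S: "\<tau> permutes ?S" unfolding \<tau>_def using s \<rho>S by (rule permutes_compose)
    have sgn: "sign \<tau> = sign \<sigma>" unfolding \<tau>_def
      using s \<rho>S \<open>sign \<rho> = 1\<close> by (subst sign_compose) (auto simp: permutation_permutes)
    have "\<tau> i = i" if "i < 2" for i
      using that k by (auto simp: \<tau>_def \<rho>_def less_2_cases_iff)
    then obtain \<tau>' where \<tau>': "\<tau>' permutes {..<2 * m}" "sign \<tau>' = sign \<tau>" "\<And>i. \<tau> (2 + i) = 2 + \<tau>' i"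
      using permutes_fixing_initial_segment[OF \<tau>S] by metis
    define w where "w = (\<lambda>i. v (\<rho> i))"
    have sw: "symplectic_seq (Suc m) \<beta> w"
      unfolding w_def \<rho>_def using symplectic_seq_swap_pairs[OF sv _ km] by simp
    have "symplectic_seq m \<beta> (\<lambda>i. w (2 + i))"
      unfolding symplectic_seq_def
    proof (intro conjI allI impI)
      fix i assume "i < m" then show "0 < \<beta> (w (2 + 2 * i)) (w (2 + (2 * i + 1)))"
        using sw[unfolded symplectic_seq_def, THEN conjunct1, rule_format, of "Suc i"] by simp
    next
      fix i j assume "i < 2 * m" "j < 2 * m" "i div 2 \<noteq> j div 2"
      then show "\<beta> (w (2 + i)) (w (2 + j)) = 0"
        using sw[unfolded symplectic_seq_def, THEN conjunct2, rule_format, of "2 + i" "2 + j"] by simp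
    qed
    then have pos: "wedge_power m (form2 \<beta>) (\<lambda>i. w (2 + i)) > 0" by (rule Suc.IH)
    have "(\<lambda>i. v (\<sigma> (2 + i))) = (\<lambda>i. w (2 + \<tau>' i))"
      by (simp add: w_def \<tau>'(3)[symmetric] \<tau>_def \<rho>\<rho> del: add_2_eq_Suc)
    then have "wedge_power m (form2 \<beta>) (\<lambda>i. v (\<sigma> (2 + i))) =
        of_int (sign \<sigma>) * wedge_power m (form2 \<beta>) (\<lambda>i. w (2 + i))"
      using wedge_power_permute[OF \<tau>'(1), of "form2 \<beta>" "\<lambda>i. w (2 + i)"] \<tau>'(2) sgn by simp
    then have "?T \<sigma> = (of_int (sign \<sigma>) * of_int (sign \<sigma>)) * \<beta> (v (\<sigma> 0)) (v (\<sigma> 1)) *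
        wedge_power m (form2 \<beta>) (\<lambda>i. w (2 + i))" by simp
    also have "of_int (sign \<sigma>) * of_int (sign \<sigma>) = (1 :: real)"
      by (metis of_int_1 of_int_mult sign_idempotent)
    finally have "?T \<sigma> = \<beta> (v (\<sigma> 0)) (v (\<sigma> 1)) * wedge_power m (form2 \<beta>) (\<lambda>i. w (2 + i))"
      by (simp only: mult_1)
    moreover have "\<beta> (v (\<sigma> 0)) (v (\<sigma> 1)) > 0"
      using sv k km unfolding symplectic_seq_def by (simp only:)
    ultimately show ?thesis using pos by (metis mult_pos_pos)
  qed
  have nonneg: "?T \<sigma> \<ge> 0" if s: "\<sigma> permutes ?S" for \<sigma>
  proof (cases "\<beta> (v (\<sigma> 0)) (v (\<sigma> 1)) = 0")
    case False
    have lt: "\<sigma> 0 < 2 + 2 * m" "\<sigma> 1 < 2 + 2 * m"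
      using permutes_in_image[OF s, of 0] permutes_in_image[OF s, of 1] by auto
    have "\<sigma> 0 \<noteq> \<sigma> 1" by (metis permutes_inj[OF s] inj_eq zero_neq_one)
    moreover have "\<sigma> 0 div 2 = \<sigma> 1 div 2"
      using sv False lt by (auto simp: symplectic_seq_def)
    ultimately consider k where "\<sigma> 0 = 2 * k" "\<sigma> 1 = 2 * k + 1" | k where "\<sigma> 1 = 2 * k" "\<sigma> 0 = 2 * k + 1"
      by (metis div_mult_mod_eq mod2_eq_if mult.commute add.right_neutral)
    then show ?thesis
    proof cases
      case 1
      then show ?thesis by (rule less_imp_le[OF main[OF s]])
    next
      case 2
      let ?\<sigma> = "\<sigma> \<circ> Transposition.transpose 0 1"
      have tp: "Transposition.transpose 0 1 permutes ?S" by (intro permutes_swap_id) auto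
      have "?\<sigma> permutes ?S" by (rule permutes_compose[OF tp s])
      moreover have "?\<sigma> 0 = 2 * k" "?\<sigma> 1 = 2 * k + 1" using 2 by (auto simp: o_def)
      ultimately have "?T ?\<sigma> > 0" by (rule main)
      moreover have "sign ?\<sigma> = - sign \<sigma>"
        using sign_compose[OF _ permutation_swap_id, of \<sigma> 0 1] s
        by (auto simp: permutation_permutes sign_swap_id)
      moreover have "\<beta> (v (?\<sigma> 0)) (v (?\<sigma> 1)) = - \<beta> (v (\<sigma> 0)) (v (\<sigma> 1))"
        using anti[of "v (\<sigma> 1)" "v (\<sigma> 0)"] by (simp add: o_def)
      moreover have "?\<sigma> (2 + i) = \<sigma> (2 + i)" for i by (simp add: o_def)
      ultimately show ?thesis by simp
    qed
  qed simp
  have id: "?T id > 0" by (rule main[of id 0]) auto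
  have "(\<Sum>\<sigma> | \<sigma> permutes ?S. ?T \<sigma>) > 0"
    by (rule sum_pos2[where i=id]) (use id nonneg in \<open>auto simp: finite_permutations permutes_id\<close>)
  moreover have "form2 \<beta> (\<lambda>i. v (\<sigma> i)) = \<beta> (v (\<sigma> 0)) (v (\<sigma> 1))" for \<sigma>
    by (simp add: form2_def)
  ultimately show ?case
    by (simp only: wedge_power.simps wedge_def) simp
qed

text \<open>Since \<open>\<alpha>\<close> vanishes on all entries but the zeroth, only permutations
  fixing 0 contribute, each by the same positive amount.\<close>

lemma wedge_contact_symplectic_pos:
  assumes anti: "\<And>x y. \<beta> x y = - \<beta> y x" and sv: "symplectic_seq m \<beta> (\<lambda>i. v (1 + i))"
    and v0: "\<alpha> (v 0) > 0" and v1: "\<And>i. 0 < i \<Longrightarrow> i < 1 + 2 * m \<Longrightarrow> \<alpha> (v i) = 0"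
  shows "wedge 1 (2 * m) (form1 \<alpha>) (wedge_power m (form2 \<beta>)) v > 0"
proof -
  let ?S = "{..<1 + 2 * m}"
  let ?T = "\<lambda>\<sigma>. of_int (sign \<sigma>) * \<alpha> (v (\<sigma> 0)) * wedge_power m (form2 \<beta>) (\<lambda>i. v (\<sigma> (1 + i)))"
  have pos: "wedge_power m (form2 \<beta>) (\<lambda>i. v (1 + i)) > 0"
    by (rule wedge_power_symplectic_pos[OF anti sv])
  have main: "?T \<sigma> > 0" if s: "\<sigma> permutes ?S" and k: "\<sigma> 0 = 0" for \<sigma>
  proof -
    obtain \<tau> where \<tau>: "\<tau> permutes {..<2 * m}" "sign \<tau> = sign \<sigma>" "\<And>i. \<sigma> (1 + i) = 1 + \<tau> i"
      using permutes_fixing_initial_segment[OF s] k by (metis less_one)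
    have "wedge_power m (form2 \<beta>) (\<lambda>i. v (\<sigma> (1 + i))) =
        of_int (sign \<sigma>) * wedge_power m (form2 \<beta>) (\<lambda>i. v (1 + i))"
      using wedge_power_permute[OF \<tau>(1), of "form2 \<beta>" "\<lambda>i. v (1 + i)"] \<tau>(2,3) by simp
    then have "?T \<sigma> = (of_int (sign \<sigma>) * of_int (sign \<sigma>)) * \<alpha> (v (\<sigma> 0)) *
        wedge_power m (form2 \<beta>) (\<lambda>i. v (1 + i))" by simp
    also have "of_int (sign \<sigma>) * of_int (sign \<sigma>) = (1 :: real)"
      by (metis of_int_1 of_int_mult sign_idempotent)
    finally have "?T \<sigma> = \<alpha> (v 0) * wedge_power m (form2 \<beta>) (\<lambda>i. v (1 + i))"
      by (simp only: mult_1 k)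
    then show ?thesis using pos v0 by (metis mult_pos_pos)
  qed
  have nonneg: "?T \<sigma> \<ge> 0" if s: "\<sigma> permutes ?S" for \<sigma>
  proof (cases "\<sigma> 0 = 0")
    case True
    then show ?thesis using main[OF s] by linarith
  next
    case False
    moreover have "\<sigma> 0 < 1 + 2 * m" using permutes_in_image[OF s, of 0] by simp
    ultimately show ?thesis using v1[of "\<sigma> 0"] by simp
  qed
  have "(\<Sum>\<sigma> | \<sigma> permutes ?S. ?T \<sigma>) > 0"
    by (rule sum_pos2[where i=id]) (use main[of id] nonneg in \<open>auto simp: finite_permutations permutes_id\<close>)
  then show ?thesis
    by (simp add: wedge_def form1_def)
qed

lemma wedge_power_of_real:
  "wedge_power m (form2 (\<lambda>a b. complex_of_real (\<beta> a b))) v = complex_of_real (wedge_power m (form2 \<beta>) v)"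
proof (induction m arbitrary: v)
  case (Suc m)
  then show ?case by (simp add: wedge_def form2_def)
qed simp


text \<open>Symplectic Gram-Schmidt: a hyperbolic plane spanned by \<open>e\<close> and
  \<open>f\<close> is split off, and the induction continues in its orthogonal complement
  \<open>S'\<close> inside \<open>S\<close>, of dimension two less.\<close>

lemma symplectic_seq_exists:
  fixes \<beta> :: "'v::euclidean_space \<Rightarrow> 'v \<Rightarrow> real"
  assumes bl: "bilinear \<beta>" and anti: "\<And>x y. \<beta> x y = - \<beta> y x"
    and "subspace S" "\<And>x. x \<in> S \<Longrightarrow> x \<noteq> 0 \<Longrightarrow> \<exists>y\<in>S. \<beta> x y \<noteq> 0"
  shows "\<exists>m v. dim S = 2 * m \<and> (\<forall>i<2 * m. v i \<in> S) \<and> symplectic_seq m \<beta> v"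
  using assms(3,4)
proof (induction "dim S" arbitrary: S rule: less_induct)
  case less
  show ?case
  proof (cases "S \<subseteq> {0}")
    case True
    then have "dim S = 0" by simp
    then show ?thesis by (intro exI[of _ 0]) (simp add: symplectic_seq_def)
  next
    case False
    note [simp] = bilinear_ladd[OF bl] bilinear_radd[OF bl] bilinear_lmul[OF bl] bilinear_rmul[OF bl]
      bilinear_lzero[OF bl] bilinear_rzero[OF bl] bilinear_lsub[OF bl] bilinear_rsub[OF bl]
    have self: "\<beta> x x = 0" for x using anti[of x x] by simp
    obtain e f0 where e: "e \<in> S" "e \<noteq> 0" "f0 \<in> S" "\<beta> e f0 \<noteq> 0" using False less.prems(2) by blast
    define f where "f = (1 / \<beta> e f0) *\<^sub>R f0"
    have f: "f \<in> S" "\<beta> e f = 1" using e less.prems(1) by (auto simp: f_def subspace_scale)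
    have fe: "\<beta> f e = - 1" using anti[of f e] f(2) by simp
    define S' where "S' = {x \<in> S. \<beta> e x = 0 \<and> \<beta> f x = 0}"
    have S': "subspace S'"
      using less.prems(1) by (auto simp: S'_def subspace_def)
    have "e \<noteq> f" using f self by (metis zero_neq_one)
    have ind: "independent {e, f}"
    proof -
      have "e \<notin> span {f}"
      proof
        assume "e \<in> span {f}"
        then obtain c where "e = c *\<^sub>R f" by (auto simp: span_singleton)
        then have "\<beta> e f = 0" using self by simp
        then show False using f by simp
      qed
      moreover have "f \<noteq> 0" using f by auto
      ultimately show ?thesis using \<open>e \<noteq> f\<close> by (simp add: independent_insert)
    qed
    have d2: "dim (span {e, f}) = 2"
      using dim_eq_card_independent[OF ind] \<open>e \<noteq> f\<close> by simp
    have span_ef: "span {e, f} = {a *\<^sub>R e + b *\<^sub>R f | a b. True}"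
    proof (intro subset_antisym subsetI)
      fix x assume "x \<in> span {e, f}"
      then obtain a b where "x - a *\<^sub>R e = b *\<^sub>R f" by (auto simp: span_breakdown_eq)
      then have "x = a *\<^sub>R e + b *\<^sub>R f" by (simp add: algebra_simps)
      then show "x \<in> {a *\<^sub>R e + b *\<^sub>R f | a b. True}" by blast
    next
      fix x assume "x \<in> {a *\<^sub>R e + b *\<^sub>R f | a b. True}"
      moreover have "e \<in> span {e, f}" "f \<in> span {e, f}" by (auto intro: span_base)
      ultimately show "x \<in> span {e, f}" by (auto intro: span_add span_scale)
    qed
    have sums: "{x + y | x y. x \<in> span {e, f} \<and> y \<in> S'} = S"
    proof (intro subset_antisym subsetI)
      fix z assume "z \<in> {x + y | x y. x \<in> span {e, f} \<and> y \<in> S'}"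
      then show "z \<in> S"
        using less.prems(1) e f by (auto simp: span_ef S'_def intro!: subspace_add subspace_scale)
    next
      fix z assume z: "z \<in> S"
      \<comment> \<open>The projection of \<open>z\<close> to the plane along \<open>S'\<close>; the
        coefficients are forced by \<open>\<beta> e f = 1\<close> and
        \<open>\<beta> f e = - 1\<close>.\<close>
      let ?x = "(- \<beta> f z) *\<^sub>R e + \<beta> e z *\<^sub>R f"
      have "z - ?x \<in> S'"
        using z e f fe self less.prems(1)
        by (auto simp: S'_def intro!: subspace_diff subspace_add subspace_scale simp del: scaleR_minus_left)
      moreover have "?x \<in> span {e, f}" unfolding span_ef by blast
      ultimately show "z \<in> {x + y | x y. x \<in> span {e, f} \<and> y \<in> S'}"
        by (intro CollectI exI[of _ ?x] exI[of _ "z - ?x"]) simp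
    qed
    have "x = 0" if "x \<in> span {e, f}" "x \<in> S'" for x
      using that fe f self by (auto simp: span_ef S'_def)
    then have "span {e, f} \<inter> S' = {0}"
      using subspace_0[OF S'] span_0 by blast
    then have dims: "dim S = 2 + dim S'"
      using dim_sums_Int[OF subspace_span[of "{e, f}"] S'] d2 sums by simp
    have nd: "\<exists>y\<in>S'. \<beta> x y \<noteq> 0" if x: "x \<in> S'" "x \<noteq> 0" for x
    proof -
      obtain y where y: "y \<in> S" "\<beta> x y \<noteq> 0" using x less.prems(2) by (auto simp: S'_def)
      \<comment> \<open>\<open>x\<close> is orthogonal to the plane, so moving a partner
        \<open>y\<close> of \<open>x\<close> into \<open>S'\<close> does not change their
        pairing.\<close>
      let ?x = "(- \<beta> f y) *\<^sub>R e + \<beta> e y *\<^sub>R f"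
      have "y - ?x \<in> S'"
        using y e f fe self less.prems(1)
        by (auto simp: S'_def intro!: subspace_diff subspace_add subspace_scale simp del: scaleR_minus_left)
      moreover have "\<beta> x e = 0" "\<beta> x f = 0" using that anti[of x e] anti[of x f] by (auto simp: S'_def)
      then have "\<beta> x (y - ?x) = \<beta> x y" by simp
      ultimately show ?thesis using y(2) by (intro bexI[of _ "y - ?x"]) simp_all
    qed
    obtain m v where mv: "dim S' = 2 * m" "\<And>i. i < 2 * m \<Longrightarrow> v i \<in> S'" "symplectic_seq m \<beta> v"
      using less.hyps[OF _ S' nd] dims by auto
    define w where "w = (\<lambda>i. if i = 0 then e else if i = 1 then f else v (i - 2))"
    have perp: "\<beta> (w i) (w j) = 0" if "i < 2" "2 \<le> j" "j < 2 * Suc m" for i j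
      using mv(2)[of "j - 2"] that by (auto simp: w_def S'_def less_2_cases_iff)
    have "symplectic_seq (Suc m) \<beta> w"
      unfolding symplectic_seq_def
    proof (intro conjI allI impI)
      fix i assume "i < Suc m"
      then show "0 < \<beta> (w (2 * i)) (w (2 * i + 1))"
        using mv(3) f by (cases i) (auto simp: w_def symplectic_seq_def)
    next
      fix i j assume ij: "i < 2 * Suc m" "j < 2 * Suc m" "i div 2 \<noteq> j div 2"
      consider "i < 2" "2 \<le> j" | "j < 2" "2 \<le> i" | "2 \<le> i" "2 \<le> j" using ij(3) by fastforce
      then show "\<beta> (w i) (w j) = 0"
      proof cases
        case 1
        then show ?thesis using perp ij by blast
      next
        case 2
        then show ?thesis using perp[of j i] ij anti[of "w i" "w j"] by simp
      next
        case 3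
        then obtain i' j' where "i = i' + 2" "j = j' + 2" by (metis add.commute le_Suc_ex)
        then have "i - 2 < 2 * m" "j - 2 < 2 * m" "(i - 2) div 2 \<noteq> (j - 2) div 2" using ij by auto
        then have "\<beta> (v (i - 2)) (v (j - 2)) = 0" using mv(3) by (simp add: symplectic_seq_def)
        then show ?thesis using 3 by (simp add: w_def)
      qed
    qed
    moreover have "\<forall>i<2 * Suc m. w i \<in> S"
      using e f mv(2) by (auto simp: w_def S'_def)
    ultimately show ?thesis using dims mv(1) by (intro exI[of _ "Suc m"] exI[of _ w]) simp
  qed
qed

lemma wedge_power_nondegenerate:
  fixes \<beta> :: "'v::euclidean_space \<Rightarrow> 'v \<Rightarrow> real"
  assumes "bilinear \<beta>" "\<And>x y. \<beta> x y = - \<beta> y x" "DIM('v) = 2 * m"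
    and "\<And>x. x \<noteq> 0 \<Longrightarrow> \<exists>y. \<beta> x y \<noteq> 0"
  shows "\<exists>v. wedge_power m (form2 \<beta>) v \<noteq> 0"
proof -
  obtain m' v where "dim (UNIV :: 'v set) = 2 * m'" "symplectic_seq m' \<beta> v"
    using symplectic_seq_exists[OF assms(1,2) subspace_UNIV] assms(4) by auto
  then have "symplectic_seq m \<beta> v" using assms(3) by (simp add: dim_UNIV)
  from wedge_power_symplectic_pos[OF assms(2) this] show ?thesis by (intro exI[of _ v]) simp
qed

lemma wedge_power_eq_0_iff:
  fixes \<beta> :: "'v::euclidean_space \<Rightarrow> 'v \<Rightarrow> real"
  assumes "bilinear \<beta>" "\<And>x y. \<beta> x y = - \<beta> y x" "DIM('v) = 2 * m"
  shows "(\<forall>v. wedge_power m (form2 \<beta>) v = 0) \<longleftrightarrow> (\<exists>x. x \<noteq> 0 \<and> (\<forall>y. \<beta> x y = 0))"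
proof
  assume "\<forall>v. wedge_power m (form2 \<beta>) v = 0"
  then show "\<exists>x. x \<noteq> 0 \<and> (\<forall>y. \<beta> x y = 0)"
    using wedge_power_nondegenerate[OF assms] by blast
next
  assume "\<exists>x. x \<noteq> 0 \<and> (\<forall>y. \<beta> x y = 0)"
  then obtain x where x: "x \<noteq> 0" "\<And>y. \<beta> x y = 0" by blast
  then have "\<beta> y x = 0" for y using assms(2)[of y x] by simp
  then show "\<forall>v. wedge_power m (form2 \<beta>) v = 0"
    using wedge_power_degenerate[OF assms(1) x(2) _ x(1) assms(3)] by blast
qed

lemma dim_kernel_functional:
  fixes \<alpha> :: "'v::euclidean_space \<Rightarrow> real"
  assumes "linear \<alpha>" "\<alpha> z \<noteq> 0"
  shows "dim {x. \<alpha> x = 0} + 1 = DIM('v)"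
proof -
  have sub: "subspace {x. \<alpha> x = 0}" by (rule linear_subspace_kernel[OF assms(1)])
  have "{x + y | x y. x \<in> span {z} \<and> y \<in> {x. \<alpha> x = 0}} = UNIV"
  proof (intro subset_antisym subsetI)
    fix y :: 'v
    have "y - (\<alpha> y / \<alpha> z) *\<^sub>R z \<in> {x. \<alpha> x = 0}"
      using assms by (simp add: linear_diff[OF assms(1)] linear_scale[OF assms(1)])
    moreover have "(\<alpha> y / \<alpha> z) *\<^sub>R z \<in> span {z}" by (simp add: span_base span_scale)
    ultimately show "y \<in> {x + y | x y. x \<in> span {z} \<and> y \<in> {x. \<alpha> x = 0}}"
      by (intro CollectI exI[of _ "(\<alpha> y / \<alpha> z) *\<^sub>R z"] exI[of _ "y - (\<alpha> y / \<alpha> z) *\<^sub>R z"]) simp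
  qed simp
  moreover have "span {z} \<inter> {x. \<alpha> x = 0} = {0}"
    using assms by (auto simp: span_singleton linear_scale[OF assms(1)] linear_0[OF assms(1)])
  moreover have "z \<noteq> 0" using assms linear_0 by blast
  then have "dim (span {z}) = 1" by simp
  ultimately show ?thesis using dim_sums_Int[OF subspace_span[of "{z}"] sub] by simp
qed

text \<open>Nondegeneracy is asked only on the kernel of \<open>\<alpha>\<close>, because the form
  it is applied to, \<open>omega\<close>, is annihilated by the Reeb field. That field plays the
  role of \<open>z\<close> and fills slot 0.\<close>

lemma wedge_contact_nondegenerate:
  fixes \<beta> :: "'v::euclidean_space \<Rightarrow> 'v \<Rightarrow> real"
  assumes "bilinear \<beta>" "\<And>x y. \<beta> x y = - \<beta> y x" "linear \<alpha>" "DIM('v) = 2 * m + 1" "\<alpha> z > 0"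
    and "\<And>x. \<alpha> x = 0 \<Longrightarrow> x \<noteq> 0 \<Longrightarrow> \<exists>y. \<alpha> y = 0 \<and> \<beta> x y \<noteq> 0"
  shows "\<exists>v. wedge 1 (2 * m) (form1 \<alpha>) (wedge_power m (form2 \<beta>)) v \<noteq> 0"
proof -
  let ?S = "{x. \<alpha> x = 0}"
  have "subspace ?S" by (rule linear_subspace_kernel[OF assms(3)])
  then obtain m' v where v: "dim ?S = 2 * m'" "\<forall>i<2 * m'. v i \<in> ?S" "symplectic_seq m' \<beta> v"
    using symplectic_seq_exists[OF assms(1,2), of ?S] assms(6) by auto
  have "dim ?S + 1 = DIM('v)" by (rule dim_kernel_functional[OF assms(3), of z]) (use assms(5) in auto)
  then have m: "m' = m" using v(1) assms(4) by simp
  define w where "w = (\<lambda>i. case i of 0 \<Rightarrow> z | Suc j \<Rightarrow> v j)"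
  have "wedge 1 (2 * m) (form1 \<alpha>) (wedge_power m (form2 \<beta>)) w > 0"
    by (rule wedge_contact_symplectic_pos[OF assms(2)])
       (use v m assms(5) in \<open>auto simp: w_def split: nat.split\<close>)
  then show ?thesis by (intro exI[of _ w]) simp
qed

section \<open>Calculus of smooth maps\<close>

lemma frechet_derivativeI: "(f has_derivative f') (at x) \<Longrightarrow> frechet_derivative f (at x) = f'"
  using frechet_derivative_at by metis

lemma frechet_derivative_cong_open:
  assumes "open S" "x \<in> S" "\<And>y. y \<in> S \<Longrightarrow> f y = g y"
  shows "frechet_derivative f (at x) = frechet_derivative g (at x)"
proof -
  have "(f has_derivative D) (at x) \<longleftrightarrow> (g has_derivative D) (at x)" for D
    using has_derivative_transform_within_open[OF _ assms(1,2)] assms(3) by metis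
  then show ?thesis unfolding frechet_derivative_def by simp
qed

lemma differentiable_cong_open:
  assumes "open S" "x \<in> S" "\<And>y. y \<in> S \<Longrightarrow> f y = g y" "f differentiable (at x)"
  shows "g differentiable (at x)"
  using assms has_derivative_transform_within_open[OF _ assms(1,2)] unfolding differentiable_def by metis

lemma Ck_on_cong:
  assumes "open S" "\<And>y. y \<in> S \<Longrightarrow> f y = g y" "Ck_on k S f"
  shows "Ck_on k S g"
  using assms(2,3)
proof (induction k arbitrary: f g)
  case 0
  then show ?case by (simp add: continuous_on_eq)
next
  case (Suc k)
  have fd: "frechet_derivative f (at x) = frechet_derivative g (at x)" if "x \<in> S" for x
    by (rule frechet_derivative_cong_open[OF assms(1) that Suc.prems(1)])
  have "Ck_on k S (\<lambda>x. frechet_derivative g (at x) v)" for v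
    by (rule Suc.IH[of "\<lambda>x. frechet_derivative f (at x) v"]) (use Suc.prems fd in auto)
  moreover have "g differentiable (at x)" if "x \<in> S" for x
    by (rule differentiable_cong_open[OF assms(1) that Suc.prems(1)]) (use Suc.prems that in auto)
  ultimately show ?case by simp
qed

lemma Ck_on_SucD: "Ck_on (Suc k) S f \<Longrightarrow> Ck_on k S f"
proof (induction k arbitrary: f)
  case 0
  then show ?case
    by (auto intro!: continuous_at_imp_continuous_on differentiable_imp_continuous_within)
next
  case (Suc k)
  then show ?case by (metis Ck_on.simps(2))
qed

lemma Ck_on_SucI:
  assumes "open S" "\<And>x. x \<in> S \<Longrightarrow> (f has_derivative f' x) (at x)" "\<And>v. Ck_on k S (\<lambda>x. f' x v)"
  shows "Ck_on (Suc k) S f"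
proof -
  have "Ck_on k S (\<lambda>x. frechet_derivative f (at x) v)" for v
    by (rule Ck_on_cong[OF assms(1) _ assms(3)[of v]]) (simp add: frechet_derivativeI[OF assms(2)])
  then show ?thesis using assms(2) by (auto simp: differentiable_def)
qed

lemma Ck_on_has_derivative:
  assumes "Ck_on (Suc k) S f" "x \<in> S"
  shows "(f has_derivative frechet_derivative f (at x)) (at x)"
  using assms frechet_derivative_works by auto

lemma Ck_on_differentiable: "Ck_on (Suc k) S f \<Longrightarrow> x \<in> S \<Longrightarrow> f differentiable (at x)"
  by simp

lemma Ck_on_frechet_derivative: "Ck_on (Suc k) S f \<Longrightarrow> Ck_on k S (\<lambda>x. frechet_derivative f (at x) v)"
  by simp

lemma C2_frechet_derivative_differentiable:
  assumes "Ck_on 2 S f" "x \<in> S"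
  shows "(\<lambda>y. frechet_derivative f (at y) v) differentiable (at x)"
  using assms Ck_on_differentiable[OF Ck_on_frechet_derivative] by (metis numeral_2_eq_2)

lemma Ck_on_const: "open S \<Longrightarrow> Ck_on k S (\<lambda>x. c)"
proof (induction k arbitrary: c)
  case (Suc k)
  show ?case by (rule Ck_on_SucI[OF Suc.prems has_derivative_const]) (rule Suc.IH[OF Suc.prems])
qed simp

lemma Ck_on_bounded_linear:
  assumes "bounded_linear L" "open S"
  shows "Ck_on k S f \<Longrightarrow> Ck_on k S (\<lambda>x. L (f x))"
proof (induction k arbitrary: f)
  case 0
  then show ?case using assms bounded_linear.continuous_on by auto
next
  case (Suc k)
  show ?case
  proof (rule Ck_on_SucI[OF assms(2)])
    fix x assume "x \<in> S"
    show "((\<lambda>x. L (f x)) has_derivative (\<lambda>v. L (frechet_derivative f (at x) v))) (at x)"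
      by (rule bounded_linear.has_derivative[OF assms(1) Ck_on_has_derivative[OF Suc.prems \<open>x \<in> S\<close>]])
  qed (use Suc in auto)
qed

lemma Ck_on_add:
  assumes "open S"
  shows "Ck_on k S f \<Longrightarrow> Ck_on k S g \<Longrightarrow> Ck_on k S (\<lambda>x. f x + g x)"
proof (induction k arbitrary: f g)
  case 0
  then show ?case by (auto intro: continuous_on_add)
next
  case (Suc k)
  show ?case
  proof (rule Ck_on_SucI[OF assms])
    fix x assume "x \<in> S"
    show "((\<lambda>x. f x + g x) has_derivative
        (\<lambda>v. frechet_derivative f (at x) v + frechet_derivative g (at x) v)) (at x)"
      by (intro has_derivative_add Ck_on_has_derivative[where k=k, OF _ \<open>x \<in> S\<close>] Suc.prems)
  qed (use Suc in auto)
qed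

lemma Ck_on_sum:
  assumes "open S" "\<And>i. i \<in> I \<Longrightarrow> Ck_on k S (f i)"
  shows "Ck_on k S (\<lambda>x. \<Sum>i\<in>I. f i x)"
  using assms(2)
proof (induction I rule: infinite_finite_induct)
  case (insert i I)
  then show ?case by (simp add: Ck_on_add[OF assms(1)])
qed (simp_all add: Ck_on_const[OF assms(1)])

lemma Ck_on_bilinear:
  assumes "bounded_bilinear h" "open S"
  shows "Ck_on k S f \<Longrightarrow> Ck_on k S g \<Longrightarrow> Ck_on k S (\<lambda>x. h (f x) (g x))"
proof (induction k arbitrary: f g)
  case 0
  then show ?case using bounded_bilinear.continuous_on[OF assms(1)] by auto
next
  case (Suc k)
  show ?case
  proof (rule Ck_on_SucI[OF assms(2)])
    fix x assume "x \<in> S"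
    show "((\<lambda>x. h (f x) (g x)) has_derivative
        (\<lambda>v. h (f x) (frechet_derivative g (at x) v) + h (frechet_derivative f (at x) v) (g x))) (at x)"
      by (intro bounded_bilinear.FDERIV[OF assms(1)] Ck_on_has_derivative[where k=k, OF _ \<open>x \<in> S\<close>] Suc.prems)
  next
    fix v
    show "Ck_on k S (\<lambda>x. h (f x) (frechet_derivative g (at x) v) + h (frechet_derivative f (at x) v) (g x))"
      by (intro Ck_on_add[OF assms(2)] Suc.IH) (use Suc.prems Ck_on_SucD in auto)
  qed
qed

text \<open>Affine inner maps cover the projections, slices and the change of parameter t = 2r - 2,
  and their constant derivative lets the induction on \<open>k\<close> close.\<close>

lemma Ck_on_compose_affine:
  assumes "linear L" "open T" "\<And>x. x \<in> T \<Longrightarrow> L x + c \<in> S"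
  shows "Ck_on k S f \<Longrightarrow> Ck_on k T (\<lambda>x. f (L x + c))"
proof (induction k arbitrary: f)
  case 0
  have "continuous_on T (\<lambda>x. L x + c)"
    using assms(1) by (intro continuous_intros linear_continuous_on) (simp add: linear_conv_bounded_linear)
  then show ?case using 0 assms(3) by (auto intro: continuous_on_compose2)
next
  case (Suc k)
  show ?case
  proof (rule Ck_on_SucI[OF assms(2)])
    fix x assume x: "x \<in> T"
    have "((\<lambda>x. L x + c) has_derivative L) (at x)"
      using assms(1) by (auto intro!: derivative_eq_intros bounded_linear_imp_has_derivative simp: linear_conv_bounded_linear)
    from has_derivative_compose[OF this Ck_on_has_derivative[OF Suc.prems assms(3)[OF x]]]
    show "((\<lambda>x. f (L x + c)) has_derivative (\<lambda>v. frechet_derivative f (at (L x + c)) (L v))) (at x)" .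
  qed (use Suc in auto)
qed

lemma Ck_on_Pair:
  fixes f :: "'a::euclidean_space \<Rightarrow> 'b::real_normed_vector" and g :: "'a \<Rightarrow> 'c::real_normed_vector"
  assumes "open S" "Ck_on k S f" "Ck_on k S g"
  shows "Ck_on k S (\<lambda>x. (f x, g x))"
proof -
  have "bounded_linear (\<lambda>y::'b. (y, 0::'c))" "bounded_linear (\<lambda>y::'c. (0::'b, y))"
    by (auto intro: bounded_linear_Pair bounded_linear_ident bounded_linear_zero)
  from Ck_on_add[OF assms(1) Ck_on_bounded_linear[OF this(1) assms(1,2)] Ck_on_bounded_linear[OF this(2) assms(1,3)]]
  show ?thesis by simp
qed

lemma Ck_on_linear:
  assumes "linear L" "open S"
  shows "Ck_on k S L"
proof (cases k)
  case 0
  then show ?thesis using assms by (simp add: linear_continuous_on linear_conv_bounded_linear)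
next
  case (Suc j)
  have "Ck_on (Suc j) S L"
    by (rule Ck_on_SucI[OF assms(2)]) (use assms Ck_on_const in
        \<open>auto intro: bounded_linear_imp_has_derivative simp: linear_conv_bounded_linear\<close>)
  then show ?thesis using Suc by simp
qed

section \<open>Second derivatives: symmetry, and sign at a minimum\<close>

lemma frechet_derivative_has_real_derivative_line:
  fixes f :: "'a::euclidean_space \<Rightarrow> real"
  assumes "f differentiable (at (x + t *\<^sub>R v))"
  shows "((\<lambda>s. f (x + s *\<^sub>R v)) has_real_derivative frechet_derivative f (at (x + t *\<^sub>R v)) v) (at t)"
proof -
  have "((\<lambda>s. x + s *\<^sub>R v) has_derivative (\<lambda>s. s *\<^sub>R v)) (at t)"
    by (auto intro!: derivative_eq_intros)
  from has_derivative_compose[OF this assms[unfolded frechet_derivative_works]]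
  have "((\<lambda>s. f (x + s *\<^sub>R v)) has_derivative (\<lambda>s. frechet_derivative f (at (x + t *\<^sub>R v)) (s *\<^sub>R v))) (at t)" .
  moreover have "(\<lambda>s. frechet_derivative f (at (x + t *\<^sub>R v)) (s *\<^sub>R v))
      = (*) (frechet_derivative f (at (x + t *\<^sub>R v)) v)"
    by (simp add: fun_eq_iff linear_scale[OF linear_frechet_derivative[OF assms]])
  ultimately show ?thesis by (simp only: has_field_derivative_def)
qed

text \<open>Two applications of the mean value theorem: in direction \<open>v\<close> to the
  difference of \<open>f\<close> along two parallel segments, then in direction \<open>w\<close> to
  the derivative obtained.\<close>

lemma mixed_difference_quotient:
  fixes f :: "'a::euclidean_space \<Rightarrow> real"
  assumes C2: "Ck_on 2 S f" and h: "h > 0"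
    and S: "\<And>s t. 0 \<le> s \<Longrightarrow> s \<le> h \<Longrightarrow> 0 \<le> t \<Longrightarrow> t \<le> h \<Longrightarrow> x + s *\<^sub>R v + t *\<^sub>R w \<in> S"
  obtains s t where "0 < s" "s < h" "0 < t" "t < h"
    "f (x + h *\<^sub>R v + h *\<^sub>R w) - f (x + h *\<^sub>R v) - f (x + h *\<^sub>R w) + f x =
       h * h * frechet_derivative (\<lambda>y. frechet_derivative f (at y) v) (at (x + s *\<^sub>R v + t *\<^sub>R w)) w"
proof -
  let ?D = "\<lambda>y. frechet_derivative f (at y) v"
  have d1: "f differentiable (at y)" and d2: "?D differentiable (at y)" if "y \<in> S" for y
    using C2 that by (auto simp: numeral_2_eq_2)
  let ?g = "\<lambda>s. f ((x + h *\<^sub>R w) + s *\<^sub>R v) - f (x + s *\<^sub>R v)"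
  have "(?g has_real_derivative ?D ((x + h *\<^sub>R w) + s *\<^sub>R v) - ?D (x + s *\<^sub>R v)) (at s)"
    if "0 \<le> s" "s \<le> h" for s
    by (intro DERIV_diff frechet_derivative_has_real_derivative_line d1)
       (use S[of s h] S[of s 0] that h in \<open>auto simp: algebra_simps\<close>)
  then obtain s where s: "0 < s" "s < h"
      "?g h - ?g 0 = (h - 0) * (?D ((x + h *\<^sub>R w) + s *\<^sub>R v) - ?D (x + s *\<^sub>R v))"
    using MVT2[OF h, of ?g "\<lambda>s. ?D ((x + h *\<^sub>R w) + s *\<^sub>R v) - ?D (x + s *\<^sub>R v)"] by blast
  let ?k = "\<lambda>t. ?D ((x + s *\<^sub>R v) + t *\<^sub>R w)"
  have "(?k has_real_derivative frechet_derivative ?D (at ((x + s *\<^sub>R v) + t *\<^sub>R w)) w) (at t)"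
    if "0 \<le> t" "t \<le> h" for t
    by (intro frechet_derivative_has_real_derivative_line d2) (use S[of s t] that s in auto)
  then obtain t where t: "0 < t" "t < h"
      "?k h - ?k 0 = (h - 0) * frechet_derivative ?D (at ((x + s *\<^sub>R v) + t *\<^sub>R w)) w"
    using MVT2[OF h, of ?k "\<lambda>t. frechet_derivative ?D (at ((x + s *\<^sub>R v) + t *\<^sub>R w)) w"] by blast
  have "f (x + h *\<^sub>R v + h *\<^sub>R w) - f (x + h *\<^sub>R v) - f (x + h *\<^sub>R w) + f x = ?g h - ?g 0"
    by (simp add: algebra_simps)
  also have "\<dots> = h * (?k h - ?k 0)" using s(3) by (simp add: algebra_simps)
  also have "\<dots> = h * h * frechet_derivative ?D (at (x + s *\<^sub>R v + t *\<^sub>R w)) w"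
    using t(3) by simp
  finally show ?thesis using that[OF s(1,2) t(1,2)] by blast
qed

text \<open>The second difference is symmetric in \<open>v\<close> and \<open>w\<close>, so the two
  mixed derivatives agree at a pair of intermediate points close to \<open>x\<close>; continuity of
  the second derivatives does the rest.\<close>

lemma frechet_derivative_symmetric_real:
  fixes f :: "'a::euclidean_space \<Rightarrow> real"
  assumes S: "open S" "x \<in> S" and C2: "Ck_on 2 S f"
  shows "frechet_derivative (\<lambda>y. frechet_derivative f (at y) v) (at x) w =
         frechet_derivative (\<lambda>y. frechet_derivative f (at y) w) (at x) v"
proof -
  let ?E = "\<lambda>v w y. frechet_derivative (\<lambda>y. frechet_derivative f (at y) v) (at y) w"
  have cont: "continuous_on S (?E v w)" for v w using C2 by (auto simp: numeral_2_eq_2)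
  have "\<bar>?E v w x - ?E w v x\<bar> \<le> 2 * e" if "e > 0" for e
  proof -
    obtain d1 where d1: "d1 > 0" "ball x d1 \<subseteq> S" using S by (meson open_contains_ball)
    obtain d2 where d2: "d2 > 0" "\<And>y. y \<in> S \<Longrightarrow> dist y x < d2 \<Longrightarrow> dist (?E v w y) (?E v w x) < e"
      using cont[of v w] S(2) \<open>e > 0\<close> unfolding continuous_on_iff by blast
    obtain d3 where d3: "d3 > 0" "\<And>y. y \<in> S \<Longrightarrow> dist y x < d3 \<Longrightarrow> dist (?E w v y) (?E w v x) < e"
      using cont[of w v] S(2) \<open>e > 0\<close> unfolding continuous_on_iff by blast
    \<comment> \<open>Keeps the parallelogram inside the ball of radius \<open>d1\<close> and within
      both continuity radii. The summand 1 makes the quotient meaningful for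
      \<open>v = w = 0\<close> and the bounds strict.\<close>
    define h where "h = min d1 (min d2 d3) / (norm v + norm w + 1)"
    have "norm v + norm w + 1 > 0" by (simp add: add_nonneg_pos)
    then have h0: "h > 0" "h * (norm v + norm w + 1) = min d1 (min d2 d3)"
      using d1(1) d2(1) d3(1) by (simp_all add: h_def)
    then have h1: "h * (norm v + norm w) < min d1 (min d2 d3)" unfolding distrib_left by linarith
    then have h: "h > 0" "h * (norm v + norm w) < d1" "h * (norm v + norm w) < d2" "h * (norm v + norm w) < d3"
      using h0(1) h1 by (simp_all only: min_less_iff_conj)
    have near: "dist (x + s *\<^sub>R v + t *\<^sub>R w) x \<le> h * (norm v + norm w)"
      if "0 \<le> s" "s \<le> h" "0 \<le> t" "t \<le> h" for s t
    proof -
      have "dist (x + s *\<^sub>R v + t *\<^sub>R w) x \<le> s * norm v + t * norm w"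
        using that norm_triangle_ineq[of "s *\<^sub>R v" "t *\<^sub>R w"] by (simp add: dist_norm algebra_simps)
      also have "\<dots> \<le> h * norm v + h * norm w"
        using that by (intro add_mono mult_right_mono) auto
      finally show ?thesis by (simp add: algebra_simps)
    qed
    have inS: "x + s *\<^sub>R v + t *\<^sub>R w \<in> S" if "0 \<le> s" "s \<le> h" "0 \<le> t" "t \<le> h" for s t
      using near[OF that] h(2) d1(2) by (auto simp: dist_commute)
    obtain s t where st: "0 < s" "s < h" "0 < t" "t < h"
      "f (x + h *\<^sub>R v + h *\<^sub>R w) - f (x + h *\<^sub>R v) - f (x + h *\<^sub>R w) + f x =
         h * h * ?E v w (x + s *\<^sub>R v + t *\<^sub>R w)"
      by (rule mixed_difference_quotient[OF C2 h(1) inS])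
    have inS': "x + s *\<^sub>R w + t *\<^sub>R v \<in> S" if "0 \<le> s" "s \<le> h" "0 \<le> t" "t \<le> h" for s t
      using inS[of t s] that by (simp add: algebra_simps)
    obtain s' t' where st': "0 < s'" "s' < h" "0 < t'" "t' < h"
      "f (x + h *\<^sub>R w + h *\<^sub>R v) - f (x + h *\<^sub>R w) - f (x + h *\<^sub>R v) + f x =
         h * h * ?E w v (x + s' *\<^sub>R w + t' *\<^sub>R v)"
      by (rule mixed_difference_quotient[OF C2 h(1) inS'])
    have "h * h * ?E v w (x + s *\<^sub>R v + t *\<^sub>R w) = h * h * ?E w v (x + s' *\<^sub>R w + t' *\<^sub>R v)"
      using st(5) st'(5) by (simp add: algebra_simps)
    then have eq: "?E v w (x + s *\<^sub>R v + t *\<^sub>R w) = ?E w v (x + t' *\<^sub>R v + s' *\<^sub>R w)"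
      using h(1) by (simp add: algebra_simps)
    have "dist (?E v w (x + s *\<^sub>R v + t *\<^sub>R w)) (?E v w x) < e"
      by (rule d2(2)[OF inS]) (use near[of s t] st h in auto)
    moreover have "dist (?E w v (x + t' *\<^sub>R v + s' *\<^sub>R w)) (?E w v x) < e"
      by (rule d3(2)[OF inS]) (use near[of t' s'] st' h in auto)
    ultimately show ?thesis using eq by (simp add: dist_real_def)
  qed
  from this[of "e / 2" for e] have "\<bar>?E v w x - ?E w v x\<bar> \<le> e" if "e > 0" for e
    using that by simp
  then show ?thesis using field_le_epsilon[of "\<bar>?E v w x - ?E w v x\<bar>" 0] by simp
qed

lemma frechet_derivative_inner:
  assumes "f differentiable (at x)"
  shows "frechet_derivative (\<lambda>y. f y \<bullet> b) (at x) v = frechet_derivative f (at x) v \<bullet> b"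
  by (subst frechet_derivativeI[OF has_derivative_inner_left[OF assms[unfolded frechet_derivative_works]]]) simp

lemma frechet_derivative_symmetric:
  fixes f :: "'a::euclidean_space \<Rightarrow> 'b::euclidean_space"
  assumes S: "open S" "x \<in> S" and C2: "Ck_on 2 S f"
  shows "frechet_derivative (\<lambda>y. frechet_derivative f (at y) v) (at x) w =
         frechet_derivative (\<lambda>y. frechet_derivative f (at y) w) (at x) v"
proof (rule euclidean_eqI)
  fix b :: 'b
  have d: "f differentiable (at y)" and d2: "(\<lambda>y. frechet_derivative f (at y) v) differentiable (at y)"
    if "y \<in> S" for y v using C2 that by (auto simp: numeral_2_eq_2)
  have "Ck_on 2 S (\<lambda>y. f y \<bullet> b)"
    by (rule Ck_on_bounded_linear[OF bounded_linear_inner_left S(1) C2])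
  from frechet_derivative_symmetric_real[OF S this, of v w]
  have "frechet_derivative (\<lambda>y. frechet_derivative (\<lambda>y. f y \<bullet> b) (at y) v) (at x) w =
      frechet_derivative (\<lambda>y. frechet_derivative (\<lambda>y. f y \<bullet> b) (at y) w) (at x) v" .
  moreover have "frechet_derivative (\<lambda>y. frechet_derivative (\<lambda>y. f y \<bullet> b) (at y) v) (at x) w =
      frechet_derivative (\<lambda>y. frechet_derivative f (at y) v) (at x) w \<bullet> b" for v w
    by (subst frechet_derivative_cong_open[OF S, of _ "\<lambda>y. frechet_derivative f (at y) v \<bullet> b"])
       (use d d2 S in \<open>auto simp: frechet_derivative_inner\<close>)
  ultimately show "frechet_derivative (\<lambda>y. frechet_derivative f (at y) v) (at x) w \<bullet> b =
      frechet_derivative (\<lambda>y. frechet_derivative f (at y) w) (at x) v \<bullet> b" by metis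
qed

text \<open>Restrict \<open>f\<close> to a line through \<open>x\<close>. Were the second derivative
  negative, the first would be negative just after \<open>x\<close>, and the mean value theorem
  would yield a value below \<open>f x\<close>.\<close>

lemma frechet_derivative_min_second:
  fixes f :: "'a::euclidean_space \<Rightarrow> real"
  assumes S: "open S" "x \<in> S" and C2: "Ck_on 2 S f" and min: "\<And>y. y \<in> S \<Longrightarrow> f x \<le> f y"
  shows "frechet_derivative f (at x) v = 0"
    and "frechet_derivative (\<lambda>y. frechet_derivative f (at y) v) (at x) v \<ge> 0"
proof -
  let ?D = "\<lambda>y. frechet_derivative f (at y) v"
  have d1: "f differentiable (at y)" and d2: "?D differentiable (at y)" if "y \<in> S" for y
    using C2 that by (auto simp: numeral_2_eq_2)
  have "open ((\<lambda>t. x + t *\<^sub>R v) -` S)"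
    by (intro open_vimage S(1) continuous_intros)
  moreover have "0 \<in> (\<lambda>t. x + t *\<^sub>R v) -` S" using S(2) by simp
  ultimately obtain d where "d > 0" "ball 0 d \<subseteq> (\<lambda>t. x + t *\<^sub>R v) -` S"
    by (meson open_contains_ball)
  then have d: "d > 0" "\<And>t. \<bar>t\<bar> < d \<Longrightarrow> x + t *\<^sub>R v \<in> S"
    by (auto simp: subset_iff dist_real_def)
  have \<phi>: "((\<lambda>s. f (x + s *\<^sub>R v)) has_real_derivative ?D (x + t *\<^sub>R v)) (at t)" if "\<bar>t\<bar> < d" for t
    by (rule frechet_derivative_has_real_derivative_line[OF d1[OF d(2)[OF that]]])
  have "?D (x + 0 *\<^sub>R v) = 0"
    by (rule DERIV_local_min[OF \<phi> d(1)]) (use d min in auto)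
  then show zero: "?D x = 0" by simp
  show "frechet_derivative ?D (at x) v \<ge> 0"
  proof (rule ccontr)
    assume neg: "\<not> ?thesis"
    have "((\<lambda>s. ?D (x + s *\<^sub>R v)) has_real_derivative frechet_derivative ?D (at (x + 0 *\<^sub>R v)) v) (at 0)"
      by (rule frechet_derivative_has_real_derivative_line) (use d2 S in auto)
    from DERIV_neg_dec_right[OF this] neg obtain e where
      e: "e > 0" "\<And>h. 0 < h \<Longrightarrow> h < e \<Longrightarrow> ?D (x + h *\<^sub>R v) < 0"
      using zero by auto
    define h where "h = min d e / 2"
    have h: "0 < h" "h < d" "h < e" using d e by (auto simp: h_def)
    obtain z where z: "0 < z" "z < h" "f (x + h *\<^sub>R v) - f (x + 0 *\<^sub>R v) = (h - 0) * ?D (x + z *\<^sub>R v)"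
      using MVT2[OF h(1), of "\<lambda>s. f (x + s *\<^sub>R v)" "\<lambda>s. ?D (x + s *\<^sub>R v)"] \<phi> h by auto
    have "h * ?D (x + z *\<^sub>R v) < 0" using e(2)[of z] z h by (simp add: mult_pos_neg)
    moreover have "f (x + h *\<^sub>R v) \<ge> f x" using min d(2)[of h] h by simp
    ultimately show False using z(3) by simp
  qed
qed

text \<open>Product rule for a varying linear map applied to a moving vector. Tensor fields are
  tested on constant vectors, so differentiability of \<open>A\<close> is known one vector at a
  time; expansion in \<open>Basis\<close> bridges the gap.\<close>

lemma has_derivative_linear_family:
  fixes A :: "'c::euclidean_space \<Rightarrow> 'a::euclidean_space \<Rightarrow> 'b::real_normed_vector"
  assumes S: "open S" "z \<in> S" and lin: "\<And>y. y \<in> S \<Longrightarrow> linear (A y)"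
    and dA: "\<And>v. (\<lambda>y. A y v) differentiable (at z)" and N: "(N has_derivative N') (at z)"
  shows "((\<lambda>y. A y (N y)) has_derivative
           (\<lambda>h. frechet_derivative (\<lambda>y. A y (N z)) (at z) h + A z (N' h))) (at z)"
proof -
  let ?dA = "\<lambda>v. frechet_derivative (\<lambda>y. A y v) (at z)"
  have expand: "A y u = (\<Sum>b\<in>Basis. (u \<bullet> b) *\<^sub>R A y b)" if "y \<in> S" for y u
  proof -
    have "A y (\<Sum>b\<in>Basis. (u \<bullet> b) *\<^sub>R b) = (\<Sum>b\<in>Basis. (u \<bullet> b) *\<^sub>R A y b)"
      by (simp add: linear_sum[OF lin[OF that]] linear_scale[OF lin[OF that]])
    then show ?thesis by (simp add: euclidean_representation)
  qed
  have "((\<lambda>y. \<Sum>b\<in>Basis. (N z \<bullet> b) *\<^sub>R A y b) has_derivative (\<lambda>h. \<Sum>b\<in>Basis. (N z \<bullet> b) *\<^sub>R ?dA b h)) (at z)"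
    using dA[unfolded frechet_derivative_works]
    by (intro has_derivative_sum has_derivative_scaleR_right)
  then have "((\<lambda>y. A y (N z)) has_derivative (\<lambda>h. \<Sum>b\<in>Basis. (N z \<bullet> b) *\<^sub>R ?dA b h)) (at z)"
    by (rule has_derivative_transform_within_open[OF _ S]) (simp add: expand)
  then have 1: "?dA (N z) = (\<lambda>h. \<Sum>b\<in>Basis. (N z \<bullet> b) *\<^sub>R ?dA b h)"
    by (rule frechet_derivativeI)
  have "((\<lambda>y. \<Sum>b\<in>Basis. (N y \<bullet> b) *\<^sub>R A y b) has_derivative
      (\<lambda>h. \<Sum>b\<in>Basis. (N z \<bullet> b) *\<^sub>R ?dA b h + (N' h \<bullet> b) *\<^sub>R A z b)) (at z)"
    using dA[unfolded frechet_derivative_works] N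
    by (intro has_derivative_sum has_derivative_scaleR has_derivative_inner_left)
  then have "((\<lambda>y. A y (N y)) has_derivative
      (\<lambda>h. \<Sum>b\<in>Basis. (N z \<bullet> b) *\<^sub>R ?dA b h + (N' h \<bullet> b) *\<^sub>R A z b)) (at z)"
    by (rule has_derivative_transform_within_open[OF _ S]) (simp add: expand)
  moreover have "(\<Sum>b\<in>Basis. (N z \<bullet> b) *\<^sub>R ?dA b h + (N' h \<bullet> b) *\<^sub>R A z b) = ?dA (N z) h + A z (N' h)" for h
    unfolding 1 expand[OF S(2), of "N' h"] by (simp add: sum.distrib)
  ultimately show ?thesis by simp
qed

section \<open>Charts\<close>

locale smooth_mfd =
  fixes W :: "('m::t2_space, 'e::euclidean_space) mfd"
  assumes smooth_manifold: "smooth_manifold W"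
begin

abbreviation dom where "dom p \<equiv> crd W p ` nbh W p"
abbreviation chart where "chart p f \<equiv> (\<lambda>x. f (crd_inv W p x))"

context
  fixes p assumes p: "p \<in> pts W"
begin

lemma mem_nbh: "p \<in> nbh W p" and nbh_subset: "nbh W p \<subseteq> pts W"
  and open_nbh: "open (nbh W p)" and open_dom: "open (dom p)"
  and homeo: "homeomorphism (nbh W p) (dom p) (crd W p) (crd_inv W p)"
  using smooth_manifold p by (simp_all add: smooth_manifold_def)

lemma crd_inv_crd: "q \<in> nbh W p \<Longrightarrow> crd_inv W p (crd W p q) = q"
  using homeo by (simp add: homeomorphism_def)

lemma crd_crd_inv: "x \<in> dom p \<Longrightarrow> crd W p (crd_inv W p x) = x"
  using homeo unfolding homeomorphism_def by blast

lemma crd_inv_mem: "x \<in> dom p \<Longrightarrow> crd_inv W p x \<in> nbh W p"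
  using homeo by (metis homeomorphism_def imageI)

lemma crd_mem_dom: "crd W p p \<in> dom p"
  using mem_nbh by blast

lemma open_overlap: "open N \<Longrightarrow> open (crd W p ` (nbh W p \<inter> N))"
proof -
  assume N: "open N"
  have "crd W p ` (nbh W p \<inter> N) = dom p \<inter> crd_inv W p -` N"
    using crd_inv_crd by auto
  moreover have "continuous_on (dom p) (crd_inv W p)" using homeo by (simp add: homeomorphism_def)
  ultimately show ?thesis using continuous_open_preimage open_dom N by metis
qed

lemma tdiff_cong:
  assumes "open N" "p \<in> N" "\<And>q. q \<in> nbh W p \<Longrightarrow> q \<in> N \<Longrightarrow> f q = g q"
  shows "tdiff W f p v = tdiff W g p v"
  unfolding tdiff_def
  by (subst frechet_derivative_cong_open[OF open_overlap[OF assms(1)]])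
     (use assms mem_nbh crd_inv_crd in auto)

end

lemma transition_Ck:
  assumes "p \<in> pts W" "q \<in> pts W"
  shows "Ck_on k (crd W p ` (nbh W p \<inter> nbh W q)) (chart p (crd W q))"
  using smooth_manifold assms by (simp add: smooth_manifold_def smooth_on_def)

lemma transition_has_derivative:
  assumes "p \<in> pts W" "q \<in> pts W" "r \<in> nbh W p" "r \<in> nbh W q"
  shows "(chart p (crd W q) has_derivative frechet_derivative (chart p (crd W q)) (at (crd W p r))) (at (crd W p r))"
  by (rule Ck_on_has_derivative[OF transition_Ck[OF assms(1,2)]]) (use assms in blast)

lemma chart_compose_has_derivative:
  assumes "p \<in> pts W" "q \<in> pts W" "r \<in> nbh W p" "r \<in> nbh W q"
    and f: "(chart p f has_derivative D) (at (crd W p r))"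
  shows "(chart q f has_derivative (\<lambda>u. D (frechet_derivative (chart q (crd W p)) (at (crd W q r)) u)))
    (at (crd W q r))"
proof -
  have "chart q (crd W p) (crd W q r) = crd W p r" using assms by (simp add: crd_inv_crd)
  with f have "(chart p f has_derivative D) (at (chart q (crd W p) (crd W q r)))" by simp
  from has_derivative_compose[OF transition_has_derivative[OF assms(2,1,4,3)] this]
  show ?thesis
    by (rule has_derivative_transform_within_open[OF _ open_overlap[OF assms(2) open_nbh[OF assms(1)]]])
       (use assms in \<open>auto simp: crd_inv_crd\<close>)
qed

context
  fixes p q assumes p: "p \<in> pts W" and q: "q \<in> nbh W p"
begin

lemma nbh_pts: "q \<in> pts W" using nbh_subset p q by blast

text \<open>A tangent vector at \<open>q\<close> is written in the chart designated for
  \<open>q\<close>; \<open>tdiff W (crd W p) q\<close> is the Jacobian that turns it into components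
  in the chart of \<open>p\<close>.\<close>

lemma tdiff_eq_chart:
  assumes "chart p f differentiable (at (crd W p q))"
  shows "tdiff W f q u = frechet_derivative (chart p f) (at (crd W p q)) (tdiff W (crd W p) q u)"
    and "chart q f differentiable (at (crd W q q))"
proof -
  note 1 = chart_compose_has_derivative[OF p nbh_pts q mem_nbh[OF nbh_pts] assms[unfolded frechet_derivative_works]]
  show "tdiff W f q u = frechet_derivative (chart p f) (at (crd W p q)) (tdiff W (crd W p) q u)"
    unfolding tdiff_def frechet_derivativeI[OF 1] by simp
  show "chart q f differentiable (at (crd W q q))" using 1 by (auto simp: differentiable_def)
qed

lemma linear_tdiff_crd: "linear (tdiff W (crd W p) q)"
  using transition_has_derivative[OF nbh_pts p mem_nbh[OF nbh_pts] q]
  unfolding tdiff_def by (metis has_derivative_linear)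

lemma linear_coord_field: "linear (\<lambda>v. coord_field W p v q)"
  using transition_has_derivative[OF p nbh_pts q mem_nbh[OF nbh_pts]]
  unfolding coord_field_def by (metis has_derivative_linear)

text \<open>\<open>coord_field W p\<close> and \<open>tdiff W (crd W p)\<close> are Jacobians of
  mutually inverse transition maps; this identity and the next are the chain rule for the two
  compositions.\<close>

lemma tdiff_crd_coord_field: "tdiff W (crd W p) q (coord_field W p v q) = v"
proof -
  note 1 = chart_compose_has_derivative[OF nbh_pts p mem_nbh[OF nbh_pts] q
      transition_has_derivative[OF nbh_pts p mem_nbh[OF nbh_pts] q]]
  have "(chart p (crd W p) has_derivative (\<lambda>v. v)) (at (crd W p q))"
    by (rule has_derivative_transform_within_open[OF has_derivative_ident open_dom[OF p]])
       (use p q in \<open>auto simp: crd_crd_inv crd_inv_crd\<close>)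
  from has_derivative_unique[OF 1 this] show ?thesis
    unfolding tdiff_def coord_field_def by metis
qed

lemma coord_field_tdiff_crd: "coord_field W p (tdiff W (crd W p) q u) q = u"
proof -
  note 1 = chart_compose_has_derivative[OF p nbh_pts q mem_nbh[OF nbh_pts]
      transition_has_derivative[OF p nbh_pts q mem_nbh[OF nbh_pts]]]
  have "(chart q (crd W q) has_derivative (\<lambda>v. v)) (at (crd W q q))"
    by (rule has_derivative_transform_within_open[OF has_derivative_ident open_dom[OF nbh_pts]])
       (use nbh_pts in \<open>auto simp: crd_crd_inv crd_inv_crd mem_nbh\<close>)
  from has_derivative_unique[OF 1 this] show ?thesis
    unfolding tdiff_def coord_field_def by metis
qed

lemma tdiff_coord_field:
  assumes "chart p f differentiable (at (crd W p q))"
  shows "tdiff W f q (coord_field W p v q) = frechet_derivative (chart p f) (at (crd W p q)) v"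
  by (simp add: tdiff_eq_chart(1)[OF assms] tdiff_crd_coord_field)

end

lemma coord_field_self: "p \<in> pts W \<Longrightarrow> coord_field W p v p = v"
proof -
  assume p: "p \<in> pts W"
  have "(chart p (crd W p) has_derivative (\<lambda>v. v)) (at (crd W p p))"
    by (rule has_derivative_transform_within_open[OF has_derivative_ident open_dom[OF p]])
       (use p in \<open>auto simp: crd_crd_inv crd_inv_crd mem_nbh\<close>)
  then show ?thesis unfolding coord_field_def by (simp add: frechet_derivativeI)
qed

lemma components_self: "p \<in> pts W \<Longrightarrow> components W p X p = X p"
  by (metis coord_field_self coord_field_tdiff_crd components_def mem_nbh)

lemma smooth_in_Ck: "smooth_in W p f \<Longrightarrow> Ck_on k (dom p) (chart p f)"
  by (simp add: smooth_in_def smooth_on_def)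

lemma smooth_in_differentiable:
  assumes "smooth_in W p f" "x \<in> dom p"
  shows "chart p f differentiable (at x)"
  by (rule Ck_on_differentiable[OF smooth_in_Ck[OF assms(1)] assms(2)])

lemma smooth_in_continuous:
  assumes p: "p \<in> pts W" and f: "smooth_in W p f"
  shows "continuous_on (nbh W p) f"
proof -
  have "continuous_on (dom p) (chart p f)" using smooth_in_Ck[OF f, of 0] by simp
  then have "continuous_on (nbh W p) (\<lambda>q. chart p f (crd W p q))"
    by (rule continuous_on_compose2) (use homeo[OF p] in \<open>auto simp: homeomorphism_def\<close>)
  then show ?thesis by (rule continuous_on_eq) (simp add: crd_inv_crd[OF p])
qed

text \<open>The coordinate Hessian in the chart designated for \<open>p\<close>. It is not a tensor
  by itself; the Christoffel correction appears in \<open>ddJ_hessian\<close>.\<close>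

definition tdiff2 :: "('m \<Rightarrow> 'b::real_normed_vector) \<Rightarrow> 'm \<Rightarrow> 'e \<Rightarrow> 'e \<Rightarrow> 'b" where
  "tdiff2 f p v w = tdiff W (\<lambda>q. tdiff W f q (coord_field W p w q)) p v"

context
  fixes p assumes p: "p \<in> pts W"
begin

lemma chart_tdiff_coord_field:
  assumes "smooth_in W p f" "x \<in> dom p"
  shows "tdiff W f (crd_inv W p x) (coord_field W p w (crd_inv W p x)) = frechet_derivative (chart p f) (at x) w"
  using tdiff_coord_field[OF p crd_inv_mem[OF p assms(2)], of f]
  by (simp add: crd_crd_inv[OF p assms(2)] smooth_in_differentiable[OF assms])

lemma chart_tdiff:
  assumes "smooth_in W p f" "x \<in> dom p"
  shows "tdiff W f (crd_inv W p x) u =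
    frechet_derivative (chart p f) (at x) (tdiff W (crd W p) (crd_inv W p x) u)"
  using tdiff_eq_chart(1)[OF p crd_inv_mem[OF p assms(2)], of f]
  by (simp add: crd_crd_inv[OF p assms(2)] smooth_in_differentiable[OF assms])

lemma tdiff_linear:
  assumes "chart p f differentiable (at (crd W p p))"
  shows "linear (tdiff W f p)"
  using linear_frechet_derivative[OF assms] unfolding tdiff_def by simp

lemma smooth_in_tdiff_coord_field:
  assumes "smooth_in W p f"
  shows "smooth_in W p (\<lambda>q. tdiff W f q (coord_field W p w q))"
  unfolding smooth_in_def smooth_on_def
proof
  fix k
  have "Ck_on k (dom p) (\<lambda>x. frechet_derivative (chart p f) (at x) w)"
    using smooth_in_Ck[OF assms, of "Suc k"] by simp
  then show "Ck_on k (dom p) (\<lambda>x. tdiff W f (crd_inv W p x) (coord_field W p w (crd_inv W p x)))"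
    by (rule Ck_on_cong[OF open_dom[OF p], rotated]) (simp add: chart_tdiff_coord_field[OF assms])
qed

lemma tdiff2_chart:
  assumes "smooth_in W p f"
  shows "tdiff2 f p v w =
    frechet_derivative (\<lambda>x. frechet_derivative (chart p f) (at x) w) (at (crd W p p)) v"
  unfolding tdiff2_def tdiff_def[of W _ p v]
  by (subst frechet_derivative_cong_open[OF open_dom[OF p] crd_mem_dom[OF p]])
     (simp_all add: chart_tdiff_coord_field[OF assms])

lemma tdiff2_commute:
  fixes f :: "'m \<Rightarrow> 'b::euclidean_space"
  assumes "smooth_in W p f"
  shows "tdiff2 f p v w = tdiff2 f p w v"
  unfolding tdiff2_chart[OF assms]
  by (rule frechet_derivative_symmetric[OF open_dom[OF p] crd_mem_dom[OF p] smooth_in_Ck[OF assms]])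

lemma tdiff2_bilinear:
  fixes f :: "'m \<Rightarrow> 'b::euclidean_space"
  assumes "smooth_in W p f"
  shows "bilinear (tdiff2 f p)"
proof -
  have 1: "linear (\<lambda>v. tdiff2 f p v w)" for w
    unfolding tdiff2_def
    using tdiff_linear[OF smooth_in_differentiable[OF smooth_in_tdiff_coord_field[OF assms] crd_mem_dom[OF p]]]
    by simp
  have "(\<lambda>w. tdiff2 f p w v) = tdiff2 f p v" for v
    by (intro ext tdiff2_commute[OF assms])
  from 1[unfolded this] 1 show ?thesis by (simp add: bilinear_def)
qed

text \<open>In the chart of \<open>p\<close>, df(X) is a linear family applied to the components of
  \<open>X\<close>, so \<open>has_derivative_linear_family\<close> gives a Hessian term plus df of
  the differentiated components.\<close>

lemma has_derivative_tdiff_field: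
  assumes f: "smooth_in W p f"
    and X: "chart p (components W p X) differentiable (at (crd W p p))"
  shows "(chart p (\<lambda>q. tdiff W f q (X q)) has_derivative
      (\<lambda>v. tdiff2 f p v (X p) + tdiff W f p (tdiff W (components W p X) p v))) (at (crd W p p))"
proof -
  let ?A = "\<lambda>x v. frechet_derivative (chart p f) (at x) v"
  let ?N = "chart p (components W p X)"
  have Nz: "?N (crd W p p) = X p"
    using p by (simp add: crd_inv_crd mem_nbh components_self)
  have "((\<lambda>y. ?A y (?N y)) has_derivative
      (\<lambda>h. frechet_derivative (\<lambda>y. ?A y (?N (crd W p p))) (at (crd W p p)) h +
           ?A (crd W p p) (frechet_derivative ?N (at (crd W p p)) h))) (at (crd W p p))"
  proof (rule has_derivative_linear_family[OF open_dom[OF p] crd_mem_dom[OF p]])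
    show "linear (?A y)" if "y \<in> dom p" for y
      using linear_frechet_derivative[OF smooth_in_differentiable[OF f that]] by simp
    show "(\<lambda>y. ?A y v) differentiable at (crd W p p)" for v
      by (rule C2_frechet_derivative_differentiable[OF smooth_in_Ck[OF f] crd_mem_dom[OF p]])
    show "(?N has_derivative frechet_derivative ?N (at (crd W p p))) (at (crd W p p))"
      using X by (simp add: frechet_derivative_works)
  qed
  then have "((\<lambda>y. ?A y (?N y)) has_derivative
      (\<lambda>v. tdiff2 f p v (X p) + tdiff W f p (tdiff W (components W p X) p v))) (at (crd W p p))"
    unfolding tdiff2_chart[OF f] Nz[symmetric] by (simp only: tdiff_def)
  then show ?thesis
    by (rule has_derivative_transform_within_open[OF _ open_dom[OF p] crd_mem_dom[OF p]])
       (simp add: chart_tdiff[OF f] components_def)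
qed

lemma tdiff_tdiff_field:
  assumes "smooth_in W p f" "chart p (components W p X) differentiable (at (crd W p p))"
  shows "tdiff W (\<lambda>q. tdiff W f q (X q)) p v = tdiff2 f p v (X p) + tdiff W f p (tdiff W (components W p X) p v)"
proof -
  have "tdiff W (\<lambda>q. tdiff W f q (X q)) p v =
      frechet_derivative (chart p (\<lambda>q. tdiff W f q (X q))) (at (crd W p p)) v"
    by (simp only: tdiff_def[of W "\<lambda>q. tdiff W f q (X q)"])
  then show ?thesis by (simp only: frechet_derivativeI[OF has_derivative_tdiff_field[OF assms]])
qed

lemma smooth_endo_components_differentiable:
  assumes "smooth_endo W J"
  shows "chart p (components W p (\<lambda>q. J q (coord_field W p v q))) differentiable (at (crd W p p))"
  by (rule smooth_in_differentiable[OF _ crd_mem_dom[OF p]]) (use assms p in \<open>simp add: smooth_endo_def\<close>)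

text \<open>Leibniz rule for d(df o J) with the first derivatives of the endomorphism kept explicit.
  It serves both \<open>J\<close> on the cone and \<open>\<Phi>\<close> on M.\<close>

lemma ext_deriv_differential_endo:
  assumes f: "smooth_in W p f" and J: "smooth_endo W J"
  shows "ext_deriv W (\<lambda>q v. tdiff W f q (J q v)) p v w =
    tdiff2 f p v (J p w) - tdiff2 f p w (J p v) +
    tdiff W f p (tdiff W (components W p (\<lambda>q. J q (coord_field W p w q))) p v
               - tdiff W (components W p (\<lambda>q. J q (coord_field W p v q))) p w)"
  using tdiff_tdiff_field[OF f smooth_endo_components_differentiable[OF J]]
    linear_diff[OF tdiff_linear[OF smooth_in_differentiable[OF f crd_mem_dom[OF p]]]]
  by (simp add: ext_deriv_def coord_field_self[OF p])

end

subsection \<open>One-forms\<close>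

definition smooth_form1 :: "('m \<Rightarrow> 'e \<Rightarrow> real) \<Rightarrow> bool" where
  "smooth_form1 \<alpha> \<longleftrightarrow> (\<forall>p\<in>pts W. linear (\<alpha> p) \<and> (\<forall>v. smooth_in W p (\<lambda>q. \<alpha> q (coord_field W p v q))))"

lemma smooth_form1_differentiable:
  assumes "smooth_form1 \<alpha>" "p \<in> pts W" "x \<in> dom p"
  shows "chart p (\<lambda>q. \<alpha> q (coord_field W p v q)) differentiable (at x)"
  by (rule smooth_in_differentiable[OF _ assms(3)]) (use assms in \<open>simp add: smooth_form1_def\<close>)

lemma smooth_form1_differential_endo:
  fixes f :: "'m \<Rightarrow> real"
  assumes f: "smooth_fun W f" and J: "smooth_endo W J"
  shows "smooth_form1 (\<lambda>q v. tdiff W f q (J q v))"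
  unfolding smooth_form1_def smooth_in_def smooth_on_def
proof (intro ballI conjI allI)
  fix p assume p: "p \<in> pts W"
  have fp: "smooth_in W p f" using f p by (simp add: smooth_fun_def)
  have "linear (tdiff W f p)" by (rule tdiff_linear[OF p smooth_in_differentiable[OF fp crd_mem_dom[OF p]]])
  moreover have "linear (J p)" using J p by (simp add: smooth_endo_def)
  ultimately show "linear (\<lambda>v. tdiff W f p (J p v))" using linear_compose by (auto simp: o_def)
  fix v k
  let ?N = "chart p (components W p (\<lambda>q. J q (coord_field W p v q)))"
  have "smooth_in W p (components W p (\<lambda>q. J q (coord_field W p v q)))"
    using J p by (simp add: smooth_endo_def)
  then have N: "Ck_on k (dom p) ?N" by (rule smooth_in_Ck)
  have "Ck_on k (dom p) (\<lambda>x. frechet_derivative (chart p f) (at x) b)" for b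
    using smooth_in_Ck[OF fp, of "Suc k"] by simp
  then have "Ck_on k (dom p) (\<lambda>x. \<Sum>b\<in>Basis. (?N x \<bullet> b) * frechet_derivative (chart p f) (at x) b)"
    by (intro Ck_on_sum Ck_on_bilinear[OF bounded_bilinear_mult] open_dom[OF p]
        Ck_on_bounded_linear[OF bounded_linear_inner_left _ N])
  then show "Ck_on k (dom p) (\<lambda>x. tdiff W f (crd_inv W p x) (J (crd_inv W p x) (coord_field W p v (crd_inv W p x))))"
  proof (rule Ck_on_cong[OF open_dom[OF p], rotated])
    fix x assume x: "x \<in> dom p"
    have lin: "linear (frechet_derivative (chart p f) (at x))"
      by (rule linear_frechet_derivative[OF smooth_in_differentiable[OF fp x]])
    have "frechet_derivative (chart p f) (at x) (\<Sum>b\<in>Basis. (?N x \<bullet> b) *\<^sub>R b) =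
        (\<Sum>b\<in>Basis. (?N x \<bullet> b) * frechet_derivative (chart p f) (at x) b)"
      by (simp add: linear_sum[OF lin] linear_scale[OF lin])
    then show "(\<Sum>b\<in>Basis. (?N x \<bullet> b) * frechet_derivative (chart p f) (at x) b) =
        tdiff W f (crd_inv W p x) (J (crd_inv W p x) (coord_field W p v (crd_inv W p x)))"
      by (simp add: chart_tdiff[OF p fp x] euclidean_representation components_def)
  qed
qed

lemma smooth_form1_lincomb:
  assumes "smooth_form1 \<alpha>" "smooth_form1 \<beta>"
  shows "smooth_form1 (\<lambda>p v. \<alpha> p v + c * \<beta> p v)"
  using assms unfolding smooth_form1_def smooth_in_def smooth_on_def
  by (auto simp: linear_iff algebra_simps intro!: Ck_on_add Ck_on_bounded_linear[OF bounded_linear_mult_right] open_dom)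

lemma ext_deriv_lincomb:
  assumes "smooth_form1 \<alpha>" "smooth_form1 \<beta>" "p \<in> pts W"
  shows "ext_deriv W (\<lambda>p v. \<alpha> p v + c * \<beta> p v) p v w = ext_deriv W \<alpha> p v w + c * ext_deriv W \<beta> p v w"
proof -
  have "tdiff W (\<lambda>q. \<alpha> q (coord_field W p a q) + c * \<beta> q (coord_field W p a q)) p b =
      tdiff W (\<lambda>q. \<alpha> q (coord_field W p a q)) p b + c * tdiff W (\<lambda>q. \<beta> q (coord_field W p a q)) p b" for a b
    unfolding tdiff_def
    by (subst frechet_derivativeI[OF has_derivative_add[OF _ has_derivative_mult_right]])
       (use smooth_form1_differentiable[OF assms(1,3) crd_mem_dom] smooth_form1_differentiable[OF assms(2,3) crd_mem_dom] assms(3)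
         in \<open>auto simp: frechet_derivative_works[symmetric]\<close>)
  then show ?thesis by (simp add: ext_deriv_def algebra_simps)
qed

lemma ext_deriv_antisym: "ext_deriv W \<alpha> p v w = - ext_deriv W \<alpha> p w v"
  by (simp add: ext_deriv_def)

lemma bilinear_ext_deriv:
  assumes \<alpha>: "smooth_form1 \<alpha>" and p: "p \<in> pts W"
  shows "bilinear (ext_deriv W \<alpha> p)"
proof -
  let ?B = "\<lambda>v w. tdiff W (\<lambda>q. \<alpha> q (coord_field W p w q)) p v"
  have d: "chart p (\<lambda>q. \<alpha> q (coord_field W p w q)) differentiable at (crd W p p)" for w
    by (rule smooth_form1_differentiable[OF \<alpha> p crd_mem_dom[OF p]])
  have l: "linear (\<alpha> q)" "linear (\<lambda>v. coord_field W p v q)" if "q \<in> nbh W p" for q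
    using \<alpha> nbh_pts[OF p that] linear_coord_field[OF p that] by (auto simp: smooth_form1_def)
  have 1: "linear (\<lambda>v. ?B v w)" for w
    using tdiff_linear[OF p d] by simp
  have "?B v (a + b) = ?B v a + ?B v b" for v a b
  proof -
    have "?B v (a + b) = tdiff W (\<lambda>q. \<alpha> q (coord_field W p a q) + \<alpha> q (coord_field W p b q)) p v"
      by (rule tdiff_cong[OF p open_UNIV]) (auto simp: linear_add[OF l(1)] linear_add[OF l(2)])
    also have "\<dots> = ?B v a + ?B v b"
      unfolding tdiff_def
      by (subst frechet_derivativeI[OF has_derivative_add]) (use d in \<open>auto simp: frechet_derivative_works[symmetric]\<close>)
    finally show ?thesis .
  qed
  moreover have "?B v (c *\<^sub>R a) = c *\<^sub>R ?B v a" for v a c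
  proof -
    have "?B v (c *\<^sub>R a) = tdiff W (\<lambda>q. c * \<alpha> q (coord_field W p a q)) p v"
      by (rule tdiff_cong[OF p open_UNIV]) (auto simp: linear_scale[OF l(1)] linear_scale[OF l(2)])
    also have "\<dots> = c *\<^sub>R ?B v a"
      unfolding tdiff_def
      by (subst frechet_derivativeI[OF has_derivative_mult_right]) (use d in \<open>auto simp: frechet_derivative_works[symmetric]\<close>)
    finally show ?thesis .
  qed
  ultimately have 2: "linear (?B v)" for v by (intro linearI)
  have "linear (\<lambda>v. ?B v w - ?B w v)" "linear (\<lambda>w. ?B v w - ?B w v)" for v w
    using 1 2 by (auto intro: linear_compose_sub)
  then show ?thesis unfolding bilinear_def ext_deriv_def by blast
qed

text \<open>The second derivatives of the transition map cancel by symmetry.\<close>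

lemma ext_deriv_chart:
  assumes \<alpha>: "smooth_form1 \<alpha>" and p: "p \<in> pts W" and q: "q \<in> nbh W p"
  shows "ext_deriv W \<alpha> q (coord_field W p v q) (coord_field W p w q) =
    frechet_derivative (chart p (\<lambda>r. \<alpha> r (coord_field W p w r))) (at (crd W p q)) v -
    frechet_derivative (chart p (\<lambda>r. \<alpha> r (coord_field W p v r))) (at (crd W p q)) w"
proof -
  have qp: "q \<in> pts W" by (rule nbh_pts[OF p q])
  let ?O = "crd W p ` (nbh W p \<inter> nbh W q)"
  have O: "open ?O" "crd W p q \<in> ?O" using open_overlap[OF p open_nbh[OF qp]] q mem_nbh[OF qp] by auto
  let ?T = "chart p (crd W q)"
  let ?DT = "\<lambda>x w. frechet_derivative ?T (at x) w"
  let ?A = "\<lambda>y u. \<alpha> (crd_inv W q y) (coord_field W q u (crd_inv W q y))"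
  have T1: "Ck_on k ?O ?T" for k by (rule transition_Ck[OF p qp])
  have Tx: "?T (crd W p q) = crd W q q" using p q by (simp add: crd_inv_crd)
  \<comment> \<open>A coordinate field of \<open>p\<close> is a coordinate field of \<open>q\<close>
    whose coefficient is the derivative of the transition map. Differentiating it therefore leaves,
    besides the transformed derivative of \<alpha>, one term with the second derivative of that
    map.\<close>
  have chg: "chart p (\<lambda>r. \<alpha> r (coord_field W p w r)) x = ?A (?T x) (?DT x w)" if x: "x \<in> ?O" for x w
  proof -
    obtain r where r: "r \<in> nbh W p" "r \<in> nbh W q" "x = crd W p r" using x by blast
    have rp: "r \<in> pts W" by (rule nbh_pts[OF p r(1)])
    note D = chart_compose_has_derivative[OF qp p r(2,1) transition_has_derivative[OF qp rp r(2) mem_nbh[OF rp]]]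
    have "coord_field W p w r = coord_field W q (?DT x w) r"
      unfolding coord_field_def frechet_derivativeI[OF D] r(3) by simp
    then show ?thesis using r p qp by (simp add: crd_inv_crd)
  qed
  have key: "frechet_derivative (chart p (\<lambda>r. \<alpha> r (coord_field W p w r))) (at (crd W p q)) v =
      frechet_derivative (\<lambda>y. ?A y (?DT (crd W p q) w)) (at (crd W q q)) (?DT (crd W p q) v) +
      ?A (crd W q q) (frechet_derivative (\<lambda>x. ?DT x w) (at (crd W p q)) v)" for v w
  proof -
    have dA: "(\<lambda>y. ?A y u) differentiable at (crd W q q)" for u
      using smooth_form1_differentiable[OF \<alpha> qp crd_mem_dom[OF qp]] by simp
    have DT: "(?T has_derivative ?DT (crd W p q)) (at (crd W p q))"
      using Ck_on_has_derivative[OF T1 O(2)] by simp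
    have comp: "((\<lambda>x. ?A (?T x) u) has_derivative
        (\<lambda>v. frechet_derivative (\<lambda>y. ?A y u) (at (crd W q q)) (?DT (crd W p q) v))) (at (crd W p q))" for u
      using has_derivative_compose[OF DT, of "\<lambda>y. ?A y u"] dA[of u] unfolding Tx frechet_derivative_works by blast
    have "((\<lambda>x. ?A (?T x) (?DT x w)) has_derivative
      (\<lambda>h. frechet_derivative (\<lambda>x. ?A (?T x) (?DT (crd W p q) w)) (at (crd W p q)) h +
           ?A (?T (crd W p q)) (frechet_derivative (\<lambda>x. ?DT x w) (at (crd W p q)) h))) (at (crd W p q))"
    proof (rule has_derivative_linear_family[OF O])
      show "linear (\<lambda>u. ?A (?T x) u)" if x: "x \<in> ?O" for x
      proof -
        obtain r where r: "r \<in> nbh W p" "r \<in> nbh W q" "x = crd W p r" using x by blast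
        have "linear (\<alpha> r)" "linear (\<lambda>v. coord_field W q v r)"
          using \<alpha> nbh_pts[OF qp r(2)] linear_coord_field[OF qp r(2)] by (auto simp: smooth_form1_def)
        then have "linear (\<lambda>u. \<alpha> r (coord_field W q u r))" using linear_compose by (auto simp: o_def)
        then show ?thesis using r p qp by (simp add: crd_inv_crd)
      qed
      show "(\<lambda>x. ?A (?T x) u) differentiable at (crd W p q)" for u
        using comp by (auto simp: differentiable_def)
      show "((\<lambda>x. ?DT x w) has_derivative frechet_derivative (\<lambda>x. ?DT x w) (at (crd W p q))) (at (crd W p q))"
        using C2_frechet_derivative_differentiable[OF T1 O(2)] by (simp add: frechet_derivative_works)
    qed
    then have D: "(chart p (\<lambda>r. \<alpha> r (coord_field W p w r)) has_derivative
      (\<lambda>h. frechet_derivative (\<lambda>x. ?A (?T x) (?DT (crd W p q) w)) (at (crd W p q)) h +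
           ?A (?T (crd W p q)) (frechet_derivative (\<lambda>x. ?DT x w) (at (crd W p q)) h))) (at (crd W p q))"
      by (rule has_derivative_transform_within_open[OF _ O]) (simp only: chg)
    then show ?thesis
      by (simp only: frechet_derivativeI[OF D] frechet_derivativeI[OF comp] Tx)
  qed
  have "frechet_derivative (\<lambda>x. ?DT x w) (at (crd W p q)) v = frechet_derivative (\<lambda>x. ?DT x v) (at (crd W p q)) w"
    by (rule frechet_derivative_symmetric[OF O T1])
  then show ?thesis
    unfolding key ext_deriv_def tdiff_def[of W _ q] by (simp add: coord_field_def)
qed

text \<open>\<open>ext_deriv W \<alpha> q\<close> is computed in the chart designated for
  \<open>q\<close>, which may jump with \<open>q\<close>; \<open>ext_deriv_chart\<close> rewrites it
  in the one chart of \<open>p\<close>, where continuity is visible.\<close>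

lemma continuous_ext_deriv:
  assumes \<alpha>: "smooth_form1 \<alpha>" and p: "p \<in> pts W"
  shows "continuous_on (nbh W p) (\<lambda>q. ext_deriv W \<alpha> q (coord_field W p v q) (coord_field W p w q))"
proof -
  have "continuous_on (dom p) (\<lambda>x. frechet_derivative (chart p (\<lambda>r. \<alpha> r (coord_field W p w r))) (at x) v)" for v w
    using smooth_in_Ck[of p _ 1] \<alpha> p by (auto simp: smooth_form1_def)
  then have "continuous_on (dom p) (\<lambda>x. frechet_derivative (chart p (\<lambda>r. \<alpha> r (coord_field W p w r))) (at x) v
      - frechet_derivative (chart p (\<lambda>r. \<alpha> r (coord_field W p v r))) (at x) w)"
    by (intro continuous_on_diff)
  moreover have "continuous_on (nbh W p) (crd W p)" using homeo[OF p] by (simp add: homeomorphism_def)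
  ultimately have "continuous_on (nbh W p) (\<lambda>q. frechet_derivative (chart p (\<lambda>r. \<alpha> r (coord_field W p w r))) (at (crd W p q)) v
      - frechet_derivative (chart p (\<lambda>r. \<alpha> r (coord_field W p v r))) (at (crd W p q)) w)"
    by (rule continuous_on_compose2) auto
  then show ?thesis
    by (rule continuous_on_eq) (simp add: ext_deriv_chart[OF \<alpha> p])
qed

end

section \<open>Cylinders over a manifold\<close>

text \<open>All powers at once, since differentiating raises the exponent. This yields smoothness of
  \<open>ln\<close>, and so of the summand 4 log r in \<psi>.\<close>

lemma Ck_on_inverse_power: "Ck_on k {0<..} (\<lambda>x::real. inverse x ^ m)"
proof (induction k arbitrary: m)
  case 0
  show ?case by (auto intro!: continuous_intros)
next
  case (Suc k)
  show ?case
  proof (rule Ck_on_SucI)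
    fix x :: real assume "x \<in> {0<..}"
    then have "(inverse has_derivative (\<lambda>v. - (inverse x * v * inverse x))) (at x)"
      using has_derivative_inverse'[of x UNIV] by simp
    from has_derivative_power[OF this, of m]
    have "((\<lambda>x. inverse x ^ m) has_derivative
        (\<lambda>v. of_nat m * (- (inverse x * v * inverse x)) * inverse x ^ (m - 1))) (at x)" .
    moreover have "of_nat m * (- (inverse x * v * inverse x)) * inverse x ^ (m - 1)
        = - (of_nat m * v) * inverse x ^ (m + 1)" for v
      by (cases m) simp_all
    ultimately show "((\<lambda>x. inverse x ^ m) has_derivative (\<lambda>v. - (of_nat m * v) * inverse x ^ (m + 1))) (at x)"
      by (simp only:)
  next
    show "Ck_on k {0<..} (\<lambda>x::real. - (of_nat m * v) * inverse x ^ (m + 1))" for v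
      by (rule Ck_on_bounded_linear[OF bounded_linear_mult_right _ Suc]) simp
  qed simp
qed

lemma Ck_on_ln: "Ck_on k {0<..} (ln :: real \<Rightarrow> real)"
proof (cases k)
  case 0
  then show ?thesis by (auto intro!: continuous_intros)
next
  case (Suc j)
  have "Ck_on (Suc j) {0<..} (ln :: real \<Rightarrow> real)"
  proof (rule Ck_on_SucI)
    fix x :: real assume "x \<in> {0<..}"
    then show "(ln has_derivative (\<lambda>v. v * inverse x ^ 1)) (at x)"
      by (auto intro!: derivative_eq_intros simp: field_simps)
  next
    show "Ck_on j {0<..} (\<lambda>x::real. v * inverse x ^ 1)" for v
      by (rule Ck_on_bounded_linear[OF bounded_linear_mult_right _ Ck_on_inverse_power]) simp
  qed simp
  then show ?thesis using Suc by simp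
qed

text \<open>Covers the cone, with \<open>I = {0<..}\<close>, and the cylinder with
  \<open>I = UNIV\<close> that carries the smooth extension of a path.\<close>

locale cylinder_mfd = smooth_mfd M for M :: "('m::t2_space, 'e::euclidean_space) mfd" +
  fixes I :: "real set"
  assumes open_I: "open I"
begin

abbreviation cyl where "cyl \<equiv> cylinder M I"

lemma pts_cyl [simp]: "pts cyl = pts M \<times> I"
  and nbh_cyl [simp]: "nbh cyl (p, s) = nbh M p \<times> I"
  and crd_cyl [simp]: "crd cyl (p, s) (q, u) = (crd M p q, u)"
  by (simp_all add: cylinder_def)

lemma dom_cyl: "crd cyl (p, s) ` (N \<times> I) = crd M p ` N \<times> I"
  by (force simp: image_iff)

lemma crd_inv_cyl:
  assumes "p \<in> pts M" "z \<in> dom p \<times> I"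
  shows "crd_inv cyl (p, s) z = (crd_inv M p (fst z), snd z)"
  unfolding crd_inv_def[of cyl]
proof (rule inv_into_f_eq)
  show "inj_on (crd cyl (p, s)) (nbh cyl (p, s))"
    by (rule inj_on_inverseI[of _ "\<lambda>z. (crd_inv M p (fst z), snd z)"]) (auto simp: crd_inv_crd[OF assms(1)])
qed (use assms in \<open>auto simp: crd_inv_mem crd_crd_inv crd_inv_crd\<close>)

lemma smooth_manifold_cyl: "smooth_manifold cyl"
  unfolding smooth_manifold_def
proof (intro conjI ballI)
  fix x assume "x \<in> pts cyl"
  then obtain p s where x: "x = (p, s)" and p: "p \<in> pts M" and s: "s \<in> I" by auto
  show "x \<in> nbh cyl x" "nbh cyl x \<subseteq> pts cyl" "open (nbh cyl x)" "open (crd cyl x ` nbh cyl x)"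
    using mem_nbh[OF p] nbh_subset[OF p] open_nbh[OF p] open_dom[OF p] s open_I
    by (auto simp: x dom_cyl open_Times)
  have "continuous_on (nbh M p \<times> I) (\<lambda>z. (crd M p (fst z), snd z))"
    using homeo[OF p] unfolding homeomorphism_def
    by (auto intro!: continuous_on_Pair continuous_on_compose2[of "nbh M p" "crd M p"] continuous_intros)
  then have 1: "continuous_on (nbh M p \<times> I) (crd cyl (p, s))"
    by (rule continuous_on_eq) auto
  have "continuous_on (dom p \<times> I) (\<lambda>z. (crd_inv M p (fst z), snd z))"
    using homeo[OF p] unfolding homeomorphism_def
    by (auto intro!: continuous_on_Pair continuous_on_compose2[of "dom p" "crd_inv M p"] continuous_intros)
  then have 2: "continuous_on (dom p \<times> I) (crd_inv cyl (p, s))"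
    by (rule continuous_on_eq) (use p in \<open>auto simp: crd_inv_cyl\<close>)
  show "homeomorphism (nbh cyl x) (crd cyl x ` nbh cyl x) (crd cyl x) (crd_inv cyl x)"
    unfolding x nbh_cyl dom_cyl
    by (rule homeomorphismI[OF 1 2]) (use p in \<open>auto simp: crd_inv_cyl crd_inv_crd\<close>)
next
  fix x y assume "x \<in> pts cyl" "y \<in> pts cyl"
  then obtain p s q t where x: "x = (p, s)" and p: "p \<in> pts M" and s: "s \<in> I"
    and y: "y = (q, t)" and q: "q \<in> pts M" and t: "t \<in> I" by auto
  let ?O = "crd M p ` (nbh M p \<inter> nbh M q)"
  have O: "open ?O" by (rule open_overlap[OF p open_nbh[OF q]])
  have dom: "crd cyl x ` (nbh cyl x \<inter> nbh cyl y) = ?O \<times> I"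
    unfolding x y nbh_cyl by (simp add: Times_Int_Times dom_cyl)
  show "smooth_on (crd cyl x ` (nbh cyl x \<inter> nbh cyl y)) (\<lambda>z. crd cyl y (crd_inv cyl x z))"
    unfolding smooth_on_def dom
  proof
    fix k
    have op: "open (?O \<times> I)" using O open_I by (rule open_Times)
    have "Ck_on k (?O \<times> I) (\<lambda>z. chart p (crd M q) (fst z + 0))"
      by (rule Ck_on_compose_affine[OF linear_fst op _ transition_Ck[OF p q]]) auto
    then have "Ck_on k (?O \<times> I) (\<lambda>z. (chart p (crd M q) (fst z), snd z))"
      by (intro Ck_on_Pair[OF op] Ck_on_linear[OF linear_snd op]) simp
    then show "Ck_on k (?O \<times> I) (\<lambda>z. crd cyl y (crd_inv cyl x z))"
      by (rule Ck_on_cong[OF op, rotated]) (use p q in \<open>auto simp: x y crd_inv_cyl crd_inv_crd\<close>)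
  qed
qed

sublocale C: smooth_mfd cyl
  by unfold_locales (rule smooth_manifold_cyl)

text \<open>The chart inverse of the cylinder has this product form only on
  \<open>dom p \<times> I\<close>, because \<open>inv_into\<close> is arbitrary elsewhere;
  derivatives pass between the two expressions by openness of that set.\<close>

abbreviation cchart where "cchart p f \<equiv> (\<lambda>z. f (crd_inv M p (fst z), snd z))"

context
  fixes p s assumes p: "p \<in> pts M" and s: "s \<in> I"
begin

lemma open_cdom: "open (dom p \<times> I)"
  by (intro open_Times open_dom[OF p] open_I)

lemma cchart_mem: "q \<in> nbh M p \<Longrightarrow> u \<in> I \<Longrightarrow> (crd M p q, u) \<in> dom p \<times> I"
  by simp

lemma smooth_in_cyl_iff: "smooth_in cyl (p, s) f \<longleftrightarrow> (\<forall>k. Ck_on k (dom p \<times> I) (cchart p f))"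
  unfolding smooth_in_def smooth_on_def nbh_cyl dom_cyl
proof (intro iff_allI iffI)
  fix k
  show "Ck_on k (dom p \<times> I) (cchart p f)" if "Ck_on k (dom p \<times> I) (\<lambda>x. f (crd_inv cyl (p, s) x))"
    by (rule Ck_on_cong[OF open_cdom _ that]) (simp add: crd_inv_cyl[OF p])
  show "Ck_on k (dom p \<times> I) (\<lambda>x. f (crd_inv cyl (p, s) x))" if "Ck_on k (dom p \<times> I) (cchart p f)"
    by (rule Ck_on_cong[OF open_cdom _ that]) (simp add: crd_inv_cyl[OF p])
qed

lemma cchart_has_derivative_iff:
  assumes "z \<in> dom p \<times> I"
  shows "((\<lambda>x. f (crd_inv cyl (p, s) x)) has_derivative D) (at z) \<longleftrightarrow> (cchart p f has_derivative D) (at z)"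
  using has_derivative_transform_within_open[OF _ open_cdom assms] crd_inv_cyl[OF p]
  by (smt (verit, best))

lemma tdiff_cyl: "tdiff cyl f (p, s) = frechet_derivative (cchart p f) (at (crd M p p, s))"
proof -
  have "(crd M p p, s) \<in> dom p \<times> I" using mem_nbh[OF p] s by simp
  then show ?thesis
    unfolding tdiff_def frechet_derivative_def by (simp add: cchart_has_derivative_iff)
qed

lemma coord_field_cyl:
  assumes q: "q \<in> nbh M p" "u \<in> I"
  shows "coord_field cyl (p, s) (v, a) (q, u) = (coord_field M p v q, a)"
proof -
  have qp: "q \<in> pts M" by (rule nbh_pts[OF p q(1)])
  note D = transition_has_derivative[OF p qp q(1) mem_nbh[OF qp]]
  have "((\<lambda>z. (chart p (crd M q) (fst z), snd z)) has_derivative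
      (\<lambda>h. (frechet_derivative (chart p (crd M q)) (at (crd M p q)) (fst h), snd h))) (at (crd M p q, u))"
    by (intro has_derivative_Pair has_derivative_compose[OF has_derivative_fst[OF has_derivative_ident]]
        has_derivative_snd has_derivative_ident) (simp add: D)
  then have "(cchart p (crd cyl (q, u)) has_derivative
      (\<lambda>h. (frechet_derivative (chart p (crd M q)) (at (crd M p q)) (fst h), snd h))) (at (crd M p q, u))"
    by simp
  then have "((\<lambda>x. crd cyl (q, u) (crd_inv cyl (p, s) x)) has_derivative
      (\<lambda>h. (frechet_derivative (chart p (crd M q)) (at (crd M p q)) (fst h), snd h))) (at (crd M p q, u))"
    by (subst cchart_has_derivative_iff[OF cchart_mem[OF q]])
  then show ?thesis
    unfolding coord_field_def crd_cyl by (simp add: frechet_derivativeI)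
qed

lemma tdiff_crd_cyl:
  assumes q: "q \<in> nbh M p" "u \<in> I"
  shows "tdiff cyl (crd cyl (p, s)) (q, u) (Y, a) = (tdiff M (crd M p) q Y, a)"
proof -
  have "coord_field cyl (p, s) (tdiff M (crd M p) q Y, a) (q, u) = (Y, a)"
    by (simp add: coord_field_cyl[OF q] coord_field_tdiff_crd[OF p q(1)])
  then show ?thesis
    using C.tdiff_crd_coord_field[of "(p, s)" "(q, u)" "(tdiff M (crd M p) q Y, a)"] p s q by simp
qed

lemma has_derivative_slice:
  assumes "(cchart p f has_derivative D) (at (crd M p p, s))"
  shows "(chart p (\<lambda>q. f (q, s)) has_derivative (\<lambda>v. D (v, 0))) (at (crd M p p))"
proof -
  have "((\<lambda>x. (x, s)) has_derivative (\<lambda>v. (v, 0))) (at (crd M p p))"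
    by (intro has_derivative_Pair has_derivative_ident has_derivative_const)
  from has_derivative_compose[OF this assms] show ?thesis by simp
qed

lemma has_real_derivative_fibre:
  fixes f :: "'m \<times> real \<Rightarrow> real"
  assumes "(cchart p f has_derivative D) (at (crd M p p, s))"
  shows "((\<lambda>u. f (p, u)) has_real_derivative D (0, 1)) (at s)"
proof -
  have "((\<lambda>u. (crd M p p, u)) has_derivative (\<lambda>u. (0, u))) (at s)"
    by (intro has_derivative_Pair has_derivative_ident has_derivative_const)
  from has_derivative_compose[OF this assms]
  have 1: "((\<lambda>u. f (p, u)) has_derivative (\<lambda>u. D (0, u))) (at s)"
    by (simp add: crd_inv_crd[OF p mem_nbh[OF p]])
  have "D (0, u) = D (0, 1) * u" for u
    using linear_scale[OF has_derivative_linear[OF assms], of u "(0, 1)"] by simp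
  then have "(\<lambda>u. D (0, u)) = (*) (D (0, 1))" by (rule ext)
  with 1 show ?thesis by (simp only: has_field_derivative_def)
qed

lemma has_derivative_lift:
  assumes "chart p f differentiable (at (crd M p p))"
  shows "((\<lambda>z. chart p f (fst z)) has_derivative (\<lambda>h. tdiff M f p (fst h))) (at (crd M p p, s))"
  using has_derivative_compose[OF has_derivative_fst[OF has_derivative_ident], of "chart p f" _ "(crd M p p, s)"] assms
  by (simp add: frechet_derivative_works tdiff_def)

lemma smooth_in_cchart_differentiable:
  assumes "smooth_in cyl (p, s) f"
  shows "(cchart p f has_derivative tdiff cyl f (p, s)) (at (crd M p p, s))"
  unfolding tdiff_cyl
  by (rule Ck_on_has_derivative[where k=0 and S="dom p \<times> I"])
     (use assms smooth_in_cyl_iff mem_nbh[OF p] s in \<open>auto simp del: Ck_on.simps\<close>)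

lemma tdiff_slice:
  assumes "smooth_in cyl (p, s) f"
  shows "tdiff cyl f (p, s) (v, 0) = tdiff M (\<lambda>q. f (q, s)) p v"
  using frechet_derivativeI[OF has_derivative_slice[OF smooth_in_cchart_differentiable[OF assms]]]
  by (simp add: tdiff_def[of M])

lemma tdiff_fibre:
  fixes f :: "'m \<times> real \<Rightarrow> real"
  assumes "smooth_in cyl (p, s) f"
  shows "((\<lambda>u. f (p, u)) has_real_derivative tdiff cyl f (p, s) (0, 1)) (at s)"
  by (rule has_real_derivative_fibre[OF smooth_in_cchart_differentiable[OF assms]])

lemma smooth_in_slice:
  assumes "smooth_in cyl (p, s) f"
  shows "smooth_in M p (\<lambda>q. f (q, s))"
  unfolding smooth_in_def smooth_on_def
proof
  fix k
  have lin: "linear (\<lambda>x::'e. (x, 0::real))" by (simp add: linear_iff)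
  have "Ck_on k (dom p) (\<lambda>x. cchart p f ((x, 0) + (0, s)))"
    by (rule Ck_on_compose_affine[OF lin open_dom[OF p], of _ "dom p \<times> I"])
       (use s assms smooth_in_cyl_iff in auto)
  then show "Ck_on k (dom p) (chart p (\<lambda>q. f (q, s)))" by simp
qed

lemma smooth_in_lift:
  assumes "smooth_in M p f"
  shows "smooth_in cyl (p, s) (\<lambda>x. f (fst x))"
  unfolding smooth_in_cyl_iff
proof
  fix k
  have "Ck_on k (dom p \<times> I) (\<lambda>z. chart p f (fst z + 0))"
    by (rule Ck_on_compose_affine[OF linear_fst open_cdom _ smooth_in_Ck[OF assms]]) auto
  then show "Ck_on k (dom p \<times> I) (\<lambda>z. f (fst (crd_inv M p (fst z), snd z)))" by simp
qed

lemma smooth_in_snd: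
  assumes "\<And>k. Ck_on k I h"
  shows "smooth_in cyl (p, s) (\<lambda>x. h (snd x))"
  unfolding smooth_in_cyl_iff
proof
  fix k
  have "Ck_on k (dom p \<times> I) (\<lambda>z. h (snd z + 0))"
    by (rule Ck_on_compose_affine[OF linear_snd open_cdom _ assms]) auto
  then show "Ck_on k (dom p \<times> I) (\<lambda>z. h (snd (crd_inv M p (fst z), snd z)))" by simp
qed

lemma smooth_in_cyl_add:
  assumes "smooth_in cyl (p, s) f" "smooth_in cyl (p, s) g"
  shows "smooth_in cyl (p, s) (\<lambda>x. f x + g x)"
  using assms unfolding smooth_in_cyl_iff by (intro allI Ck_on_add[OF open_cdom]) auto

text \<open>The chart of a cylinder at \<open>(p, s')\<close> does not depend on \<open>s'\<close>,
  so smoothness at a single height already covers the whole fibre \<open>J\<close>.\<close>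

lemma smooth_in_reparametrize:
  assumes J: "open J" and st: "s' \<in> J" and f: "smooth_in (cylinder M J) (p, s') f"
    and map: "\<And>u. u \<in> I \<Longrightarrow> a * u + b \<in> J"
  shows "smooth_in cyl (p, s) (\<lambda>(q, u). f (q, a * u + b))"
  unfolding smooth_in_cyl_iff
proof
  fix k
  interpret J: cylinder_mfd M J by unfold_locales (rule J)
  have lin: "linear (\<lambda>z::'e \<times> real. (fst z, a * snd z))" by (simp add: linear_iff algebra_simps)
  have "Ck_on k (dom p \<times> I) (\<lambda>z. cchart p f ((fst z, a * snd z) + (0, b)))"
    by (rule Ck_on_compose_affine[OF lin open_cdom, of _ "dom p \<times> J"])
       (use map f J.smooth_in_cyl_iff[OF p st] in auto)
  then show "Ck_on k (dom p \<times> I) (\<lambda>z. case (crd_inv M p (fst z), snd z) of (q, u) \<Rightarrow> f (q, a * u + b))"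
    by simp
qed

end

section \<open>Second derivatives on a cylinder, split into slice and fibre directions\<close>

context
  fixes F :: "'m \<times> real \<Rightarrow> real" assumes F: "smooth_fun cyl F"
begin

lemma smooth_in_of_fun: "p \<in> pts M \<Longrightarrow> s \<in> I \<Longrightarrow> smooth_in cyl (p, s) F"
  using F by (simp add: smooth_fun_def)

lemma tdiff2_slice:
  assumes p: "p \<in> pts M" and s: "s \<in> I"
  shows "C.tdiff2 F (p, s) (v, 0) (w, 0) = tdiff2 (\<lambda>q. F (q, s)) p v w"
proof -
  let ?G = "\<lambda>x. tdiff cyl F x (coord_field cyl (p, s) (w, 0) x)"
  have ps: "(p, s) \<in> pts cyl" using p s by simp
  have "C.tdiff2 F (p, s) (v, 0) (w, 0) = tdiff M (\<lambda>q. ?G (q, s)) p v"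
    unfolding C.tdiff2_def
    by (rule tdiff_slice[OF p s C.smooth_in_tdiff_coord_field[OF ps smooth_in_of_fun[OF p s]]])
  also have "\<dots> = tdiff M (\<lambda>q. tdiff M (\<lambda>q. F (q, s)) q (coord_field M p w q)) p v"
    by (rule tdiff_cong[OF p open_UNIV])
       (use s nbh_pts[OF p] in \<open>auto simp: coord_field_cyl[OF p s] tdiff_slice smooth_in_of_fun\<close>)
  finally show ?thesis by (simp only: tdiff2_def)
qed

lemma coord_field_cyl_fibre:
  assumes "p \<in> pts M" "s \<in> I" "q \<in> nbh M p" "u \<in> I"
  shows "coord_field cyl (p, s) (0, 1) (q, u) = (0, 1)"
  by (simp add: coord_field_cyl[OF assms] linear_0[OF linear_coord_field[OF assms(1,3)]])

lemma deriv_fibre: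
  assumes "p \<in> pts M" "s \<in> I" "q \<in> nbh M p" "u \<in> I"
  shows "tdiff cyl F (q, u) (coord_field cyl (p, s) (0, 1) (q, u)) = deriv (\<lambda>u. F (q, u)) u"
  using DERIV_imp_deriv[OF tdiff_fibre[OF _ assms(4) smooth_in_of_fun[OF _ assms(4)]]] nbh_pts[OF assms(1,3)]
  by (simp add: coord_field_cyl_fibre[OF assms])

lemma smooth_in_deriv_fibre:
  assumes p: "p \<in> pts M" and s: "s \<in> I"
  shows "smooth_in M p (\<lambda>q. deriv (\<lambda>u. F (q, u)) s)"
  unfolding smooth_in_def smooth_on_def
proof
  fix k
  have "(p, s) \<in> pts cyl" using p s by simp
  then have "smooth_in M p (\<lambda>q. tdiff cyl F (q, s) (coord_field cyl (p, s) (0, 1) (q, s)))"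
    by (intro smooth_in_slice[OF p s] C.smooth_in_tdiff_coord_field smooth_in_of_fun[OF p s])
  then show "Ck_on k (dom p) (chart p (\<lambda>q. deriv (\<lambda>u. F (q, u)) s))"
    by (intro Ck_on_cong[OF open_dom[OF p] _ smooth_in_Ck]) (simp_all add: deriv_fibre[OF p s _ s] crd_inv_mem[OF p])
qed

lemma tdiff2_slice_fibre:
  assumes p: "p \<in> pts M" and s: "s \<in> I"
  shows "C.tdiff2 F (p, s) (v, 0) (0, 1) = tdiff M (\<lambda>q. deriv (\<lambda>u. F (q, u)) s) p v"
proof -
  let ?G = "\<lambda>x. tdiff cyl F x (coord_field cyl (p, s) (0, 1) x)"
  have ps: "(p, s) \<in> pts cyl" using p s by simp
  have "C.tdiff2 F (p, s) (v, 0) (0, 1) = tdiff M (\<lambda>q. ?G (q, s)) p v"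
    unfolding C.tdiff2_def
    by (rule tdiff_slice[OF p s C.smooth_in_tdiff_coord_field[OF ps smooth_in_of_fun[OF p s]]])
  also have "\<dots> = tdiff M (\<lambda>q. deriv (\<lambda>u. F (q, u)) s) p v"
    by (rule tdiff_cong[OF p open_UNIV])
       (use s in \<open>auto simp: deriv_fibre[OF p s]\<close>)
  finally show ?thesis .
qed

lemma DERIV_deriv_fibre:
  assumes p: "p \<in> pts M" and s: "s \<in> I"
  shows "((\<lambda>t. deriv (\<lambda>u. F (p, u)) t) has_real_derivative C.tdiff2 F (p, s) (0, 1) (0, 1)) (at s)"
proof -
  have ps: "(p, s) \<in> pts cyl" using p s by simp
  have "((\<lambda>t. tdiff cyl F (p, t) (coord_field cyl (p, s) (0, 1) (p, t))) has_real_derivative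
      C.tdiff2 F (p, s) (0, 1) (0, 1)) (at s)"
    unfolding C.tdiff2_def
    by (rule tdiff_fibre[OF p s C.smooth_in_tdiff_coord_field[OF ps smooth_in_of_fun[OF p s]]])
  then show ?thesis
    by (rule has_field_derivative_transform_within_open[OF _ open_I s]) (simp add: deriv_fibre[OF p s mem_nbh[OF p]])
qed

lemmas tdiff2_fibre = DERIV_imp_deriv[OF DERIV_deriv_fibre, symmetric]

end

end

section \<open>Kaehler manifolds\<close>

text \<open>\<open>A z\<close> represents the functional \<open>B z\<close> by the inner product;
  \<open>A\<close> is injective by positivity, hence bijective. This makes the \<open>THE\<close> in
  \<open>christoffel\<close> and \<open>covector_norm\<close> well defined.\<close>

lemma riesz_bilinear:
  fixes B :: "'e::euclidean_space \<Rightarrow> 'e \<Rightarrow> real"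
  assumes bl: "bilinear B" and pd: "\<And>v. v \<noteq> 0 \<Longrightarrow> B v v > 0" and L: "linear L"
  shows "\<exists>!z. \<forall>u. B z u = L u"
proof -
  define A where "A z = (\<Sum>b\<in>Basis. B z b *\<^sub>R b)" for z
  have "linear A" unfolding A_def
    using bl by (intro linear_compose_sum) (auto simp: bilinear_def linear_iff scaleR_add_left)
  have BA: "B z u = A z \<bullet> u" for z u
  proof -
    have "linear (B z)" using bl by (simp add: bilinear_def)
    then have "B z (\<Sum>b\<in>Basis. (u \<bullet> b) *\<^sub>R b) = (\<Sum>b\<in>Basis. (u \<bullet> b) * B z b)"
      by (simp add: linear_sum linear_scale)
    moreover have "A z \<bullet> u = (\<Sum>b\<in>Basis. (u \<bullet> b) * B z b)"
      unfolding A_def inner_sum_left by (intro sum.cong refl) (simp add: inner_commute)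
    ultimately show ?thesis by (simp add: euclidean_representation)
  qed
  have "inj A"
  proof (rule linear_injective_0[OF \<open>linear A\<close>, THEN iffD2], intro allI impI)
    fix z assume "A z = 0"
    then have "B z z = 0" by (simp add: BA)
    then show "z = 0" using pd[of z] by force
  qed
  then have "surj A" using linear_injective_imp_surjective[OF \<open>linear A\<close>] by simp
  define y where "y = (\<Sum>b\<in>Basis. L b *\<^sub>R b)"
  have yL: "y \<bullet> u = L u" for u
  proof -
    have "L (\<Sum>b\<in>Basis. (u \<bullet> b) *\<^sub>R b) = (\<Sum>b\<in>Basis. (u \<bullet> b) * L b)"
      by (simp add: linear_sum[OF L] linear_scale[OF L])
    moreover have "y \<bullet> u = (\<Sum>b\<in>Basis. (u \<bullet> b) * L b)"
      unfolding y_def inner_sum_left by (intro sum.cong refl) (simp add: inner_commute)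
    ultimately show ?thesis by (simp add: euclidean_representation)
  qed
  obtain z where "A z = y" using \<open>surj A\<close> by (metis surjD)
  show ?thesis
  proof (rule ex1I[of _ z])
    show "\<forall>u. B z u = L u" by (simp add: BA \<open>A z = y\<close> yL)
    fix z' assume "\<forall>u. B z' u = L u"
    then have "(A z' - A z) \<bullet> u = 0" for u by (simp add: BA \<open>A z = y\<close> yL inner_diff_left)
    then have "A z' = A z" by (metis eq_iff_diff_eq_0 inner_eq_zero_iff)
    then show "z' = z" using \<open>inj A\<close> by (simp add: inj_eq)
  qed
qed

context smooth_mfd begin

definition metric_coeff :: "('m \<Rightarrow> 'e \<Rightarrow> 'e \<Rightarrow> real) \<Rightarrow> 'm \<Rightarrow> 'e \<Rightarrow> 'e \<Rightarrow> 'm \<Rightarrow> real" where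
  "metric_coeff g p a b q = g q (coord_field W p a q) (coord_field W p b q)"

lemma metric_pts:
  assumes g: "riemannian_metric W g" and "q \<in> pts W"
  shows "bilinear (g q)" "g q v w = g q w v" "v \<noteq> 0 \<Longrightarrow> g q v v > 0"
  using g assms by (auto simp: riemannian_metric_def)

context
  fixes g :: "'m \<Rightarrow> 'e \<Rightarrow> 'e \<Rightarrow> real" and p :: 'm
  assumes g: "riemannian_metric W g" and p: "p \<in> pts W"
begin

lemma metric_coeff_smooth: "smooth_in W p (metric_coeff g p a b)"
  using g p unfolding riemannian_metric_def metric_coeff_def by blast

lemma metric_coeff_commute: "tdiff W (metric_coeff g p a b) p v = tdiff W (metric_coeff g p b a) p v"
  by (rule tdiff_cong[OF p open_UNIV]) (auto simp: metric_coeff_def metric_pts(2)[OF g nbh_pts[OF p]])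

lemma metric_coeff_differentiable: "chart p (metric_coeff g p a b) differentiable (at (crd W p p))"
  by (rule smooth_in_differentiable[OF metric_coeff_smooth crd_mem_dom[OF p]])

lemma linear_tdiff_metric_coeff: "linear (\<lambda>b. tdiff W (metric_coeff g p a b) p v)"
proof (rule linearI)
  have l: "linear (g q x)" "linear (\<lambda>v. coord_field W p v q)" if "q \<in> nbh W p" for q x
    using metric_pts(1)[OF g nbh_pts[OF p that]] linear_coord_field[OF p that] by (auto simp: bilinear_def)
  fix b c
  have "tdiff W (metric_coeff g p a (b + c)) p v = tdiff W (\<lambda>q. metric_coeff g p a b q + metric_coeff g p a c q) p v"
    by (rule tdiff_cong[OF p open_UNIV]) (auto simp: metric_coeff_def linear_add[OF l(1)] linear_add[OF l(2)])
  also have "\<dots> = tdiff W (metric_coeff g p a b) p v + tdiff W (metric_coeff g p a c) p v"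
    unfolding tdiff_def
    by (subst frechet_derivativeI[OF has_derivative_add])
       (use metric_coeff_differentiable in \<open>auto simp: frechet_derivative_works[symmetric]\<close>)
  finally show "tdiff W (metric_coeff g p a (b + c)) p v =
    tdiff W (metric_coeff g p a b) p v + tdiff W (metric_coeff g p a c) p v" .
  fix r
  have "tdiff W (metric_coeff g p a (r *\<^sub>R b)) p v = tdiff W (\<lambda>q. r * metric_coeff g p a b q) p v"
    by (rule tdiff_cong[OF p open_UNIV]) (auto simp: metric_coeff_def linear_scale[OF l(1)] linear_scale[OF l(2)])
  also have "\<dots> = r * tdiff W (metric_coeff g p a b) p v"
    unfolding tdiff_def
    by (subst frechet_derivativeI[OF has_derivative_mult_right])
       (use metric_coeff_differentiable in \<open>auto simp: frechet_derivative_works[symmetric]\<close>)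
  finally show "tdiff W (metric_coeff g p a (r *\<^sub>R b)) p v = r *\<^sub>R tdiff W (metric_coeff g p a b) p v" by simp
qed

lemma linear_tdiff_metric_coeff_dir: "linear (tdiff W (metric_coeff g p a b) p)"
  by (rule tdiff_linear[OF p metric_coeff_differentiable])

lemma christoffel_ex1:
  "\<exists>!z. \<forall>u. g p z u = (tdiff W (metric_coeff g p w u) p v + tdiff W (metric_coeff g p v u) p w
      - tdiff W (metric_coeff g p v w) p u) / 2"
proof (rule riesz_bilinear[OF metric_pts(1)[OF g p] metric_pts(3)[OF g p]])
  note l = linear_tdiff_metric_coeff[of w v] linear_tdiff_metric_coeff[of v w] linear_tdiff_metric_coeff_dir[of v w]
  have "linear (\<lambda>u. (1 / 2) *\<^sub>R (tdiff W (metric_coeff g p w u) p v + tdiff W (metric_coeff g p v u) p w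
      - tdiff W (metric_coeff g p v w) p u))"
    by (intro linear_compose_scale_right linear_compose_sub linear_compose_add l)
  then show "linear (\<lambda>u. (tdiff W (metric_coeff g p w u) p v + tdiff W (metric_coeff g p v u) p w
      - tdiff W (metric_coeff g p v w) p u) / 2)" by simp
qed

lemma christoffel_eq:
  "g p (christoffel W g p v w) u = (tdiff W (metric_coeff g p w u) p v + tdiff W (metric_coeff g p v u) p w
      - tdiff W (metric_coeff g p v w) p u) / 2"
  using theI'[OF christoffel_ex1[of w v]] unfolding christoffel_def Let_def metric_coeff_def by blast

lemma christoffel_unique:
  assumes "\<And>u. g p z u = (tdiff W (metric_coeff g p w u) p v + tdiff W (metric_coeff g p v u) p w
      - tdiff W (metric_coeff g p v w) p u) / 2"
  shows "christoffel W g p v w = z"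
  using christoffel_ex1[of w v] assms christoffel_eq[of v w] by blast

lemma christoffel_commute: "christoffel W g p v w = christoffel W g p w v"
  by (rule christoffel_unique) (simp add: christoffel_eq metric_coeff_commute[of w v])

lemma christoffel_minus: "christoffel W g p v (- w) = - christoffel W g p v w"
proof (rule christoffel_unique)
  fix u
  have "tdiff W (metric_coeff g p (- w) u) p v = - tdiff W (metric_coeff g p w u) p v"
    using linear_neg[OF linear_tdiff_metric_coeff[of u v], of w] metric_coeff_commute by metis
  moreover have "tdiff W (metric_coeff g p v (- w)) p u = - tdiff W (metric_coeff g p v w) p u"
    using linear_neg[OF linear_tdiff_metric_coeff[of v u], of w] by simp
  moreover have "tdiff W (metric_coeff g p v u) p (- w) = - tdiff W (metric_coeff g p v u) p w"
    using linear_neg[OF linear_tdiff_metric_coeff_dir] by simp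
  ultimately show "g p (- christoffel W g p v w) u = (tdiff W (metric_coeff g p (- w) u) p v +
      tdiff W (metric_coeff g p v u) p (- w) - tdiff W (metric_coeff g p v (- w)) p u) / 2"
    using bilinear_lneg[OF metric_pts(1)[OF g p]] by (simp add: christoffel_eq field_simps)
qed

end

lemma tdiff_eqI: "(chart p f has_derivative D) (at (crd W p p)) \<Longrightarrow> tdiff W f p v = D v"
  unfolding tdiff_def by (simp add: frechet_derivativeI)

text \<open>The operator dd^c up to sign and normalisation. It is used for \<open>J\<close> on the
  cone and, as its basic counterpart, for \<open>\<Phi>\<close> on M.\<close>

definition ddJ :: "('m \<Rightarrow> 'e \<Rightarrow> 'e) \<Rightarrow> ('m \<Rightarrow> real) \<Rightarrow> 'm \<Rightarrow> 'e \<Rightarrow> 'e \<Rightarrow> real" where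
  "ddJ J f = ext_deriv W (\<lambda>q v. tdiff W f q (J q v))"

context
  fixes g :: "'m \<Rightarrow> 'e \<Rightarrow> 'e \<Rightarrow> real" and J :: "'m \<Rightarrow> 'e \<Rightarrow> 'e"
  assumes kaehler: "kaehler W g J"
begin

lemma kaehler_metric: "riemannian_metric W g" and kaehler_endo: "smooth_endo W J"
  using kaehler by (auto simp: kaehler_def)

lemma kaehler_square: "p \<in> pts W \<Longrightarrow> J p (J p v) = - v"
  using kaehler by (auto simp: kaehler_def)

text \<open>A coordinate field has constant components, so its covariant derivative is the
  Christoffel term alone; parallelism of \<open>J\<close> then determines the coordinate derivative
  of \<open>J\<close>.\<close>

lemma kaehler_components:
  assumes p: "p \<in> pts W"
  shows "tdiff W (components W p (\<lambda>q. J q (coord_field W p w q))) p v =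
    J p (christoffel W g p v w) - christoffel W g p v (J p w)"
proof -
  have "tdiff W (components W p (coord_field W p w)) p v = tdiff W (\<lambda>q. w) p v"
    by (rule tdiff_cong[OF p open_UNIV]) (auto simp: components_def tdiff_crd_coord_field[OF p])
  then have "tdiff W (components W p (coord_field W p w)) p v = 0"
    by (simp add: tdiff_def)
  moreover have "levi_civita W g (\<lambda>q. J q (coord_field W p w q)) p v = J p (levi_civita W g (coord_field W p w) p v)"
    using kaehler p by (simp add: kaehler_def)
  ultimately show ?thesis
    by (simp add: levi_civita_def coord_field_self[OF p] algebra_simps)
qed

text \<open>In terms of the covariant Hessian \<open>H(v,w) = D\<^sup>2f(v,w) - df(\<Gamma>(v,w))\<close>, which is symmetric,
  \<open>d(df \<circ> J)(v,w) = H(v,Jw) - H(w,Jv)\<close>; this is \<open>J\<close>-invariant.\<close>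

lemma ddJ_hessian:
  assumes p: "p \<in> pts W" and f: "smooth_in W p f"
  shows "ddJ J f p v w = (tdiff2 f p v (J p w) - tdiff W f p (christoffel W g p v (J p w)))
    - (tdiff2 f p w (J p v) - tdiff W f p (christoffel W g p w (J p v)))"
proof -
  have lin: "linear (tdiff W f p)" by (rule tdiff_linear[OF p smooth_in_differentiable[OF f crd_mem_dom[OF p]]])
  show ?thesis
    unfolding ddJ_def ext_deriv_differential_endo[OF p f kaehler_endo] kaehler_components[OF p]
    by (simp add: linear_diff[OF lin] christoffel_commute[OF kaehler_metric p, of w v])
qed

text \<open>With J^2 = -1 and symmetric H, H(Jv, JJw) - H(Jw, JJv) = -H(Jv, w) + H(Jw, v), which is
  the original expression with its two terms exchanged.\<close>

lemma ddJ_invariant: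
  assumes p: "p \<in> pts W" and f: "smooth_in W p f"
  shows "ddJ J f p (J p v) (J p w) = ddJ J f p v w"
proof -
  have lin: "linear (tdiff W f p)" by (rule tdiff_linear[OF p smooth_in_differentiable[OF f crd_mem_dom[OF p]]])
  show ?thesis
    unfolding ddJ_hessian[OF p f] kaehler_square[OF p] christoffel_minus[OF kaehler_metric p]
      bilinear_rneg[OF tdiff2_bilinear[OF p f]] linear_neg[OF lin]
    using tdiff2_commute[OF p f, of "J p v" w] tdiff2_commute[OF p f, of "J p w" v]
      christoffel_commute[OF kaehler_metric p, of "J p v" w] christoffel_commute[OF kaehler_metric p, of "J p w" v]
    by simp
qed

text \<open>The (0,1)-part of df is (df + \<i> df o J)/2. Its exact half is killed by d through
  symmetry of the Hessian, and the projection to type (1,1) fixes the other half by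
  \<open>ddJ_invariant\<close>.\<close>

lemma del_delbar_eq_ddJ:
  assumes p: "p \<in> pts W" and f: "smooth_fun W f"
  shows "del_delbar W J f p v w = \<i> / 2 * complex_of_real (ddJ J f p v w)"
proof -
  have fp: "smooth_in W p f" using f p by (simp add: smooth_fun_def)
  let ?\<alpha> = "\<lambda>q v. tdiff W f q (J q v)"
  have sf: "smooth_form1 ?\<alpha>" by (rule smooth_form1_differential_endo[OF f kaehler_endo])
  have "tdiff W (\<lambda>q. delbar W J f q (coord_field W p a q)) p b =
      (complex_of_real (tdiff2 f p b a) + \<i> * complex_of_real (tdiff W (\<lambda>q. ?\<alpha> q (coord_field W p a q)) p b)) / 2" for a b
  proof -
    let ?x = "crd W p p"
    have 1: "(chart p (\<lambda>q. tdiff W f q (coord_field W p a q)) has_derivative (\<lambda>b. tdiff2 f p b a)) (at ?x)"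
      using smooth_in_differentiable[OF smooth_in_tdiff_coord_field[OF p fp] crd_mem_dom[OF p], of a]
      by (simp add: frechet_derivative_works tdiff2_def tdiff_def[of W _ p])
    have 2: "(chart p (\<lambda>q. ?\<alpha> q (coord_field W p a q)) has_derivative
        (\<lambda>b. tdiff W (\<lambda>q. ?\<alpha> q (coord_field W p a q)) p b)) (at ?x)"
      using smooth_form1_differentiable[OF sf p crd_mem_dom[OF p], of a]
      by (simp add: frechet_derivative_works tdiff_def[of W _ p])
    have "(chart p (\<lambda>q. (complex_of_real (tdiff W f q (coord_field W p a q)) +
        \<i> * complex_of_real (?\<alpha> q (coord_field W p a q))) / 2) has_derivative
       (\<lambda>b. (complex_of_real (tdiff2 f p b a) + \<i> * complex_of_real (tdiff W (\<lambda>q. ?\<alpha> q (coord_field W p a q)) p b)) / 2)) (at ?x)"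
      by (intro bounded_linear.has_derivative[OF bounded_linear_divide] has_derivative_add has_derivative_of_real
          has_derivative_mult_right 1 2)
    from tdiff_eqI[OF this] show ?thesis
      unfolding delbar_def part01_def .
  qed
  then have "ext_deriv W (delbar W J f) p v w = \<i> / 2 * complex_of_real (ddJ J f p v w)" for v w
    using tdiff2_commute[OF p fp, of v w] by (simp add: ext_deriv_def ddJ_def field_simps)
  then show ?thesis
    by (simp add: del_delbar_def part11_def ddJ_invariant[OF p fp])
qed

end

end

section \<open>The cone of a Sasakian manifold\<close>

locale sasakian_mfd = smooth_mfd M for M :: "('m::t2_space, 'e::euclidean_space) mfd" +
  fixes \<xi> :: "'m \<Rightarrow> 'e" and \<eta> :: "'m \<Rightarrow> 'e \<Rightarrow> real" and \<Phi> :: "'m \<Rightarrow> 'e \<Rightarrow> 'e"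
    and g :: "'m \<Rightarrow> 'e \<Rightarrow> 'e \<Rightarrow> real"
  assumes sasakian: "sasakian M \<xi> \<eta> \<Phi> g"
begin

sublocale cylinder_mfd M "{0<..}"
  by unfold_locales simp

abbreviation J where "J \<equiv> cone_J \<xi> \<eta> \<Phi>"

lemma J_simp [simp]: "J (p, r) (Y, s) = (\<Phi> p Y + (s / r) *\<^sub>R \<xi> p, - (\<eta> p Y * r))"
  by (simp add: cone_J_def)

lemma kaehler_cone: "kaehler cyl (cone_metric g) J"
  using sasakian by (simp add: sasakian_def cone_def)

lemmas endo_J = C.kaehler_endo[OF kaehler_cone]

lemma metric: "riemannian_metric M g"
  using sasakian by (simp add: sasakian_def)

context
  fixes p assumes p: "p \<in> pts M"
begin

lemma eta_metric: "\<eta> p v = g p (\<xi> p) v" and Phi_levi_civita: "\<Phi> p v = levi_civita M g \<xi> p v"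
  using sasakian p by (simp_all add: sasakian_def)

lemma smooth_xi: "smooth_in M p (components M p \<xi>)"
  using sasakian p by (simp add: sasakian_def smooth_field_def)

text \<open>Read off from the cone at radius 1, as are the structure equations below: linearity of
  \<open>J\<close> and J^2 = -1 contain them.\<close>

lemma linear_Phi: "linear (\<Phi> p)" and linear_eta: "linear (\<eta> p)"
proof -
  have lin: "linear (J (p, 1))" using endo_J p by (simp add: smooth_endo_def)
  show "linear (\<Phi> p)"
  proof (rule linearI)
    show "\<Phi> p (x + y) = \<Phi> p x + \<Phi> p y" for x y
      using linear_add[OF lin, of "(x, 0)" "(y, 0)"] by simp
    show "\<Phi> p (c *\<^sub>R x) = c *\<^sub>R \<Phi> p x" for c x
      using linear_scale[OF lin, of c "(x, 0)"] by simp
  qed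
  show "linear (\<eta> p)"
  proof (rule linearI)
    show "\<eta> p (x + y) = \<eta> p x + \<eta> p y" for x y
      using linear_add[OF lin, of "(x, 0)" "(y, 0)"] by simp
    show "\<eta> p (c *\<^sub>R x) = c *\<^sub>R \<eta> p x" for c x
      using linear_scale[OF lin, of c "(x, 0)"] by simp
  qed
qed

lemma J_square: "r > 0 \<Longrightarrow> J (p, r) (J (p, r) x) = - x"
  using C.kaehler_square[OF kaehler_cone] p by simp

lemma Phi_square: "\<Phi> p (\<Phi> p v) = \<eta> p v *\<^sub>R \<xi> p - v" and eta_Phi: "\<eta> p (\<Phi> p v) = 0"
  using J_square[of 1 "(v, 0)"] by (auto simp: algebra_simps)

lemma Phi_xi: "\<Phi> p (\<xi> p) = 0" and eta_xi: "\<eta> p (\<xi> p) = 1"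
  using J_square[of 1 "(0, 1)"] linear_0[OF linear_Phi] linear_0[OF linear_eta] by auto

lemma components_J:
  assumes "s > 0" "q \<in> nbh M p" "u > 0"
  shows "components cyl (p, s) (\<lambda>x. J x (coord_field cyl (p, s) (w, b) x)) (q, u) =
    (components M p (\<lambda>q. \<Phi> q (coord_field M p w q)) q + (b / u) *\<^sub>R components M p \<xi> q,
     - (\<eta> q (coord_field M p w q) * u))"
  unfolding components_def using assms p
  by (simp add: coord_field_cyl tdiff_crd_cyl linear_add[OF linear_tdiff_crd] linear_scale[OF linear_tdiff_crd])

text \<open>A slice of the smoothness of \<open>J\<close>; taking \<open>fst\<close> or the negative
  of \<open>snd\<close> for \<open>L\<close> gives smoothness of \<open>\<Phi>\<close> or
  \<open>\<eta>\<close>.\<close>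

lemma smooth_slice_J:
  assumes "bounded_linear L"
  shows "smooth_in M p (\<lambda>q. L (components M p (\<lambda>q. \<Phi> q (coord_field M p w q)) q, - \<eta> q (coord_field M p w q)))"
  unfolding smooth_in_def smooth_on_def
proof
  fix k
  let ?X = "\<lambda>x. J x (coord_field cyl (p, 1) (w, 0) x)"
  have "smooth_in cyl (p, 1) (components cyl (p, 1) ?X)"
    using endo_J p by (simp add: smooth_endo_def)
  then have "smooth_in M p (\<lambda>q. components cyl (p, 1) ?X (q, 1))"
    using p by (intro smooth_in_slice) simp_all
  then have "Ck_on k (dom p) (\<lambda>x. L (components cyl (p, 1) ?X (crd_inv M p x, 1)))"
    by (rule Ck_on_bounded_linear[OF assms open_dom[OF p] smooth_in_Ck])
  then show "Ck_on k (dom p) (chart p (\<lambda>q. L (components M p (\<lambda>q. \<Phi> q (coord_field M p w q)) q, - \<eta> q (coord_field M p w q))))"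
    by (rule Ck_on_cong[OF open_dom[OF p], rotated]) (simp add: components_J crd_inv_mem[OF p])
qed

end

lemma smooth_eta: "smooth_form1 \<eta>"
  unfolding smooth_form1_def
proof (intro ballI conjI allI)
  fix p w assume p: "p \<in> pts M"
  have "bounded_linear (\<lambda>z::'e \<times> real. - snd z)"
    by (intro bounded_linear_minus bounded_linear_snd)
  from smooth_slice_J[OF p this] show "smooth_in M p (\<lambda>q. \<eta> q (coord_field M p w q))" by simp
qed (rule linear_eta)

lemma endo_Phi: "smooth_endo M \<Phi>"
  unfolding smooth_endo_def
proof (intro ballI conjI allI)
  fix p w assume p: "p \<in> pts M"
  from smooth_slice_J[OF p bounded_linear_fst]
  show "smooth_in M p (components M p (\<lambda>q. \<Phi> q (coord_field M p w q)))" by simp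
qed (rule linear_Phi)

text \<open>Leibniz rule for g(\<xi>, w), where the metric derivatives match the Christoffel terms
  of \<nabla>\<xi> after antisymmetrising. Here \<open>\<Phi>\<close> enters as \<nabla>\<xi>; the
  gain is that d\<eta>(v, \<Phi> v) > 0 for nonzero horizontal v.\<close>

lemma ext_deriv_eta:
  assumes p: "p \<in> pts M"
  shows "ext_deriv M \<eta> p v w = g p (\<Phi> p v) w - g p (\<Phi> p w) v"
proof -
  let ?mc = "metric_coeff g p"
  let ?N = "chart p (components M p \<xi>)"
  let ?x = "crd M p p"
  have x: "?x \<in> dom p" by (rule crd_mem_dom[OF p])
  have inv: "crd_inv M p ?x = p" by (rule crd_inv_crd[OF p mem_nbh[OF p]])
  have Nx: "?N ?x = \<xi> p" by (simp add: inv components_self[OF p])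
  have xi: "\<xi> q = coord_field M p (components M p \<xi> q) q" if "q \<in> nbh M p" for q
    by (simp add: components_def coord_field_tdiff_crd[OF p that])
  have D: "tdiff M (\<lambda>q. \<eta> q (coord_field M p w q)) p v =
      tdiff M (?mc (\<xi> p) w) p v + g p (tdiff M (components M p \<xi>) p v) w" for v w
  proof -
    let ?A = "\<lambda>y u. chart p (?mc u w) y"
    have "((\<lambda>y. ?A y (?N y)) has_derivative
      (\<lambda>h. frechet_derivative (\<lambda>y. ?A y (?N ?x)) (at ?x) h + ?A ?x (frechet_derivative ?N (at ?x) h))) (at ?x)"
    proof (rule has_derivative_linear_family[OF open_dom[OF p] x])
      show "linear (?A y)" if "y \<in> dom p" for y
      proof -
        have q: "crd_inv M p y \<in> nbh M p" by (rule crd_inv_mem[OF p that])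
        have "linear (\<lambda>u. g (crd_inv M p y) u (coord_field M p w (crd_inv M p y)))"
          using metric_pts(1)[OF metric nbh_pts[OF p q]] unfolding bilinear_def by blast
        from linear_compose[OF linear_coord_field[OF p q] this] show ?thesis
          by (simp add: o_def metric_coeff_def)
      qed
      show "(\<lambda>y. ?A y u) differentiable at ?x" for u
        by (rule metric_coeff_differentiable[OF metric p])
      show "(?N has_derivative frechet_derivative ?N (at ?x)) (at ?x)"
        using smooth_in_differentiable[OF smooth_xi[OF p] x] by (simp add: frechet_derivative_works)
    qed
    then have "(chart p (\<lambda>q. \<eta> q (coord_field M p w q)) has_derivative
      (\<lambda>h. frechet_derivative (\<lambda>y. ?A y (?N ?x)) (at ?x) h + ?A ?x (frechet_derivative ?N (at ?x) h))) (at ?x)"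
    proof (rule has_derivative_transform_within_open[OF _ open_dom[OF p] x])
      fix y assume "y \<in> dom p"
      then have q: "crd_inv M p y \<in> nbh M p" by (rule crd_inv_mem[OF p])
      show "?A y (?N y) = \<eta> (crd_inv M p y) (coord_field M p w (crd_inv M p y))"
        unfolding metric_coeff_def xi[OF q, symmetric] by (simp add: eta_metric[OF nbh_pts[OF p q]])
    qed
    from tdiff_eqI[OF this] show ?thesis
      by (simp add: Nx) (simp add: tdiff_def metric_coeff_def inv coord_field_self[OF p])
  qed
  have G: "g p (\<Phi> p v) w = g p (tdiff M (components M p \<xi>) p v) w +
     (tdiff M (?mc (\<xi> p) w) p v + tdiff M (?mc v w) p (\<xi> p) - tdiff M (?mc v (\<xi> p)) p w) / 2" for v w
    unfolding Phi_levi_civita[OF p] levi_civita_def bilinear_ladd[OF metric_pts(1)[OF metric p]]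
      christoffel_eq[OF metric p] ..
  show ?thesis
    unfolding ext_deriv_def D G
    using metric_coeff_commute[OF metric p, of v "\<xi> p" w] metric_coeff_commute[OF metric p, of w "\<xi> p" v]
      metric_coeff_commute[OF metric p, of v w "\<xi> p"]
    by (simp add: field_simps)
qed

subsection \<open>The form \<open>d(dF \<circ> J)\<close> on the cone\<close>

text \<open>This and \<open>dxi\<close> are chart-dependent coordinate derivatives:
  \<open>dPhi\<close> is absorbed into \<open>ddJ \<Phi>\<close>, and \<open>dxi\<close> is
  eliminated through basicness.\<close>

definition dPhi where "dPhi p v w = tdiff M (components M p (\<lambda>q. \<Phi> q (coord_field M p w q))) p v"
definition dxi where "dxi p v = tdiff M (components M p \<xi>) p v"

lemma ddPhi_eq:
  assumes "p \<in> pts M" "smooth_in M p f"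
  shows "ddJ \<Phi> f p v w = tdiff2 f p v (\<Phi> p w) - tdiff2 f p w (\<Phi> p v) + tdiff M f p (dPhi p v w - dPhi p w v)"
  unfolding ddJ_def dPhi_def by (rule ext_deriv_differential_endo[OF assms endo_Phi])

context
  fixes F :: "'m \<times> real \<Rightarrow> real" and p :: 'm and r :: real
  assumes F: "smooth_fun cyl F" and p: "p \<in> pts M" and r: "r > 0"
begin

lemma pr: "(p, r) \<in> pts cyl" and r': "r \<in> {0<..}"
  using p r by simp_all

lemma Fpr: "smooth_in cyl (p, r) F"
  by (rule smooth_in_of_fun[OF F p r'])

lemma tdiff_components_J:
  "tdiff cyl (components cyl (p, r) (\<lambda>x. J x (coord_field cyl (p, r) (w, b) x))) (p, r) (v, a) =
    (dPhi p v w + (b / r) *\<^sub>R dxi p v - (a * b / r\<^sup>2) *\<^sub>R \<xi> p,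
     - (a * \<eta> p w) - r * tdiff M (\<lambda>q. \<eta> q (coord_field M p w q)) p v)"
proof -
  let ?x = "crd M p p" and ?X = "components cyl (p, r) (\<lambda>x. J x (coord_field cyl (p, r) (w, b) x))"
  let ?P = "chart p (components M p (\<lambda>q. \<Phi> q (coord_field M p w q)))" and ?Q = "chart p (components M p \<xi>)"
  let ?R = "chart p (\<lambda>q. \<eta> q (coord_field M p w q))"
  have x: "?x \<in> dom p" by (rule crd_mem_dom[OF p])
  have inv: "crd_inv M p ?x = p" by (rule crd_inv_crd[OF p mem_nbh[OF p]])
  have 1: "((\<lambda>z. ?P (fst z)) has_derivative (\<lambda>h. dPhi p (fst h) w)) (at (?x, r))"
    unfolding dPhi_def by (rule has_derivative_lift[OF p r' smooth_endo_components_differentiable[OF p endo_Phi]])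
  have 2: "((\<lambda>z. ?Q (fst z)) has_derivative (\<lambda>h. dxi p (fst h))) (at (?x, r))"
    unfolding dxi_def by (rule has_derivative_lift[OF p r' smooth_in_differentiable[OF smooth_xi[OF p] x]])
  have 3: "((\<lambda>z. ?R (fst z)) has_derivative (\<lambda>h. tdiff M (\<lambda>q. \<eta> q (coord_field M p w q)) p (fst h))) (at (?x, r))"
    by (rule has_derivative_lift[OF p r' smooth_form1_differentiable[OF smooth_eta p x]])
  have 4: "((\<lambda>z::'e \<times> real. b / snd z) has_derivative (\<lambda>h. - (snd h * b / r\<^sup>2))) (at (?x, r))"
    using r by (auto intro!: derivative_eq_intros simp: field_simps power2_eq_square)
  have "((\<lambda>z::'e \<times> real. (?P (fst z) + (b / snd z) *\<^sub>R ?Q (fst z), - (?R (fst z) * snd z))) has_derivative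
      (\<lambda>h. (dPhi p (fst h) w + ((b / snd (?x, r)) *\<^sub>R dxi p (fst h) + (- (snd h * b / r\<^sup>2)) *\<^sub>R ?Q (fst (?x, r))),
        - (?R (fst (?x, r)) * snd h + tdiff M (\<lambda>q. \<eta> q (coord_field M p w q)) p (fst h) * snd (?x, r))))) (at (?x, r))"
    by (intro has_derivative_Pair has_derivative_add has_derivative_scaleR has_derivative_minus has_derivative_mult
        1 2 3 4 has_derivative_snd has_derivative_ident)
  then have "(cchart p ?X has_derivative
      (\<lambda>h. (dPhi p (fst h) w + ((b / snd (?x, r)) *\<^sub>R dxi p (fst h) + (- (snd h * b / r\<^sup>2)) *\<^sub>R ?Q (fst (?x, r))),
        - (?R (fst (?x, r)) * snd h + tdiff M (\<lambda>q. \<eta> q (coord_field M p w q)) p (fst h) * snd (?x, r))))) (at (?x, r))"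
  proof (rule has_derivative_transform_within_open[OF _ open_cdom[OF p r']])
    fix z :: "'e \<times> real" assume "z \<in> dom p \<times> {0<..}"
    then show "(?P (fst z) + (b / snd z) *\<^sub>R ?Q (fst z), - (?R (fst z) * snd z)) = cchart p ?X z"
      using components_J[OF p r crd_inv_mem[OF p]] by auto
  qed (use x r in auto)
  then show ?thesis
    unfolding tdiff_cyl[OF p r'] by (simp add: frechet_derivativeI inv components_self[OF p] coord_field_self[OF p] algebra_simps)
qed

lemma bilinear_T: "bilinear (C.tdiff2 F (p, r))" and linear_D: "linear (tdiff cyl F (p, r))"
  using C.tdiff2_bilinear[OF pr Fpr] C.tdiff_linear[OF pr C.smooth_in_differentiable[OF Fpr C.crd_mem_dom[OF pr]]]
  by auto

lemma T_Pair: "C.tdiff2 F (p, r) x (w, b) = C.tdiff2 F (p, r) x (w, 0) + b * C.tdiff2 F (p, r) x (0, 1)"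
  using bilinear_radd[OF bilinear_T, of x "(w, 0)" "b *\<^sub>R (0, 1)"] bilinear_rmul[OF bilinear_T, of x b "(0, 1)"] by simp

lemma T_Pair': "C.tdiff2 F (p, r) (w, b) x = C.tdiff2 F (p, r) (w, 0) x + b * C.tdiff2 F (p, r) (0, 1) x"
  using T_Pair C.tdiff2_commute[OF pr Fpr] by metis

lemma D_Pair: "tdiff cyl F (p, r) (w, b) = tdiff cyl F (p, r) (w, 0) + b * tdiff cyl F (p, r) (0, 1)"
  using linear_add[OF linear_D, of "(w, 0)" "b *\<^sub>R (0, 1)"] linear_scale[OF linear_D, of b "(0, 1)"] by simp

text \<open>The \<xi>-term with coefficient \<open>a * b / r\<^sup>2\<close> in
  \<open>tdiff_components_J\<close> is symmetric and drops out of the antisymmetrisation.\<close>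

lemma ddJ_cone:
  "C.ddJ J F (p, r) (v, a) (w, b) =
    C.tdiff2 F (p, r) (v, a) (J (p, r) (w, b)) - C.tdiff2 F (p, r) (w, b) (J (p, r) (v, a)) +
    tdiff cyl F (p, r) (dPhi p v w - dPhi p w v + (b / r) *\<^sub>R dxi p v - (a / r) *\<^sub>R dxi p w,
      b * \<eta> p v - a * \<eta> p w - r * ext_deriv M \<eta> p v w)"
  unfolding C.ddJ_def C.ext_deriv_differential_endo[OF pr Fpr endo_J] tdiff_components_J
  by (simp add: algebra_simps ext_deriv_def)

text \<open>At the boundary of \<open>M \<times> [1,3/2]\<close> nothing is known about \<open>\<partial>F/\<partial>r\<close>; on \<open>\<D>\<close> it only enters as a
  multiple of \<open>d\<eta>\<close>, which cancels in \<open>\<Omega>\<^sub>\<psi>\<close>.\<close>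

lemma ddJ_cone_contact:
  assumes "\<eta> p v = 0" "\<eta> p w = 0"
  shows "C.ddJ J F (p, r) (v, 0) (w, 0) =
    ddJ \<Phi> (\<lambda>q. F (q, r)) p v w - r * tdiff cyl F (p, r) (0, 1) * ext_deriv M \<eta> p v w"
proof -
  have f: "smooth_in M p (\<lambda>q. F (q, r))" by (rule smooth_in_slice[OF p r' Fpr])
  have e: "tdiff cyl F (p, r) (v, - (r * x)) = tdiff M (\<lambda>q. F (q, r)) p v - r * x * tdiff cyl F (p, r) (0, 1)" for v x
    using D_Pair[of v "- (r * x)"] tdiff_slice[OF p r' Fpr, of v] by simp
  show ?thesis
    unfolding ddJ_cone ddPhi_eq[OF p f] using assms
    by (simp add: tdiff2_slice[OF F p r'] e)
qed

text \<open>The derivative of the identity dF(\<xi>) = 0. The neighbourhood \<open>N\<close> is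
  present because \<open>F\<close> will be an arbitrary smooth extension of \<psi>, with dF(\<xi>) =
  0 known only over M x [1, 3/2].\<close>

lemma tdiff2_basic:
  assumes N: "open N" "(p, r) \<in> N" "\<And>q u. q \<in> nbh M p \<Longrightarrow> u > 0 \<Longrightarrow> (q, u) \<in> N \<Longrightarrow> tdiff cyl F (q, u) (\<xi> q, 0) = 0"
  shows "tdiff cyl F (p, r) (dxi p (fst h), 0) = - C.tdiff2 F (p, r) h (\<xi> p, 0)"
proof -
  let ?X = "\<lambda>x. (\<xi> (fst x), 0)"
  have comp: "components cyl (p, r) ?X (q, u) = (components M p \<xi> q, 0)" if "q \<in> nbh M p" "u > 0" for q u
    unfolding components_def using that p r by (simp add: tdiff_crd_cyl)
  have dX: "((\<lambda>z. components cyl (p, r) ?X (crd_inv cyl (p, r) z)) has_derivative (\<lambda>h. (dxi p (fst h), 0))) (at (crd M p p, r))"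
  proof (subst cchart_has_derivative_iff[OF p r'])
    show "(crd M p p, r) \<in> dom p \<times> {0<..}" using crd_mem_dom[OF p] r by simp
    have "((\<lambda>z. chart p (components M p \<xi>) (fst z)) has_derivative (\<lambda>h. dxi p (fst h))) (at (crd M p p, r))"
      unfolding dxi_def
      by (rule has_derivative_lift[OF p r' smooth_in_differentiable[OF smooth_xi[OF p] crd_mem_dom[OF p]]])
    then have "((\<lambda>z. (chart p (components M p \<xi>) (fst z), 0::real)) has_derivative (\<lambda>h. (dxi p (fst h), 0))) (at (crd M p p, r))"
      by (intro has_derivative_Pair has_derivative_const)
    then show "(cchart p (components cyl (p, r) ?X) has_derivative (\<lambda>h. (dxi p (fst h), 0))) (at (crd M p p, r))"
      by (rule has_derivative_transform_within_open[OF _ open_cdom[OF p r']])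
         (use crd_mem_dom[OF p] r comp crd_inv_mem[OF p] in auto)
  qed
  have "tdiff cyl (\<lambda>x. tdiff cyl F x (?X x)) (p, r) h = tdiff cyl (\<lambda>x. 0::real) (p, r) h" for h
    by (rule C.tdiff_cong[OF pr N(1,2)]) (use N(3) in auto)
  then have z1: "tdiff cyl (\<lambda>x. tdiff cyl F x (?X x)) (p, r) h = 0" for h
    by (simp add: tdiff_def)
  have z2: "tdiff cyl (\<lambda>x. tdiff cyl F x (?X x)) (p, r) h =
      C.tdiff2 F (p, r) h (?X (p, r)) + tdiff cyl F (p, r) (tdiff cyl (components cyl (p, r) ?X) (p, r) h)" for h
    by (rule C.tdiff_tdiff_field[OF pr Fpr]) (use dX in \<open>auto simp: differentiable_def\<close>)
  have z3: "tdiff cyl (components cyl (p, r) ?X) (p, r) h = (dxi p (fst h), 0)" for h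
    using C.tdiff_eqI[where p="(p, r)" and f="components cyl (p, r) ?X"] dX by simp
  show ?thesis
    using z1[of h] z2[of h] z3[of h] by simp
qed

text \<open>By \<open>tdiff2_basic\<close> the terms with \<open>dxi\<close> cancel the Hessian
  terms in direction \<xi>. By \<open>ddJ_snd\<close> the last line is the r-derivative of
  \<open>F\<close> times \<open>ddJ J snd\<close>, exactly the correction subtracted in
  \<Omega>.\<close>

lemma ddJ_cone_basic:
  assumes N: "open N" "(p, r) \<in> N" "\<And>q u. q \<in> nbh M p \<Longrightarrow> u > 0 \<Longrightarrow> (q, u) \<in> N \<Longrightarrow> tdiff cyl F (q, u) (\<xi> q, 0) = 0"
  shows "C.ddJ J F (p, r) (v, a) (w, b) =
    ddJ \<Phi> (\<lambda>q. F (q, r)) p v w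
    + a * C.tdiff2 F (p, r) (\<Phi> p w, 0) (0, 1) - b * C.tdiff2 F (p, r) (\<Phi> p v, 0) (0, 1)
    - r * (\<eta> p w * C.tdiff2 F (p, r) (v, 0) (0, 1) - \<eta> p v * C.tdiff2 F (p, r) (w, 0) (0, 1))
    - r * C.tdiff2 F (p, r) (0, 1) (0, 1) * (a * \<eta> p w - b * \<eta> p v)
    - tdiff cyl F (p, r) (0, 1) * (a * \<eta> p w - b * \<eta> p v + r * ext_deriv M \<eta> p v w)"
proof -
  have f: "smooth_in M p (\<lambda>q. F (q, r))" by (rule smooth_in_slice[OF p r' Fpr])
  note basic = tdiff2_basic[OF N]
  have T1: "C.tdiff2 F (p, r) h (\<Phi> p w + (b / r) *\<^sub>R \<xi> p, c) = C.tdiff2 F (p, r) h (\<Phi> p w, 0)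
      + (b / r) * C.tdiff2 F (p, r) h (\<xi> p, 0) + c * C.tdiff2 F (p, r) h (0, 1)" for h w b c
    using T_Pair[of h "\<Phi> p w + (b / r) *\<^sub>R \<xi> p" c]
      bilinear_radd[OF bilinear_T, of h "(\<Phi> p w, 0)" "(b / r) *\<^sub>R (\<xi> p, 0)"] bilinear_rmul[OF bilinear_T, of h "b / r" "(\<xi> p, 0)"]
    by simp
  have D1: "tdiff cyl F (p, r) (x + (b / r) *\<^sub>R dxi p v - (a / r) *\<^sub>R dxi p w, c) = tdiff cyl F (p, r) (x, 0)
      - (b / r) * C.tdiff2 F (p, r) (v, a) (\<xi> p, 0) + (a / r) * C.tdiff2 F (p, r) (w, b) (\<xi> p, 0) + c * tdiff cyl F (p, r) (0, 1)" for x c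
  proof -
    have "tdiff cyl F (p, r) ((x, 0) + (b / r) *\<^sub>R (dxi p v, 0) - (a / r) *\<^sub>R (dxi p w, 0)) =
      tdiff cyl F (p, r) (x, 0) + (b / r) * tdiff cyl F (p, r) (dxi p v, 0) - (a / r) * tdiff cyl F (p, r) (dxi p w, 0)"
      by (simp only: linear_add[OF linear_D] linear_diff[OF linear_D] linear_scale[OF linear_D] real_scaleR_def)
    then show ?thesis
      using D_Pair[of "x + (b / r) *\<^sub>R dxi p v - (a / r) *\<^sub>R dxi p w" c] basic[of "(v, a)"] basic[of "(w, b)"] by simp
  qed
  have s: "C.tdiff2 F (p, r) (0, 1) (\<Phi> p w, 0) = C.tdiff2 F (p, r) (\<Phi> p w, 0) (0, 1)" for w
    by (rule C.tdiff2_commute[OF pr Fpr])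
  show ?thesis
    unfolding ddJ_cone ddPhi_eq[OF p f] J_simp T1 D1
    using T_Pair'[of v a "(\<Phi> p w, 0)"] T_Pair'[of w b "(\<Phi> p v, 0)"] T_Pair'[of v a "(0, 1)"] T_Pair'[of w b "(0, 1)"]
    by (simp add: tdiff2_slice[OF F p r'] s tdiff_slice[OF p r' Fpr] algebra_simps)
qed

end

end

section \<open>Descent from the cone: invariance of d\<eta> and of d(df o \<Phi>)\<close>

context sasakian_mfd begin

lemma ddJ_zero: "ddJ \<Phi> (\<lambda>q. c) p v w = 0"
  by (simp add: ddJ_def ext_deriv_def tdiff_def)

lemma smooth_fun_snd: "smooth_fun cyl snd"
  unfolding smooth_fun_def
proof
  fix x assume "x \<in> pts cyl"
  then obtain p s where x: "x = (p, s)" "p \<in> pts M" "s \<in> {0<..}" by auto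
  have "smooth_in cyl (p, s) (\<lambda>x. snd x)"
    by (rule smooth_in_snd[OF x(2,3)]) (rule Ck_on_linear, auto simp: linear_iff)
  then show "smooth_in cyl x snd" by (simp add: x)
qed

lemma smooth_fun_lift:
  fixes f :: "'m \<Rightarrow> real"
  assumes "smooth_fun M f"
  shows "smooth_fun cyl (\<lambda>x. f (fst x))"
  using assms smooth_in_lift unfolding smooth_fun_def by auto

text \<open>The radius as test function: J-invariance of this form on the cone yields the invariance
  of d\<eta>, and the correction term of \<Omega> becomes explicit.\<close>

lemma ddJ_snd:
  assumes p: "p \<in> pts M" and r: "r > 0"
  shows "C.ddJ J snd (p, r) (v, a) (w, b) = - (a * \<eta> p w - b * \<eta> p v + r * ext_deriv M \<eta> p v w)"
proof -
  have r': "r \<in> {0<..}" using r by simp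
  have basic: "tdiff cyl snd (q, u) (Y, 0) = 0" if "q \<in> nbh M p" "u > 0" for q u Y
    using tdiff_slice[OF nbh_pts[OF p that(1)], of u snd Y] smooth_in_of_fun[OF smooth_fun_snd nbh_pts[OF p that(1)], of u] that
    by (simp add: tdiff_def[of M])
  have "tdiff cyl snd (p, r) (0, 1) = 1"
    using DERIV_unique[OF tdiff_fibre[OF p r' smooth_in_of_fun[OF smooth_fun_snd p r']], of 1] by simp
  moreover have "C.tdiff2 snd (p, r) (v, 0) (0, 1) = 0" for v
    by (simp add: tdiff2_slice_fibre[OF smooth_fun_snd p r'] tdiff_def)
  moreover have "C.tdiff2 snd (p, r) (0, 1) (0, 1) = 0"
    by (simp add: tdiff2_fibre[OF smooth_fun_snd p r'])
  ultimately show ?thesis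
    using ddJ_cone_basic[OF smooth_fun_snd p r open_UNIV, of v a w b] basic by (simp add: ddJ_zero)
qed

text \<open>Lets identities for the parallel \<open>J\<close> descend to \<open>\<Phi>\<close>: the
  pullback has no r-derivatives, so every mixed term of \<open>ddJ_cone_basic\<close> is
  zero.\<close>

lemma ddJ_lift:
  assumes p: "p \<in> pts M" and r: "r > 0" and f: "f \<in> basic_funs M \<xi>"
  shows "C.ddJ J (\<lambda>x. f (fst x)) (p, r) (v, a) (w, b) = ddJ \<Phi> f p v w"
proof -
  have r': "r \<in> {0<..}" using r by simp
  have sf: "smooth_fun M f" using f by (simp add: basic_funs_def)
  note F = smooth_fun_lift[OF sf]
  have fib: "deriv (\<lambda>u. f (fst (q, u))) t = 0" for q t by simp
  have basic: "tdiff cyl (\<lambda>x. f (fst x)) (q, u) (\<xi> q, 0) = 0" if "q \<in> nbh M p" "u > 0" for q u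
    using tdiff_slice[OF nbh_pts[OF p that(1)] _ smooth_in_of_fun[OF F nbh_pts[OF p that(1)]], of u "\<xi> q"] that
      f nbh_pts[OF p that(1)] by (simp add: basic_funs_def)
  have "tdiff cyl (\<lambda>x. f (fst x)) (p, r) (0, 1) = 0"
    using DERIV_unique[OF tdiff_fibre[OF p r' smooth_in_of_fun[OF F p r']], of 0] by simp
  moreover have "C.tdiff2 (\<lambda>x. f (fst x)) (p, r) (v, 0) (0, 1) = 0" for v
    by (simp add: tdiff2_slice_fibre[OF F p r'] tdiff_def)
  moreover have "C.tdiff2 (\<lambda>x. f (fst x)) (p, r) (0, 1) (0, 1) = 0"
    by (simp add: tdiff2_fibre[OF F p r'])
  ultimately show ?thesis
    using ddJ_cone_basic[OF F p r open_UNIV, of v a w b] basic by simp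
qed

lemma Phi_decomposition: "p \<in> pts M \<Longrightarrow> v = \<Phi> p (- \<Phi> p v) + \<eta> p v *\<^sub>R \<xi> p"
  using Phi_square[of p v] linear_neg[OF linear_Phi, of p "\<Phi> p v"] by simp

text \<open>A two-form whose pullback to the cone (up to \<open>dr \<and> \<eta>\<close>) is \<open>J\<close>-invariant is \<open>\<Phi>\<close>-invariant and
  annihilated by \<open>\<xi> = J(r \<partial>/\<partial>r)\<close>.\<close>

lemma deta_invariant:
  assumes p: "p \<in> pts M"
  shows "ext_deriv M \<eta> p (\<Phi> p v) (\<Phi> p w) = ext_deriv M \<eta> p v w" and "ext_deriv M \<eta> p (\<xi> p) w = 0"
proof -
  have inv: "C.ddJ J snd (p, 1) (J (p, 1) x) (J (p, 1) y) = C.ddJ J snd (p, 1) x y" for x y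
    using p by (intro C.ddJ_invariant[OF kaehler_cone] smooth_in_of_fun[OF smooth_fun_snd]) simp_all
  show "ext_deriv M \<eta> p (\<Phi> p v) (\<Phi> p w) = ext_deriv M \<eta> p v w" for v w
    using inv[of "(v, 0)" "(w, 0)"] by (simp add: ddJ_snd[OF p] eta_Phi[OF p])
  have bl: "bilinear (ext_deriv M \<eta> p)" by (rule bilinear_ext_deriv[OF smooth_eta p])
  have Phi: "ext_deriv M \<eta> p (\<xi> p) (\<Phi> p w) = 0" for w
    using inv[of "(0, 1)" "(w, 0)"] by (simp add: ddJ_snd[OF p] eta_Phi[OF p] eta_xi[OF p] Phi_xi[OF p] linear_0[OF linear_Phi[OF p]] linear_0[OF linear_eta[OF p]] bilinear_lzero[OF bl])
  have "ext_deriv M \<eta> p (\<xi> p) (\<xi> p) = 0" by (simp add: ext_deriv_def)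
  then show "ext_deriv M \<eta> p (\<xi> p) w = 0"
    by (subst Phi_decomposition[OF p, of w]) (simp only: bilinear_radd[OF bl] bilinear_rmul[OF bl] Phi, simp)
qed

lemma smooth_form1_dPhi: "f \<in> basic_funs M \<xi> \<Longrightarrow> smooth_form1 (\<lambda>q v. tdiff M f q (\<Phi> q v))"
  by (rule smooth_form1_differential_endo[OF _ endo_Phi]) (simp add: basic_funs_def)

lemma bilinear_ddPhi: "f \<in> basic_funs M \<xi> \<Longrightarrow> p \<in> pts M \<Longrightarrow> bilinear (ddJ \<Phi> f p)"
  unfolding ddJ_def by (rule bilinear_ext_deriv[OF smooth_form1_dPhi])

text \<open>The device of \<open>deta_invariant\<close> with the pullback of \<open>f\<close> in
  place of r: J-invariance is tested on tangent vectors of M, and on \<partial>/\<partial>r, which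
  \<open>J\<close> sends to \<xi> at radius 1.\<close>

lemma ddPhi_invariant:
  assumes p: "p \<in> pts M" and f: "f \<in> basic_funs M \<xi>"
  shows "ddJ \<Phi> f p (\<Phi> p v) (\<Phi> p w) = ddJ \<Phi> f p v w" and "ddJ \<Phi> f p (\<xi> p) w = 0"
proof -
  have F: "smooth_fun cyl (\<lambda>x. f (fst x))" using f by (intro smooth_fun_lift) (simp add: basic_funs_def)
  have inv: "C.ddJ J (\<lambda>x. f (fst x)) (p, 1) (J (p, 1) x) (J (p, 1) y) = C.ddJ J (\<lambda>x. f (fst x)) (p, 1) x y" for x y
    using p by (intro C.ddJ_invariant[OF kaehler_cone] smooth_in_of_fun[OF F]) simp_all
  show "ddJ \<Phi> f p (\<Phi> p v) (\<Phi> p w) = ddJ \<Phi> f p v w" for v w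
    using inv[of "(v, 0)" "(w, 0)"] by (simp add: ddJ_lift[OF p _ f])
  have bl: "bilinear (ddJ \<Phi> f p)" by (rule bilinear_ddPhi[OF f p])
  have Phi: "ddJ \<Phi> f p (\<xi> p) (\<Phi> p w) = 0" for w
    using inv[of "(0, 1)" "(w, 0)"] by (simp add: ddJ_lift[OF p _ f] linear_0[OF linear_Phi[OF p]] bilinear_lzero[OF bl])
  have "ddJ \<Phi> f p (\<xi> p) (\<xi> p) = 0" by (simp add: ddJ_def ext_deriv_def)
  then show "ddJ \<Phi> f p (\<xi> p) w = 0"
    by (subst Phi_decomposition[OF p, of w]) (simp only: bilinear_radd[OF bl] bilinear_rmul[OF bl] Phi, simp)
qed

section \<open>The deformed contact form and metric\<close>

abbreviation eta' where "eta' \<equiv> eta_pot M \<eta> \<Phi>"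
abbreviation omega where "omega f \<equiv> ext_deriv M (eta' f)"

lemma eta_pot_eq: "eta' f = (\<lambda>p v. \<eta> p v + (- 1 / 2) * tdiff M f p (\<Phi> p v))"
  by (simp add: eta_pot_def dcB_def delbar_def del_def part10_def part01_def fun_eq_iff field_simps)

context
  fixes f p assumes f: "f \<in> basic_funs M \<xi>" and p: "p \<in> pts M"
begin

lemma smooth_eta_pot: "smooth_form1 (eta' f)"
  unfolding eta_pot_eq by (rule smooth_form1_lincomb[OF smooth_eta smooth_form1_dPhi[OF f]])

lemma linear_eta_pot: "linear (eta' f p)"
  using smooth_eta_pot p by (simp add: smooth_form1_def)

lemma omega_eq: "omega f p v w = ext_deriv M \<eta> p v w - ddJ \<Phi> f p v w / 2"
  unfolding eta_pot_eq ext_deriv_lincomb[OF smooth_eta smooth_form1_dPhi[OF f] p] ddJ_def by simp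

lemma bilinear_omega: "bilinear (omega f p)"
  by (rule bilinear_ext_deriv[OF smooth_eta_pot p])

lemma omega_invariant: "omega f p (\<Phi> p v) (\<Phi> p w) = omega f p v w"
  by (simp add: omega_eq deta_invariant[OF p] ddPhi_invariant[OF p f])

lemma omega_xi: "omega f p (\<xi> p) w = 0" "omega f p w (\<xi> p) = 0"
proof -
  show "omega f p (\<xi> p) w = 0" by (simp add: omega_eq deta_invariant[OF p] ddPhi_invariant[OF p f])
  then show "omega f p w (\<xi> p) = 0" using ext_deriv_antisym[of "eta' f" p w "\<xi> p"] by simp
qed

lemma eta_pot_xi: "eta' f p (\<xi> p) = 1"
proof -
  have "linear (tdiff M f p)"
    using f p by (intro tdiff_linear smooth_in_differentiable crd_mem_dom) (auto simp: basic_funs_def smooth_fun_def)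
  then show ?thesis by (simp add: eta_pot_eq eta_xi[OF p] Phi_xi[OF p] linear_0)
qed

lemma metric_pot_eq: "metric_pot M \<xi> \<eta> \<Phi> f p v w = omega f p v (\<Phi> p w) / 2 + eta' f p v * eta' f p w"
proof -
  have "omega f p v (Phi_pot M \<xi> \<Phi> f p w) = omega f p v (\<Phi> p w)"
    unfolding Phi_pot_def by (simp only: bilinear_rsub[OF bilinear_omega] bilinear_rmul[OF bilinear_omega] omega_xi) simp
  then show ?thesis by (simp add: metric_pot_def)
qed

end

section \<open>The form Omega in real terms\<close>

lemma cone_omega_eq:
  assumes p: "p \<in> pts M" and r: "r > 0"
  shows "cone_omega M \<eta> (p, r) (v, a) (w, b) = r * (a * \<eta> p w - b * \<eta> p v) + r\<^sup>2 / 2 * ext_deriv M \<eta> p v w"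
proof -
  have r': "r \<in> {0<..}" using r by simp
  let ?\<alpha> = "\<lambda>(p, r) (Y, s). r\<^sup>2 * \<eta> p Y"
  have "tdiff cyl (\<lambda>x. ?\<alpha> x (coord_field cyl (p, r) (w, b) x)) (p, r) (v, a) =
      2 * r * a * \<eta> p w + r\<^sup>2 * tdiff M (\<lambda>q. \<eta> q (coord_field M p w q)) p v" for v a w b
  proof -
    let ?x = "crd M p p" and ?R = "chart p (\<lambda>q. \<eta> q (coord_field M p w q))"
    have x: "?x \<in> dom p" by (rule crd_mem_dom[OF p])
    have 1: "((\<lambda>z. ?R (fst z)) has_derivative (\<lambda>h. tdiff M (\<lambda>q. \<eta> q (coord_field M p w q)) p (fst h))) (at (?x, r))"
      by (rule has_derivative_lift[OF p r' smooth_form1_differentiable[OF smooth_eta p x]])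
    have 2: "((\<lambda>z::'e \<times> real. (snd z)\<^sup>2) has_derivative (\<lambda>h. 2 * r * snd h)) (at (?x, r))"
      by (auto intro!: derivative_eq_intros simp: power2_eq_square)
    from has_derivative_mult[OF 2 1]
    have "(cchart p (\<lambda>x. ?\<alpha> x (coord_field cyl (p, r) (w, b) x)) has_derivative
       (\<lambda>h. (snd (?x, r))\<^sup>2 * tdiff M (\<lambda>q. \<eta> q (coord_field M p w q)) p (fst h) + 2 * r * snd h * ?R (fst (?x, r)))) (at (?x, r))"
      by (rule has_derivative_transform_within_open[OF _ open_cdom[OF p r']])
         (use x r p crd_inv_mem[OF p] in \<open>auto simp: coord_field_cyl\<close>)
    then show ?thesis
      unfolding tdiff_cyl[OF p r'] by (simp add: frechet_derivativeI crd_inv_crd[OF p mem_nbh[OF p]] coord_field_self[OF p])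
  qed
  then show ?thesis
    unfolding cone_omega_def cone_def ext_deriv_def[of cyl] by (simp add: ext_deriv_def field_simps)
qed

text \<open>The real expression of \<Omega> for an extension \<open>F\<close>: the factor \<i> times
  the \<i>/2 of \<open>del_delbar_eq_ddJ\<close> turns r^2/2 into -r^2/4, and the Hessian of r is
  replaced by \<open>ddJ_snd\<close>.\<close>

definition cone_form where
  "cone_form F p r v a w b = r * (a * \<eta> p w - b * \<eta> p v) + r\<^sup>2 / 2 * ext_deriv M \<eta> p v w - r\<^sup>2 / 4 *
     (C.ddJ J F (p, r) (v, a) (w, b) + tdiff cyl F (p, r) (0, 1) * (a * \<eta> p w - b * \<eta> p v + r * ext_deriv M \<eta> p v w))"

text \<open>Replaces the \<open>SOME\<close> in \<open>Omega\<close> by one fixed \<open>F\<close>,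
  of which later arguments use only smoothness and the values over M x [1, 3/2].\<close>

lemma Omega_eq:
  assumes ex: "\<exists>F. smooth_ext cyl (Mbar M) \<psi> F"
  obtains F where "smooth_fun cyl F" "\<And>p r. p \<in> pts M \<Longrightarrow> r \<in> {1..3/2} \<Longrightarrow> F (p, r) = \<psi> (p, r)"
    "\<And>p r v a w b. p \<in> pts M \<Longrightarrow> r > 0 \<Longrightarrow> Omega M \<xi> \<eta> \<Phi> \<psi> (p, r) (v, a) (w, b) =
      complex_of_real (cone_form F p r v a w b)"
proof -
  define F where "F = (SOME F. smooth_ext cyl (Mbar M) \<psi> F)"
  have "smooth_ext cyl (Mbar M) \<psi> F" using someI_ex[OF ex] by (simp add: F_def)
  then have F: "smooth_fun cyl F" "\<And>p r. p \<in> pts M \<Longrightarrow> r \<in> {1..3/2} \<Longrightarrow> F (p, r) = \<psi> (p, r)"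
    by (auto simp: smooth_ext_def Mbar_def)
  show thesis
  proof (rule that[OF F])
    fix p r v a w b assume p: "p \<in> pts M" and r: "(r::real) > 0"
    have pr: "(p, r) \<in> pts cyl" using p r by simp
    have "Omega M \<xi> \<eta> \<Phi> \<psi> (p, r) (v, a) (w, b) = complex_of_real (cone_omega M \<eta> (p, r) (v, a) (w, b))
      + complex_of_real (r\<^sup>2 / 2) * \<i> * (\<i> / 2 * complex_of_real (C.ddJ J F (p, r) (v, a) (w, b))
          - complex_of_real (tdiff cyl F (p, r) (0, 1)) * (\<i> / 2 * complex_of_real (C.ddJ J snd (p, r) (v, a) (w, b))))"
      unfolding Omega_def cone_def F_def[symmetric] Let_def C.del_delbar_eq_ddJ[OF kaehler_cone pr F(1)]
        C.del_delbar_eq_ddJ[OF kaehler_cone pr smooth_fun_snd] by simp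
    then show "Omega M \<xi> \<eta> \<Phi> \<psi> (p, r) (v, a) (w, b) =
      complex_of_real (cone_form F p r v a w b)"
      unfolding cone_form_def cone_omega_eq[OF p r] ddJ_snd[OF p r] by (simp add: complex_eq_iff algebra_simps)
  qed
qed

end

section \<open>Positivity of potentials\<close>

text \<open>On the line \<open>t *\<^sub>R v + w\<close> the quadratic form is affine in t, so a
  nonzero slope would make it negative; the chosen \<open>t\<close> gives the value -1.\<close>

lemma semidefinite_null:
  fixes B :: "'a::real_vector \<Rightarrow> 'a \<Rightarrow> real"
  assumes bl: "bilinear B" and sym: "\<And>x y. B x y = B y x" and nn: "\<And>x. B x x \<ge> 0" and v: "B v v = 0"
  shows "B v w = 0"
proof (rule ccontr)
  assume n: "B v w \<noteq> 0"
  define t where "t = - (B w w + 1) / (2 * B v w)"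
  have "B (t *\<^sub>R v + w) (t *\<^sub>R v + w) = 2 * t * B v w + B w w"
    using sym[of w v] v
    by (simp add: bilinear_ladd[OF bl] bilinear_radd[OF bl] bilinear_lmul[OF bl] bilinear_rmul[OF bl])
  also have "\<dots> = - 1" using n by (simp add: t_def field_simps)
  finally show False using nn[of "t *\<^sub>R v + w"] by simp
qed

context smooth_mfd begin

lemma tdiff_at_min:
  fixes f :: "'m \<Rightarrow> real"
  assumes p: "p \<in> pts W" and f: "smooth_in W p f" and min: "\<And>q. q \<in> nbh W p \<Longrightarrow> f p \<le> f q"
  shows "tdiff W f p v = 0" and "tdiff2 f p v v \<ge> 0"
proof -
  have "chart p f (crd W p p) \<le> chart p f x" if "x \<in> dom p" for x
    using min[OF crd_inv_mem[OF p that]] by (simp add: crd_inv_crd[OF p mem_nbh[OF p]])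
  note m = frechet_derivative_min_second[OF open_dom[OF p] crd_mem_dom[OF p] smooth_in_Ck[OF f] this]
  show "tdiff W f p v = 0" unfolding tdiff_def by (rule m(1))
  show "tdiff2 f p v v \<ge> 0" unfolding tdiff2_chart[OF p f] by (rule m(2))
qed

end

context sasakian_mfd begin

abbreviation g' where "g' \<equiv> metric_pot M \<xi> \<eta> \<Phi>"

context
  fixes f p assumes f: "f \<in> basic_funs M \<xi>" and p: "p \<in> pts M"
begin

lemmas metric_pot = metric_pot_eq[OF f p]
lemmas omega_bilinear = bilinear_omega[OF f p]

lemma omega_Phi_sym: "omega f p v (\<Phi> p w) = omega f p w (\<Phi> p v)"
proof -
  have "omega f p v (\<Phi> p w) = omega f p (\<Phi> p v) (\<Phi> p (\<Phi> p w))"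
    by (rule omega_invariant[OF f p, symmetric])
  also have "\<dots> = - omega f p (\<Phi> p v) w"
    unfolding Phi_square[OF p]
    by (simp only: bilinear_rsub[OF omega_bilinear] bilinear_rmul[OF omega_bilinear] omega_xi[OF f p]) simp
  also have "\<dots> = omega f p w (\<Phi> p v)" using ext_deriv_antisym[of "eta' f" p w "\<Phi> p v"] by simp
  finally show ?thesis .
qed

lemma metric_pot_sym: "g' f p v w = g' f p w v"
  using omega_Phi_sym[of v w] by (simp add: metric_pot)

lemma bilinear_metric_pot: "bilinear (g' f p)"
proof -
  have l: "linear (\<lambda>w. omega f p v (\<Phi> p w) / 2 + eta' f p v * eta' f p w)" for v
    using linear_eta_pot[OF f p] linear_Phi[OF p] omega_bilinear unfolding bilinear_def
    by (simp add: linear_iff algebra_simps add_divide_distrib)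
  have eq: "g' f p v = (\<lambda>w. omega f p v (\<Phi> p w) / 2 + eta' f p v * eta' f p w)" for v
    by (simp add: metric_pot fun_eq_iff)
  have 1: "linear (g' f p v)" for v unfolding eq by (rule l)
  have "(\<lambda>v. g' f p v w) = g' f p w" for w using metric_pot_sym by blast
  then show ?thesis unfolding bilinear_def using 1 by metis
qed

lemma omega_horizontal:
  "omega f p (v - c *\<^sub>R \<xi> p) (\<Phi> p (v - c *\<^sub>R \<xi> p)) = omega f p v (\<Phi> p v)"
  by (simp add: linear_diff[OF linear_Phi[OF p]] linear_scale[OF linear_Phi[OF p]] Phi_xi[OF p]
      bilinear_lsub[OF omega_bilinear] bilinear_lmul[OF omega_bilinear] omega_xi[OF f p])

lemma eta_horizontal: "\<eta> p (v - \<eta> p v *\<^sub>R \<xi> p) = 0"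
  by (simp add: linear_diff[OF linear_eta[OF p]] linear_scale[OF linear_eta[OF p]] eta_xi[OF p])

text \<open>The kernels of \<open>\<eta>\<close> and of the deformed contact form are both
  complements of \<xi>. Shifting a vector by a multiple of \<xi> moves between them and leaves the
  quadratic form of \<open>omega\<close> unchanged.\<close>

lemma metric_pot_pos_iff:
  "(\<forall>v. v \<noteq> 0 \<longrightarrow> g' f p v v > 0) \<longleftrightarrow> (\<forall>v. v \<noteq> 0 \<longrightarrow> \<eta> p v = 0 \<longrightarrow> omega f p v (\<Phi> p v) > 0)"
proof (intro iffI allI impI)
  fix v :: 'e assume pos: "\<forall>v. v \<noteq> 0 \<longrightarrow> g' f p v v > 0" and v: "v \<noteq> 0" "\<eta> p v = 0"
  let ?x = "v - eta' f p v *\<^sub>R \<xi> p"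
  have "?x \<noteq> 0"
  proof
    assume "?x = 0"
    then have "v = eta' f p v *\<^sub>R \<xi> p" by simp
    then have "\<eta> p v = eta' f p v" by (metis eta_xi[OF p] linear_scale[OF linear_eta[OF p]] mult.right_neutral real_scaleR_def)
    with v \<open>v = eta' f p v *\<^sub>R \<xi> p\<close> show False by simp
  qed
  then have "g' f p ?x ?x > 0" using pos by blast
  moreover have "eta' f p ?x = 0"
    by (simp add: linear_diff[OF linear_eta_pot[OF f p]] linear_scale[OF linear_eta_pot[OF f p]] eta_pot_xi[OF f p])
  ultimately show "omega f p v (\<Phi> p v) > 0" by (simp add: metric_pot omega_horizontal)
next
  fix v :: 'e assume pos: "\<forall>v. v \<noteq> 0 \<longrightarrow> \<eta> p v = 0 \<longrightarrow> omega f p v (\<Phi> p v) > 0" and v: "v \<noteq> 0"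
  let ?y = "v - \<eta> p v *\<^sub>R \<xi> p"
  show "g' f p v v > 0"
  proof (cases "?y = 0")
    case True
    then have eq: "v = \<eta> p v *\<^sub>R \<xi> p" by simp
    then have "eta' f p v = \<eta> p v" by (metis eta_pot_xi[OF f p] linear_scale[OF linear_eta_pot[OF f p]] mult.right_neutral real_scaleR_def)
    moreover have "\<eta> p v \<noteq> 0" using eq v by auto
    moreover have "omega f p v (\<Phi> p v) = 0"
      using omega_horizontal[of v "\<eta> p v"] True by (simp add: bilinear_lzero[OF omega_bilinear])
    ultimately show ?thesis by (auto simp: metric_pot zero_less_mult_iff linorder_neq_iff)
  next
    case False
    then have "omega f p ?y (\<Phi> p ?y) > 0" using pos eta_horizontal by blast
    then show ?thesis by (simp add: metric_pot omega_horizontal add_pos_nonneg)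
  qed
qed

text \<open>Testing against \<xi> puts a vector of the radical into the kernel of the deformed
  contact form, and then into that of \<open>omega\<close>; such a vector annihilates the contact
  volume form.\<close>

lemma metric_pot_nondegenerate:
  assumes dim: "DIM('e) = 2 * n + 1" and pot: "f \<in> potentials n M \<xi> \<eta> \<Phi>" and z: "\<And>w. g' f p z w = 0"
  shows "z = 0"
proof (rule ccontr)
  assume "z \<noteq> 0"
  have e: "eta' f p z = 0"
    using z[of "\<xi> p"] by (simp add: metric_pot Phi_xi[OF p] bilinear_rzero[OF omega_bilinear] eta_pot_xi[OF f p])
  then have o: "omega f p z (\<Phi> p w) = 0" for w using z[of w] by (simp add: metric_pot)
  have o1: "omega f p z w = 0" for w
    by (subst Phi_decomposition[OF p, of w])
       (simp only: bilinear_radd[OF omega_bilinear] bilinear_rmul[OF omega_bilinear] o omega_xi[OF f p], simp)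
  have o2: "omega f p w z = 0" for w using ext_deriv_antisym[of "eta' f" p w z] o1 by simp
  have "wedge 1 (2 * n) (form1 (eta' f p)) (wedge_power n (form2 (omega f p))) v = 0" for v
    by (rule wedge_contact_degenerate[OF omega_bilinear linear_eta_pot[OF f p] o1 o2 e \<open>z \<noteq> 0\<close> dim])
  then show False using pot p by (auto simp: potentials_def)
qed

lemma potential_contact_volume:
  assumes dim: "DIM('e) = 2 * n + 1" and pos: "\<And>v. v \<noteq> 0 \<Longrightarrow> g' f p v v > 0"
  shows "\<exists>v. wedge 1 (2 * n) (form1 (eta' f p)) (wedge_power n (form2 (omega f p))) v \<noteq> 0"
proof (rule wedge_contact_nondegenerate[OF omega_bilinear ext_deriv_antisym linear_eta_pot[OF f p] dim])
  show "eta' f p (\<xi> p) > 0" by (simp add: eta_pot_xi[OF f p])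
  fix x assume x: "eta' f p x = 0" "x \<noteq> 0"
  \<comment> \<open>The partner \<open>\<Phi> p x\<close> corrected along \<xi> into the kernel of
    the deformed contact form; \<open>omega\<close> does not see the correction.\<close>
  let ?y = "\<Phi> p x - eta' f p (\<Phi> p x) *\<^sub>R \<xi> p"
  have "eta' f p ?y = 0"
    by (simp add: linear_diff[OF linear_eta_pot[OF f p]] linear_scale[OF linear_eta_pot[OF f p]] eta_pot_xi[OF f p])
  moreover have "omega f p x ?y = omega f p x (\<Phi> p x)"
    by (simp add: bilinear_rsub[OF omega_bilinear] bilinear_rmul[OF omega_bilinear] omega_xi[OF f p])
  moreover have "omega f p x (\<Phi> p x) > 0" using pos[OF x(2)] x(1) by (simp add: metric_pot)
  ultimately show "\<exists>y. eta' f p y = 0 \<and> omega f p x y \<noteq> 0" by (intro exI[of _ ?y]) simp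
qed

text \<open>At a minimum df = 0 removes the Christoffel terms, so on the cone d(df o \<Phi>)(v,
  \<Phi> v) is minus the sum of the Hessian at v and at \<Phi> v, hence not positive; it enters
  \<open>omega\<close> with factor -1/2, next to the positive d\<eta>(v, \<Phi> v).\<close>

lemma metric_pot_pos_at_min:
  assumes min: "\<And>q. f p \<le> f q" and v: "v \<noteq> 0"
  shows "g' f p v v > 0"
proof -
  have "omega f p v (\<Phi> p v) > 0" if v: "v \<noteq> 0" "\<eta> p v = 0" for v
  proof -
    let ?F = "\<lambda>x. f (fst x)"
    have sf: "smooth_fun M f" using f by (simp add: basic_funs_def)
    have p1: "(p, 1) \<in> pts cyl" using p by simp
    note F = smooth_in_of_fun[OF smooth_fun_lift[OF sf] p, of 1, simplified]
    note m = C.tdiff_at_min[OF p1 F]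
    have J1: "J (p, 1) (v, 0) = (\<Phi> p v, 0)" using v by simp
    have J2: "J (p, 1) (\<Phi> p v, 0) = - (v, 0)" using J_square[OF p, of 1 "(v, 0)"] unfolding J1 by simp
    have "ddJ \<Phi> f p v (\<Phi> p v) = C.ddJ J ?F (p, 1) (v, 0) (\<Phi> p v, 0)"
      by (rule ddJ_lift[OF p _ f, symmetric]) simp
    also have "\<dots> = - C.tdiff2 ?F (p, 1) (v, 0) (v, 0) - C.tdiff2 ?F (p, 1) (\<Phi> p v, 0) (\<Phi> p v, 0)"
      unfolding C.ddJ_hessian[OF kaehler_cone p1 F] J1 J2 bilinear_rneg[OF C.tdiff2_bilinear[OF p1 F]]
      using m(1) min by simp
    also have "\<dots> \<le> 0" using m(2)[of "(v, 0)"] m(2)[of "(\<Phi> p v, 0)"] min by simp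
    finally have "ddJ \<Phi> f p v (\<Phi> p v) \<le> 0" .
    moreover have "ext_deriv M \<eta> p v (\<Phi> p v) > 0"
    proof -
      note mp = metric_pts[OF metric p]
      have "ext_deriv M \<eta> p v (\<Phi> p v) = g p (\<Phi> p v) (\<Phi> p v) + g p v v"
        unfolding ext_deriv_eta[OF p] Phi_square[OF p] using v by (simp add: bilinear_lneg[OF mp(1)])
      moreover have "g p v v > 0" using v mp(3) by blast
      moreover have "g p (\<Phi> p v) (\<Phi> p v) \<ge> 0"
        using mp(3)[of "\<Phi> p v"] bilinear_lzero[OF mp(1)] by (cases "\<Phi> p v = 0") auto
      ultimately show ?thesis by simp
    qed
    ultimately show ?thesis by (simp add: omega_eq[OF f p])
  qed
  then show ?thesis using metric_pot_pos_iff v by blast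
qed

end

section \<open>Openness of positivity and of negativity of the deformed metric\<close>

context
  fixes f p assumes f: "f \<in> basic_funs M \<xi>" and p: "p \<in> pts M"
begin

lemma bilinear_metric_pot_coeff: "q \<in> nbh M p \<Longrightarrow> bilinear (\<lambda>a b. g' f q (coord_field M p a q) (coord_field M p b q))"
  using bilinear_metric_pot[OF f nbh_pts[OF p]] linear_coord_field[OF p, of q]
  unfolding bilinear_def by (auto simp: linear_iff)

lemma continuous_metric_pot_coeff:
  "continuous_on (nbh M p) (\<lambda>q. g' f q (coord_field M p a q) (coord_field M p b q))"
proof -
  let ?c = "components M p (\<lambda>q. \<Phi> q (coord_field M p b q))"
  have c: "continuous_on (nbh M p) ?c" using endo_Phi p by (intro smooth_in_continuous) (simp_all add: smooth_endo_def)
  have e: "continuous_on (nbh M p) (\<lambda>q. eta' f q (coord_field M p a q))" for a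
    using smooth_eta_pot[OF f p] p by (intro smooth_in_continuous) (simp_all add: smooth_form1_def)
  have o: "continuous_on (nbh M p) (\<lambda>q. omega f q (coord_field M p a q) (coord_field M p b q))" for a b
    by (rule continuous_ext_deriv[OF smooth_eta_pot[OF f p] p])
  have "continuous_on (nbh M p) (\<lambda>q. (\<Sum>i\<in>Basis. (?c q \<bullet> i) * omega f q (coord_field M p a q) (coord_field M p i q)) / 2
      + eta' f q (coord_field M p a q) * eta' f q (coord_field M p b q))"
    by (intro continuous_intros c e o) simp
  then show ?thesis
  proof (rule continuous_on_eq)
    fix q assume q: "q \<in> nbh M p"
    have qp: "q \<in> pts M" by (rule nbh_pts[OF p q])
    have lin: "linear (\<lambda>u. omega f q (coord_field M p a q) (coord_field M p u q))"
      using bilinear_omega[OF f qp] linear_coord_field[OF p q] unfolding bilinear_def by (auto simp: linear_iff)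
    have "\<Phi> q (coord_field M p b q) = coord_field M p (?c q) q"
      by (simp add: components_def coord_field_tdiff_crd[OF p q])
    then have "omega f q (coord_field M p a q) (\<Phi> q (coord_field M p b q)) =
        omega f q (coord_field M p a q) (coord_field M p (\<Sum>i\<in>Basis. (?c q \<bullet> i) *\<^sub>R i) q)"
      by (simp add: euclidean_representation)
    also have "\<dots> = (\<Sum>i\<in>Basis. (?c q \<bullet> i) * omega f q (coord_field M p a q) (coord_field M p i q))"
      by (simp add: linear_sum[OF lin] linear_scale[OF lin])
    finally show "(\<Sum>i\<in>Basis. (?c q \<bullet> i) * omega f q (coord_field M p a q) (coord_field M p i q)) / 2
      + eta' f q (coord_field M p a q) * eta' f q (coord_field M p b q) = g' f q (coord_field M p a q) (coord_field M p b q)"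
      by (simp add: metric_pot_eq[OF f qp])
  qed
qed

text \<open>Positivity on the compact unit sphere of the fixed chart persists nearby by the tube
  lemma and extends to all vectors by homogeneity.\<close>

lemma metric_pot_pos_open:
  assumes pos: "\<And>v. v \<noteq> 0 \<Longrightarrow> g' f p v v > 0"
  shows "\<exists>N. open N \<and> p \<in> N \<and> N \<subseteq> nbh M p \<and> (\<forall>q\<in>N. \<forall>v. v \<noteq> 0 \<longrightarrow> g' f q v v > 0)"
proof -
  let ?G = "\<lambda>q a b. g' f q (coord_field M p a q) (coord_field M p b q)"
  have expand: "?G q u u = (\<Sum>i\<in>Basis. \<Sum>j\<in>Basis. (u \<bullet> i) * (u \<bullet> j) * ?G q i j)" if q: "q \<in> nbh M p" for q u
  proof -
    have l: "linear (\<lambda>a. ?G q a b)" "linear (?G q a)" for a b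
      using bilinear_metric_pot_coeff[OF q] by (auto simp: bilinear_def)
    have 1: "?G q u b = (\<Sum>i\<in>Basis. (u \<bullet> i) * ?G q i b)" for b
    proof -
      have "?G q (\<Sum>i\<in>Basis. (u \<bullet> i) *\<^sub>R i) b = (\<Sum>i\<in>Basis. (u \<bullet> i) * ?G q i b)"
        by (simp only: linear_sum[OF l(1)] linear_scale[OF l(1)] real_scaleR_def)
      then show ?thesis by (simp only: euclidean_representation)
    qed
    have 2: "?G q a u = (\<Sum>j\<in>Basis. (u \<bullet> j) * ?G q a j)" for a
    proof -
      have "?G q a (\<Sum>j\<in>Basis. (u \<bullet> j) *\<^sub>R j) = (\<Sum>j\<in>Basis. (u \<bullet> j) * ?G q a j)"
        by (simp only: linear_sum[OF l(2)] linear_scale[OF l(2)] real_scaleR_def)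
      then show ?thesis by (simp only: euclidean_representation)
    qed
    have "?G q u u = (\<Sum>i\<in>Basis. (u \<bullet> i) * (\<Sum>j\<in>Basis. (u \<bullet> j) * ?G q i j))"
      unfolding 1[of u] by (intro sum.cong refl arg_cong2[where f="(*)"] 2)
    then show ?thesis by (simp add: sum_distrib_left mult.assoc)
  qed
  have "continuous_on (nbh M p \<times> UNIV) (\<lambda>z. \<Sum>i\<in>Basis. \<Sum>j\<in>Basis. (snd z \<bullet> i) * (snd z \<bullet> j) * ?G (fst z) i j)"
    by (intro continuous_intros continuous_on_compose2[OF continuous_metric_pot_coeff]) auto
  then have cont: "continuous_on (nbh M p \<times> UNIV) (\<lambda>z. ?G (fst z) (snd z) (snd z))"
    by (rule continuous_on_eq) (auto simp: expand[symmetric])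
  let ?W = "(nbh M p \<times> UNIV) \<inter> (\<lambda>z. ?G (fst z) (snd z) (snd z)) -` {0<..}"
  have W: "open ?W"
    by (rule continuous_open_preimage[OF cont]) (auto intro: open_Times open_nbh[OF p])
  have "{p} \<times> sphere 0 1 \<subseteq> ?W"
  proof
    fix z assume z: "z \<in> {p} \<times> sphere (0::'e) 1"
    then have "snd z \<noteq> 0" by auto
    from pos[OF this] show "z \<in> ?W" using z mem_nbh[OF p] by (auto simp: coord_field_self[OF p])
  qed
  from Elementary_Topology.tube_lemma[OF compact_sphere W this]
  obtain X where X: "p \<in> X" "open X" "X \<times> sphere 0 1 \<subseteq> ?W" by blast
  have "g' f q v v > 0" if q: "q \<in> X \<inter> nbh M p" and v: "v \<noteq> 0" for q v
  proof -
    have qn: "q \<in> nbh M p" using q by simp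
    define u where "u = tdiff M (crd M p) q v"
    have vu: "v = coord_field M p u q" by (simp add: u_def coord_field_tdiff_crd[OF p qn])
    have "u \<noteq> 0" using v vu linear_0[OF linear_coord_field[OF p qn]] by auto
    then have "(q, (1 / norm u) *\<^sub>R u) \<in> X \<times> sphere 0 1" using q by simp
    then have "(q, (1 / norm u) *\<^sub>R u) \<in> ?W" by (rule subsetD[OF X(3)])
    then have pos: "?G q ((1 / norm u) *\<^sub>R u) ((1 / norm u) *\<^sub>R u) > 0" by simp
    have "?G q ((1 / norm u) *\<^sub>R u) ((1 / norm u) *\<^sub>R u) = (1 / norm u)\<^sup>2 * ?G q u u"
      using bilinear_lmul[OF bilinear_metric_pot_coeff[OF qn]] bilinear_rmul[OF bilinear_metric_pot_coeff[OF qn]] by (simp add: power2_eq_square)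
    with pos show ?thesis using vu \<open>u \<noteq> 0\<close> by (simp add: zero_less_mult_iff)
  qed
  then show ?thesis using X open_nbh[OF p] mem_nbh[OF p] by (intro exI[of _ "X \<inter> nbh M p"]) auto
qed

lemma metric_pot_neg_open:
  assumes neg: "g' f p v v < 0"
  shows "\<exists>N. open N \<and> p \<in> N \<and> N \<subseteq> nbh M p \<and> (\<forall>q\<in>N. \<exists>v. v \<noteq> 0 \<and> g' f q v v < 0)"
proof -
  let ?N = "nbh M p \<inter> (\<lambda>q. g' f q (coord_field M p v q) (coord_field M p v q)) -` {..<0}"
  have "open ?N"
    by (rule continuous_open_preimage[OF continuous_metric_pot_coeff open_nbh[OF p]]) simp
  moreover have "p \<in> ?N" using neg mem_nbh[OF p] by (simp add: coord_field_self[OF p])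
  moreover have "\<exists>v. v \<noteq> 0 \<and> g' f q v v < 0" if "q \<in> ?N" for q
  proof (intro exI conjI)
    show "g' f q (coord_field M p v q) (coord_field M p v q) < 0" using that by simp
    then show "coord_field M p v q \<noteq> 0"
      using bilinear_lzero[OF bilinear_metric_pot[OF f nbh_pts[OF p]]] that by force
  qed
  ultimately show ?thesis by blast
qed

end

text \<open>The set of positivity is also closed: a nondegenerate form that is not positive definite
  takes a negative value, since by \<open>semidefinite_null\<close> a null vector of a semidefinite
  form lies in its radical, and negativity is an open condition.\<close>

lemma potential_metric_pos:
  assumes M: "pts M = UNIV" "compact (UNIV :: 'm set)" "connected (UNIV :: 'm set)"
    and dim: "DIM('e) = 2 * n + 1" and pot: "f \<in> potentials n M \<xi> \<eta> \<Phi>" and v: "v \<noteq> 0"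
  shows "g' f p v v > 0"
proof -
  have f: "f \<in> basic_funs M \<xi>" using pot by (simp add: potentials_def)
  have p: "p \<in> pts M" for p by (simp add: M)
  let ?P = "{p. \<forall>v. v \<noteq> 0 \<longrightarrow> g' f p v v > 0}"
  have "continuous_on UNIV f"
    unfolding continuous_on_eq_continuous_within
  proof
    fix q :: 'm
    have sf: "smooth_in M q f" using f p by (simp add: basic_funs_def smooth_fun_def)
    show "continuous (at q) f" using smooth_in_continuous[OF p sf] open_nbh[OF p] mem_nbh[OF p] continuous_on_eq_continuous_at by blast
  qed
  then obtain p0 where "\<And>q. f p0 \<le> f q"
    using continuous_attains_inf[OF M(2), of f] by auto
  then have p0: "p0 \<in> ?P" using metric_pot_pos_at_min[OF f p] by blast
  have "open ?P"
  proof (subst open_subopen, intro ballI)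
    fix q assume "q \<in> ?P"
    then have "g' f q v v > 0" if "v \<noteq> 0" for v using that by blast
    from metric_pot_pos_open[OF f p this] obtain N where
      "open N" "q \<in> N" "\<forall>q\<in>N. \<forall>v. v \<noteq> 0 \<longrightarrow> g' f q v v > 0" by blast
    then show "\<exists>T. open T \<and> q \<in> T \<and> T \<subseteq> ?P" by (intro exI[of _ N]) auto
  qed
  moreover have "open (- ?P)"
  proof (subst open_subopen, intro ballI)
    fix q assume "q \<in> - ?P"
    then obtain v where v: "v \<noteq> 0" "\<not> g' f q v v > 0" by blast
    have "\<exists>u. g' f q u u < 0"
    proof (rule ccontr)
      assume "\<not> ?thesis"
      then have nn: "g' f q u u \<ge> 0" for u by (simp add: not_less)
      from this[of v] have "g' f q v v = 0" using v(2) by simp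
      then have "g' f q v w = 0" for w
        by (rule semidefinite_null[OF bilinear_metric_pot[OF f p[of q]] metric_pot_sym[OF f p[of q]] nn])
      then show False using metric_pot_nondegenerate[OF f p[of q] dim pot] v by blast
    qed
    then obtain u where "g' f q u u < 0" by blast
    from metric_pot_neg_open[OF f p this] obtain N where
      N: "open N" "q \<in> N" "\<And>x. x \<in> N \<Longrightarrow> \<exists>v. v \<noteq> 0 \<and> g' f x v v < 0" by blast
    have "N \<subseteq> - ?P"
    proof
      fix x assume "x \<in> N"
      from N(3)[OF this] obtain v where "v \<noteq> 0" "g' f x v v < 0" by blast
      then have "\<not> (v \<noteq> 0 \<longrightarrow> g' f x v v > 0)" by simp
      then show "x \<in> - ?P" by blast
    qed
    with N show "\<exists>T. open T \<and> q \<in> T \<and> T \<subseteq> - ?P" by blast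
  qed
  ultimately have "- ?P = {}"
    using connectedD[OF M(3), of ?P "- ?P"] p0 by auto
  then show ?thesis using v by blast
qed

end

section \<open>The degenerate form on the cone\<close>

context sasakian_mfd begin

abbreviation velocity where "velocity \<phi> t p \<equiv> tdiff M (\<lambda>q. deriv (\<lambda>u. \<phi> u q) t) p"
abbreviation acceleration where "acceleration \<phi> t p \<equiv> deriv (\<lambda>s. deriv (\<lambda>u. \<phi> u p) s) t"

definition geodesic_form where
  "geodesic_form f p r c \<alpha> v a w b = omega f p v w + 2 * r * c * (a * \<eta> p w - b * \<eta> p v)
     + r * (\<alpha> v * \<eta> p w - \<alpha> w * \<eta> p v) - (a * \<alpha> (\<Phi> p w) - b * \<alpha> (\<Phi> p v))"

context
  fixes f p assumes f: "f \<in> basic_funs M \<xi>" and p: "p \<in> pts M"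
    and pos: "\<And>v. v \<noteq> 0 \<Longrightarrow> g' f p v v > 0"
begin

lemma covector_norm_dual:
  assumes "linear \<alpha>"
  obtains V where "\<And>w. g' f p V w = \<alpha> w" "(covector_norm (g' f p) \<alpha>)\<^sup>2 = \<alpha> V"
proof -
  note ex1 = riesz_bilinear[OF bilinear_metric_pot[OF f p] pos assms]
  define V where "V = (THE z. \<forall>u. g' f p z u = \<alpha> u)"
  have V: "g' f p V w = \<alpha> w" for w using theI'[OF ex1] by (simp add: V_def)
  have "g' f p V V \<ge> 0"
    using pos[of V] bilinear_lzero[OF bilinear_metric_pot[OF f p]] by (cases "V = 0") auto
  then have "(covector_norm (g' f p) \<alpha>)\<^sup>2 = \<alpha> V"
    by (simp add: covector_norm_def Let_def V_def[symmetric] V)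
  with V show thesis using that by blast
qed

text \<open>If \<open>V\<close> is the vector dual to \<open>\<alpha>\<close>, the kernel is contained in the span of \<open>V - 2 \<partial>/\<partial>r\<close> and
  \<open>r \<Phi>V - 2\<xi>\<close> up to multiples of \<open>\<xi>\<close> in \<open>V\<close> and \<open>\<Phi>V\<close>; testing against \<open>\<xi>\<close> and \<open>\<partial>/\<partial>r\<close> leaves the geodesic equation.\<close>

lemma geodesic_form_degenerate_iff:
  fixes \<alpha> :: "'e \<Rightarrow> real" and r c :: real
  assumes \<alpha>: "linear \<alpha>" "\<alpha> (\<xi> p) = 0" and r: "r > 0"
  shows "(\<exists>v a. (v \<noteq> 0 \<or> a \<noteq> 0) \<and> (\<forall>w b. geodesic_form f p r c \<alpha> v a w b = 0))
    \<longleftrightarrow> c - 1 / 4 * (covector_norm (g' f p) \<alpha>)\<^sup>2 = 0" (is "?L \<longleftrightarrow> ?R")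
proof -
  obtain V where V: "\<And>w. g' f p V w = \<alpha> w" and norm: "(covector_norm (g' f p) \<alpha>)\<^sup>2 = \<alpha> V"
    using covector_norm_dual[OF \<alpha>(1)] by blast
  note bl = bilinear_omega[OF f p]
  note [simp] = bilinear_ladd[OF bl] bilinear_radd[OF bl] bilinear_lsub[OF bl] bilinear_rsub[OF bl]
    bilinear_lmul[OF bl] bilinear_rmul[OF bl] bilinear_lneg[OF bl] bilinear_rneg[OF bl] bilinear_lzero[OF bl]
    omega_xi[OF f p] linear_add[OF \<alpha>(1)] linear_diff[OF \<alpha>(1)] linear_scale[OF \<alpha>(1)] linear_neg[OF \<alpha>(1)]
    linear_0[OF \<alpha>(1)] \<alpha>(2)
    linear_add[OF linear_eta[OF p]] linear_diff[OF linear_eta[OF p]] linear_scale[OF linear_eta[OF p]]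
    linear_0[OF linear_eta[OF p]] linear_neg[OF linear_eta[OF p]]
    linear_add[OF linear_Phi[OF p]] linear_diff[OF linear_Phi[OF p]] linear_scale[OF linear_Phi[OF p]]
    linear_0[OF linear_Phi[OF p]] linear_neg[OF linear_Phi[OF p]]
    Phi_xi[OF p] eta_xi[OF p] eta_Phi[OF p] Phi_square[OF p]
  have "eta' f p V = 0"
    using V[of "\<xi> p"] by (simp add: metric_pot_eq[OF f p] eta_pot_xi[OF f p] bilinear_rzero[OF bl])
  then have VPhi: "omega f p V (\<Phi> p w) = 2 * \<alpha> w" for w
    using V[of w] by (simp add: metric_pot_eq[OF f p])
  have oV: "omega f p V w = - 2 * \<alpha> (\<Phi> p w)" for w
    using VPhi[of "\<Phi> p w"] by simp
  have oPhiV: "omega f p (\<Phi> p V) w = - 2 * \<alpha> w" for w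
    using omega_invariant[OF f p, of "\<Phi> p V" w] VPhi[of w] by simp
  have "omega f p V V = 0" by (simp add: ext_deriv_def)
  then have PhiV: "\<alpha> (\<Phi> p V) = 0" using oV[of V] by simp
  show ?thesis
  proof
    assume ?R
    then have c: "4 * c = \<alpha> V" by (simp add: norm)
    \<comment> \<open>With \<open>a = 1\<close> and \<open>\<eta> p v = 0\<close> the kernel
      condition reads omega(v, w) = \<alpha>(\<Phi> w), which is -1/2 times omega(V, w). So v is
      -V/2 up to a multiple of \<xi>, fixed by \<open>\<eta> p v = 0\<close>.\<close>
    let ?v = "- (1 / 2) *\<^sub>R (V - \<eta> p V *\<^sub>R \<xi> p)"
    have "geodesic_form f p r c \<alpha> ?v 1 w b = 0" for w b
      using c oV[of w] PhiV by (simp add: geodesic_form_def algebra_simps)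
    then show ?L by (intro exI[of _ ?v] exI[of _ 1]) simp
  next
    assume ?L
    then obtain v a where va: "v \<noteq> 0 \<or> a \<noteq> 0" and ker: "\<And>w b. geodesic_form f p r c \<alpha> v a w b = 0" by blast
    note ker = ker[unfolded geodesic_form_def]
    have k1: "\<alpha> (\<Phi> p v) = 2 * r * c * \<eta> p v" using ker[of 0 1] by (simp add: bilinear_rzero[OF bl])
    have "r * (2 * c * a + \<alpha> v) = 0" using ker[of "\<xi> p" 0] by (simp add: algebra_simps)
    then have k2: "\<alpha> v = - 2 * c * a" using r by simp
    have k3: "omega f p v w = r * \<eta> p v * \<alpha> w + a * \<alpha> (\<Phi> p w)" for w
      using ker[of w 0] k2 by (simp add: algebra_simps)
    \<comment> \<open>The difference between \<open>v\<close> and the form that \<open>k3\<close>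
      forces on it. It annihilates \<open>omega\<close>, hence by positivity is a multiple of \<xi>,
      on which \<alpha> and \<alpha> o \<Phi> vanish.\<close>
    define z where "z = v + (a / 2) *\<^sub>R V + (r * \<eta> p v / 2) *\<^sub>R \<Phi> p V"
    have "omega f p z w = 0" for w
      using k3[of w] oV[of w] oPhiV[of w] by (simp add: z_def)
    then have oz: "omega f p z (\<Phi> p z) = 0" by blast
    have z: "z - \<eta> p z *\<^sub>R \<xi> p = 0"
    proof (rule ccontr)
      assume "z - \<eta> p z *\<^sub>R \<xi> p \<noteq> 0"
      moreover have "\<eta> p (z - \<eta> p z *\<^sub>R \<xi> p) = 0" by simp
      ultimately have "omega f p (z - \<eta> p z *\<^sub>R \<xi> p) (\<Phi> p (z - \<eta> p z *\<^sub>R \<xi> p)) > 0"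
        using metric_pot_pos_iff[OF f p] pos by blast
      then show False using oz omega_horizontal[OF f p] by simp
    qed
    have "\<alpha> z = 0" "\<alpha> (\<Phi> p z) = 0"
      using arg_cong[OF z, of \<alpha>] arg_cong[OF z, of "\<lambda>x. \<alpha> (\<Phi> p x)"] by simp_all
    then have 1: "\<alpha> v = - (a / 2) * \<alpha> V" and 2: "\<alpha> (\<Phi> p v) = (r * \<eta> p v / 2) * \<alpha> V"
      using PhiV by (simp_all add: z_def algebra_simps)
    show ?R
    proof (rule ccontr)
      \<comment> \<open>Comparing the two values of \<alpha>(v), and those of \<alpha>(\<Phi> v),
        shows that \<open>4 * c \<noteq> \<alpha> V\<close> would force \<open>a = 0\<close> and
        \<open>\<eta> p v = 0\<close>; then \<open>v = z\<close> is a multiple of \<xi> with zero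
        \<eta>, so the kernel vector would be 0.\<close>
      assume "\<not> ?R"
      then have n: "4 * c \<noteq> \<alpha> V" by (auto simp: norm)
      have "a * (4 * c - \<alpha> V) = 0" using 1 k2 by (simp add: algebra_simps)
      then have a: "a = 0" using n by simp
      have "r * \<eta> p v * (4 * c - \<alpha> V) = 0" using 2 k1 by (simp add: algebra_simps)
      then have e: "\<eta> p v = 0" using n r by simp
      have "z = v" using a e by (simp add: z_def)
      then show False using z e va a by simp
    qed
  qed
qed

end

subsection \<open>Paths of basic functions\<close>

context
  fixes \<phi> :: "real \<Rightarrow> 'm \<Rightarrow> real" and \<psi> :: "'m \<times> real \<Rightarrow> real"
  assumes UNIV: "pts M = UNIV" and path: "smooth_basic_path M \<xi> \<phi>"
    and \<psi>: "\<And>p r. r \<in> {1..3/2} \<Longrightarrow> \<psi> (p, r) = \<phi> (2 * (r - 1)) p + 4 * ln r"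
begin

lemma path_basic: "t \<in> {0..1} \<Longrightarrow> \<phi> t \<in> basic_funs M \<xi>"
  using path by (simp add: smooth_basic_path_def)

lemma all_pts [simp]: "p \<in> pts M"
  by (simp add: UNIV)

text \<open>The given extension of the path is composed with t = 2r - 2, and 4 log r is smooth for
  all r > 0. This witness makes the \<open>SOME\<close> in \<open>Omega\<close> an actual extension
  of \<psi>.\<close>

lemma extension_exists: "\<exists>F. smooth_ext cyl (Mbar M) \<psi> F"
proof -
  obtain H where H: "smooth_fun (cylinder M UNIV) H" "\<And>q t. t \<in> {0..1} \<Longrightarrow> H (q, t) = \<phi> t q"
    using path by (auto simp: smooth_basic_path_def smooth_ext_def UNIV)
  let ?F = "\<lambda>x. (case x of (q, u) \<Rightarrow> H (q, 2 * u + (- 2))) + 4 * ln (snd x)"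
  have "smooth_fun cyl ?F"
    unfolding smooth_fun_def
  proof
    fix x assume "x \<in> pts cyl"
    then obtain p s where x: "x = (p, s)" "s \<in> {0<..}" by auto
    have "smooth_in (cylinder M UNIV) (p, 0) H" using H(1) by (simp add: smooth_fun_def cylinder_def)
    then have 1: "smooth_in cyl (p, s) (\<lambda>(q, u). H (q, 2 * u + (- 2)))"
      by (intro smooth_in_reparametrize[OF all_pts x(2) open_UNIV UNIV_I]) simp_all
    have 2: "smooth_in cyl (p, s) (\<lambda>x. 4 * ln (snd x))"
      by (rule smooth_in_snd[OF all_pts x(2)]) (rule Ck_on_bounded_linear[OF bounded_linear_mult_right open_I Ck_on_ln])
    show "smooth_in cyl x ?F" unfolding x(1) by (rule smooth_in_cyl_add[OF all_pts x(2) 1 2])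
  qed
  moreover have "?F x = \<psi> x" if "x \<in> Mbar M" for x
    using that H(2) \<psi> by (auto simp: Mbar_def algebra_simps)
  ultimately show ?thesis unfolding smooth_ext_def by blast
qed

context
  fixes F :: "'m \<times> real \<Rightarrow> real"
  assumes F: "smooth_fun cyl F" and F\<psi>: "\<And>q u. u \<in> {1..3/2} \<Longrightarrow> F (q, u) = \<phi> (2 * (u - 1)) q + 4 * ln u"
begin

lemma F_in: "u > 0 \<Longrightarrow> smooth_in cyl (q, u) F"
  by (rule smooth_in_of_fun[OF F all_pts]) simp

lemma tdiff_F_slice:
  assumes "u \<in> {1..3/2}"
  shows "tdiff M (\<lambda>q. F (q, u)) q v = tdiff M (\<phi> (2 * (u - 1))) q v"
proof -
  let ?h = "chart q (\<phi> (2 * (u - 1)))"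
  have "2 * (u - 1) \<in> {0..1}" using assms by auto
  then have "smooth_in M q (\<phi> (2 * (u - 1)))" using path_basic by (simp add: basic_funs_def smooth_fun_def UNIV)
  then have "?h differentiable (at (crd M q q))" by (rule smooth_in_differentiable[OF _ crd_mem_dom[OF all_pts]])
  then have "((\<lambda>x. ?h x + 4 * ln u) has_derivative frechet_derivative ?h (at (crd M q q))) (at (crd M q q))"
    by (auto intro!: derivative_eq_intros simp: frechet_derivative_works)
  then show ?thesis
    unfolding tdiff_def using assms by (simp add: F\<psi> frechet_derivativeI)
qed

lemma ddJ_F_slice:
  assumes "u \<in> {1..3/2}"
  shows "ddJ \<Phi> (\<lambda>q. F (q, u)) p v w = ddJ \<Phi> (\<phi> (2 * (u - 1))) p v w"
  unfolding ddJ_def by (simp add: tdiff_F_slice[OF assms])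

lemma F_basic: "u \<in> {1..3/2} \<Longrightarrow> tdiff cyl F (q, u) (\<xi> q, 0) = 0"
  using tdiff_slice[OF all_pts _ F_in] tdiff_F_slice path_basic[of "2 * (u - 1)"] by (simp add: basic_funs_def)

lemma F_fibre:
  assumes "u > 0"
  shows "((\<lambda>u. F (q, u)) has_real_derivative deriv (\<lambda>u. F (q, u)) u) (at u)"
proof -
  have D: "((\<lambda>u. F (q, u)) has_real_derivative tdiff cyl F (q, u) (0, 1)) (at u)"
    using assms by (intro tdiff_fibre all_pts F_in) simp
  show ?thesis unfolding DERIV_imp_deriv[OF D] by (rule D)
qed

lemma deriv_path:
  assumes "s \<in> {0<..<1}"
  shows "deriv (\<lambda>u. \<phi> u q) s = deriv (\<lambda>u. F (q, u)) (1 + s / 2) / 2 - 2 * inverse (1 + s / 2)"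
proof (rule DERIV_imp_deriv)
  have pos: "1 + s / 2 > 0" using assms by auto
  have 1: "((\<lambda>s. 1 + s / 2) has_real_derivative 1 / 2) (at s)"
    by (auto intro!: derivative_eq_intros)
  have "((\<lambda>s. F (q, 1 + s / 2) - 4 * ln (1 + s / 2)) has_real_derivative
      deriv (\<lambda>u. F (q, u)) (1 + s / 2) * (1 / 2) - 4 * (inverse (1 + s / 2) * (1 / 2))) (at s)"
    by (rule DERIV_diff[OF DERIV_chain'[OF 1 F_fibre[OF pos]] DERIV_cmult[OF DERIV_chain'[OF 1 DERIV_ln[OF pos]]]])
  then have "((\<lambda>s. \<phi> s q) has_real_derivative
      deriv (\<lambda>u. F (q, u)) (1 + s / 2) * (1 / 2) - 4 * (inverse (1 + s / 2) * (1 / 2))) (at s)"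
    by (rule has_field_derivative_transform_within_open[of _ _ _ "{0<..<1}"]) (use assms F\<psi> in auto)
  then show "((\<lambda>s. \<phi> s q) has_real_derivative
      deriv (\<lambda>u. F (q, u)) (1 + s / 2) / 2 - 2 * inverse (1 + s / 2)) (at s)"
    by simp
qed

context
  fixes r :: real and p :: 'm assumes r: "r \<in> {1<..<3/2}"
begin

abbreviation (input) "\<tau> \<equiv> 2 * (r - 1)"

lemma r_pos: "r > 0" and r_mem: "r \<in> {0<..}" and t_mem: "\<tau> \<in> {0<..<1}" and rt: "1 + \<tau> / 2 = r"
  using r by (auto simp: field_simps)

text \<open>As r = 1 + t/2, one t-derivative is half an r-derivative, whence the factor 4;
  \<open>- 4 / r\<^sup>2\<close> is the second derivative of 4 log r.\<close>

lemma second_fibre_derivative: "C.tdiff2 F (p, r) (0, 1) (0, 1) = 4 * acceleration \<phi> \<tau> p - 4 / r\<^sup>2"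
proof -
  let ?T = "C.tdiff2 F (p, r) (0, 1) (0, 1)"
  have 0: "((\<lambda>u. deriv (\<lambda>u. F (p, u)) u) has_real_derivative ?T) (at (1 + \<tau> / 2))"
    using DERIV_deriv_fibre[OF F all_pts r_mem] by (simp only: rt)
  have 1: "((\<lambda>s. 1 + s / 2) has_real_derivative 1 / 2) (at \<tau>)"
    by (auto intro!: derivative_eq_intros)
  have "1 + \<tau> / 2 \<noteq> 0" using r_pos rt by simp
  from DERIV_diff[OF DERIV_cdivide[OF DERIV_chain'[OF 1 0]] DERIV_cmult[OF DERIV_inverse'[OF 1 this]], of 2 2]
  have "((\<lambda>s. deriv (\<lambda>u. F (p, u)) (1 + s / 2) / 2 - 2 * inverse (1 + s / 2)) has_real_derivative
      ?T * (1 / 2) / 2 - 2 * (- (inverse (1 + \<tau> / 2) * (1 / 2) * inverse (1 + \<tau> / 2)))) (at \<tau>)" .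
  then have "((\<lambda>s. deriv (\<lambda>u. \<phi> u p) s) has_real_derivative
      ?T * (1 / 2) / 2 - 2 * (- (inverse (1 + \<tau> / 2) * (1 / 2) * inverse (1 + \<tau> / 2)))) (at \<tau>)"
    by (rule has_field_derivative_transform_within_open[of _ _ _ "{0<..<1}"])
       (use t_mem deriv_path in auto)
  from DERIV_imp_deriv[OF this] show ?thesis
    unfolding rt using r_pos by (simp add: field_simps power2_eq_square)
qed

lemma velocity_differential:
  "linear (velocity \<phi> \<tau> p)" "C.tdiff2 F (p, r) (v, 0) (0, 1) = 2 * velocity \<phi> \<tau> p v"
proof -
  let ?h = "chart p (\<lambda>q. deriv (\<lambda>u. F (q, u)) r)"
  let ?D = "frechet_derivative ?h (at (crd M p p))"
  have "?h differentiable (at (crd M p p))"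
    by (rule smooth_in_differentiable[OF smooth_in_deriv_fibre[OF F all_pts r_mem] crd_mem_dom[OF all_pts]])
  then have D: "(?h has_derivative ?D) (at (crd M p p))" by (simp add: frechet_derivative_works)
  then have D2: "(chart p (\<lambda>q. deriv (\<lambda>u. F (q, u)) r / 2 - 2 * inverse r) has_derivative (\<lambda>v. ?D v / 2)) (at (crd M p p))"
    by (auto intro!: derivative_eq_intros)
  have eq: "(\<lambda>q. deriv (\<lambda>u. \<phi> u q) \<tau>) = (\<lambda>q. deriv (\<lambda>u. F (q, u)) r / 2 - 2 * inverse r)"
    using deriv_path[OF t_mem] unfolding rt by (rule ext)
  have \<alpha>: "velocity \<phi> \<tau> p = (\<lambda>v. ?D v / 2)"
    unfolding eq by (rule ext tdiff_eqI[OF D2])+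
  show "linear (velocity \<phi> \<tau> p)" unfolding \<alpha> using has_derivative_linear[OF D] by (simp add: linear_iff add_divide_distrib)
  show "C.tdiff2 F (p, r) (v, 0) (0, 1) = 2 * velocity \<phi> \<tau> p v"
    unfolding \<alpha> tdiff2_slice_fibre[OF F all_pts r_mem] by (simp add: tdiff_def)
qed

lemma basic_neighbourhood:
  "open (UNIV \<times> {1<..<3/2 :: real})" "(p, r) \<in> UNIV \<times> {1<..<3/2}"
  "\<And>q u. q \<in> nbh M p \<Longrightarrow> u > 0 \<Longrightarrow> (q, u) \<in> UNIV \<times> {1<..<3/2} \<Longrightarrow> tdiff cyl F (q, u) (\<xi> q, 0) = 0"
  using r F_basic by (auto intro: open_Times)

text \<open>dF(\<xi>) = 0 is differentiated along r. As \<xi> does not depend on r, the mixed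
  derivative of \<open>F\<close> in r and \<xi> vanishes, and it is twice the value in
  question.\<close>

lemma velocity_basic: "velocity \<phi> \<tau> p (\<xi> p) = 0"
proof -
  have "dxi p 0 = 0"
    unfolding dxi_def
    by (rule linear_0[OF tdiff_linear[OF all_pts smooth_in_differentiable[OF smooth_xi[OF all_pts] crd_mem_dom[OF all_pts]]]])
  then have "C.tdiff2 F (p, r) (0, 1) (\<xi> p, 0) = 0"
    using tdiff2_basic[OF F all_pts r_pos basic_neighbourhood, of "(0, 1)"] linear_0[OF linear_D[OF F all_pts r_pos]]
    by (simp add: zero_prod_def)
  moreover have "(p, r) \<in> pts cyl" using r_pos by simp
  ultimately show ?thesis
    using velocity_differential(2)[of "\<xi> p"] C.tdiff2_commute[OF _ F_in[OF r_pos]] by simp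
qed

lemma cone_form_interior:
  "cone_form F p r v a w b = r\<^sup>2 / 2 * geodesic_form (\<phi> \<tau>) p r (acceleration \<phi> \<tau> p) (velocity \<phi> \<tau> p) v a w b"
proof -
  have r1: "r \<in> {1..3/2}" using r by simp
  have t1: "\<tau> \<in> {0..1}" using t_mem by auto
  have "C.ddJ J F (p, r) (v, a) (w, b) =
    ddJ \<Phi> (\<lambda>q. F (q, r)) p v w
    + a * C.tdiff2 F (p, r) (\<Phi> p w, 0) (0, 1) - b * C.tdiff2 F (p, r) (\<Phi> p v, 0) (0, 1)
    - r * (\<eta> p w * C.tdiff2 F (p, r) (v, 0) (0, 1) - \<eta> p v * C.tdiff2 F (p, r) (w, 0) (0, 1))
    - r * C.tdiff2 F (p, r) (0, 1) (0, 1) * (a * \<eta> p w - b * \<eta> p v)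
    - tdiff cyl F (p, r) (0, 1) * (a * \<eta> p w - b * \<eta> p v + r * ext_deriv M \<eta> p v w)"
    by (rule ddJ_cone_basic[OF F all_pts r_pos basic_neighbourhood(1,2)]) (rule basic_neighbourhood(3))
  note B = this[unfolded ddJ_F_slice[OF r1] velocity_differential(2) second_fibre_derivative]
  \<comment> \<open>\<open>D\<close>, the r-derivative of \<open>F\<close>, cancels. In
    \<open>4 * c - 4 / r\<^sup>2\<close> the second part, due to 4 log r, contributes
    \<open>- r * E\<close> and cancels the term \<open>r * E\<close> of the Kaehler form of the
    cone.\<close>
  have id: "r * E + r\<^sup>2 / 2 * d - r\<^sup>2 / 4 * ((dd + a * (2 * x) - b * (2 * y) - r * (h * (2 * z) - k * (2 * u))
        - r * (4 * c - 4 / r\<^sup>2) * E - D * (E + r * d)) + D * (E + r * d))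
      = r\<^sup>2 / 2 * (d - dd / 2 + 2 * r * c * E + r * (z * h - u * k) - (a * x - b * y))"
    for E d dd x y h z k u c D :: real
    using r_pos by (simp add: field_simps power2_eq_square)
  show ?thesis
    unfolding cone_form_def geodesic_form_def B omega_eq[OF path_basic[OF t1] all_pts] by (rule id)
qed

end

lemma cone_form_contact:
  assumes r: "r \<in> {1..3/2}" and "\<eta> p v = 0" "\<eta> p w = 0"
  shows "cone_form F p r v 0 w 0 = r\<^sup>2 / 2 * omega (\<phi> (2 * (r - 1))) p v w"
proof -
  have "2 * (r - 1) \<in> {0..1}" "r > 0" using r by auto
  then show ?thesis
    by (simp add: cone_form_def ddJ_cone_contact[OF F all_pts _ assms(2,3)] ddJ_F_slice[OF r] omega_eq[OF path_basic all_pts] algebra_simps)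
qed

end

lemma Omega_contact:
  assumes r: "r \<in> {1..3/2}" and v: "\<eta> p v = 0" "\<eta> p w = 0"
  shows "Omega M \<xi> \<eta> \<Phi> \<psi> (p, r) (v, 0) (w, 0) = complex_of_real (r\<^sup>2 / 2 * omega (\<phi> (2 * (r - 1))) p v w)"
proof -
  obtain F where F: "smooth_fun cyl F" and Fp: "\<And>p r. p \<in> pts M \<Longrightarrow> r \<in> {1..3/2} \<Longrightarrow> F (p, r) = \<psi> (p, r)"
    and O: "\<And>p r v a w b. p \<in> pts M \<Longrightarrow> r > 0 \<Longrightarrow> Omega M \<xi> \<eta> \<Phi> \<psi> (p, r) (v, a) (w, b) =
      complex_of_real (cone_form F p r v a w b)"
    using Omega_eq[OF extension_exists] by blast
  have Fp': "F (q, u) = \<phi> (2 * (u - 1)) q + 4 * ln u" if "u \<in> {1..3/2}" for q u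
    using Fp \<psi> that by (simp add: UNIV)
  have "r > 0" using r by simp
  show ?thesis
    unfolding O[OF all_pts \<open>r > 0\<close>]
    by (rule arg_cong[where f=complex_of_real], rule cone_form_contact[OF F Fp' r v])
qed

lemma Omega_interior:
  assumes r: "r \<in> {1<..<3/2}"
  defines "t \<equiv> 2 * (r - 1)"
  shows "Omega M \<xi> \<eta> \<Phi> \<psi> (p, r) (v, a) (w, b) = complex_of_real
      (r\<^sup>2 / 2 * geodesic_form (\<phi> t) p r (acceleration \<phi> t p) (velocity \<phi> t p) v a w b)" (is ?O)
    and "linear (velocity \<phi> t p)" (is ?L)
    and "velocity \<phi> t p (\<xi> p) = 0" (is ?B)
proof -
  obtain F where F: "smooth_fun cyl F" and Fp: "\<And>p r. p \<in> pts M \<Longrightarrow> r \<in> {1..3/2} \<Longrightarrow> F (p, r) = \<psi> (p, r)"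
    and O: "\<And>p r v a w b. p \<in> pts M \<Longrightarrow> r > 0 \<Longrightarrow> Omega M \<xi> \<eta> \<Phi> \<psi> (p, r) (v, a) (w, b) =
      complex_of_real (cone_form F p r v a w b)"
    using Omega_eq[OF extension_exists] by blast
  have Fp': "F (q, u) = \<phi> (2 * (u - 1)) q + 4 * ln u" if "u \<in> {1..3/2}" for q u
    using Fp \<psi> that by (simp add: UNIV)
  have "r > 0" using r by simp
  show ?O
    unfolding t_def O[OF all_pts \<open>r > 0\<close>]
    by (rule arg_cong[where f=complex_of_real], rule cone_form_interior[OF F Fp' r])
  show ?L unfolding t_def by (rule velocity_differential(1)[OF F Fp' r])
  show ?B unfolding t_def by (rule velocity_basic[OF F Fp' r])
qed

text \<open>Parametrises the (1,0)-vectors by their real parts, so that positivity of \<Omega>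
  becomes a condition on real horizontal vectors.\<close>

lemma D10_iff: "(x, y) \<in> D10 \<eta> \<Phi> p \<longleftrightarrow> \<eta> p x = 0 \<and> y = - \<Phi> p x"
proof -
  have "\<Phi> p (- \<Phi> p x) = x" if "\<eta> p x = 0"
    using that Phi_square[of p x] linear_neg[OF linear_Phi[of p], of "\<Phi> p x"] by (simp add: UNIV)
  moreover have "\<eta> p (- \<Phi> p x) = 0"
    using eta_Phi[of p x] linear_neg[OF linear_eta[of p], of "\<Phi> p x"] by (simp add: UNIV)
  ultimately show ?thesis
    by (auto simp: D10_def cvec_i_def equation_minus_iff[of _ "\<Phi> p x"])
qed

lemma Omega_positive_iff:
  "Omega_positive M \<xi> \<eta> \<Phi> \<psi> \<longleftrightarrow>
    (\<forall>t\<in>{0..1}. \<forall>p v. v \<noteq> 0 \<longrightarrow> \<eta> p v = 0 \<longrightarrow> omega (\<phi> t) p v (\<Phi> p v) > 0)"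
proof -
  \<comment> \<open>For X = x - \<i> \<Phi> x only the mixed terms survive in the pairing with the
    conjugate. They are equal and double the factor r^2/2.\<close>
  have val: "- \<i> * cext2 (\<lambda>a b. Omega M \<xi> \<eta> \<Phi> \<psi> (p, r) (a, 0) (b, 0)) (x, - \<Phi> p x) (cvec_cnj (x, - \<Phi> p x))
      = complex_of_real (r\<^sup>2 * omega (\<phi> (2 * (r - 1))) p x (\<Phi> p x))"
    if r: "r \<in> {1..3/2}" and x: "\<eta> p x = 0" for p r x
  proof -
    let ?o = "omega (\<phi> (2 * (r - 1))) p"
    have p: "p \<in> pts M" by (simp add: UNIV)
    have "2 * (r - 1) \<in> {0..1}" using r by auto
    then have bl: "bilinear ?o" by (intro bilinear_omega path_basic p)
    have e: "\<eta> p (\<Phi> p x) = 0" "\<eta> p (- \<Phi> p x) = 0"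
      using eta_Phi[OF p] linear_neg[OF linear_eta[OF p], of "\<Phi> p x"] by auto
    have s: "?o a a = 0" for a by (simp add: ext_deriv_def)
    have a: "?o (\<Phi> p x) x = - ?o x (\<Phi> p x)" by (rule ext_deriv_antisym)
    show ?thesis
      unfolding cext2_def cvec_cnj_def fst_conv snd_conv minus_minus Omega_contact[OF r x x] Omega_contact[OF r x e(1)]
        Omega_contact[OF r e(2) x] Omega_contact[OF r e(2) e(1)] bilinear_lneg[OF bl] s a
      by (simp add: complex_eq_iff field_simps)
  qed
  show ?thesis
  proof
    assume pos: "Omega_positive M \<xi> \<eta> \<Phi> \<psi>"
    show "\<forall>t\<in>{0..1}. \<forall>p v. v \<noteq> 0 \<longrightarrow> \<eta> p v = 0 \<longrightarrow> omega (\<phi> t) p v (\<Phi> p v) > 0"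
    proof (intro ballI allI impI)
      fix t p and v :: 'e assume t: "t \<in> {0..(1::real)}" and v: "v \<noteq> 0" "\<eta> p v = 0"
      define r where "r = 1 + t / 2"
      have r: "r \<in> {1..3/2}" and tr: "2 * (r - 1) = t" using t by (auto simp: r_def)
      have m: "(p, r) \<in> Mbar M" "(v, - \<Phi> p v) \<in> D10 \<eta> \<Phi> (fst (p, r))" "(v, - \<Phi> p v) \<noteq> 0"
        using r v by (auto simp: Mbar_def UNIV D10_iff zero_prod_def)
      have "0 < Re (complex_of_real (r\<^sup>2 * omega (\<phi> (2 * (r - 1))) p v (\<Phi> p v)))"
        using pos[unfolded Omega_positive_def Let_def, rule_format, OF m] unfolding val[OF r v(2)] by blast
      then have "0 < r\<^sup>2 * omega (\<phi> t) p v (\<Phi> p v)" unfolding tr by (simp only: Re_complex_of_real)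
      then show "omega (\<phi> t) p v (\<Phi> p v) > 0" by (simp add: zero_less_mult_iff)
    qed
  next
    assume pos: "\<forall>t\<in>{0..1}. \<forall>p v. v \<noteq> 0 \<longrightarrow> \<eta> p v = 0 \<longrightarrow> omega (\<phi> t) p v (\<Phi> p v) > 0"
    show "Omega_positive M \<xi> \<eta> \<Phi> \<psi>"
      unfolding Omega_positive_def Let_def
    proof (intro ballI impI)
      fix x X assume x: "x \<in> Mbar M" and X: "X \<in> D10 \<eta> \<Phi> (fst x)" "X \<noteq> 0"
      obtain p r where pr: "x = (p, r)" by (cases x)
      have r: "r \<in> {1..3/2}" using x by (auto simp: pr Mbar_def)
      obtain v where v: "X = (v, - \<Phi> p v)" "\<eta> p v = 0" using X(1) D10_iff by (cases X) (auto simp: pr)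
      have "v \<noteq> 0"
      proof
        assume "v = 0"
        then have "\<Phi> p v = 0" using linear_0[OF linear_Phi[of p]] by (simp add: UNIV)
        then show False using X(2) v(1) \<open>v = 0\<close> by (simp add: zero_prod_def)
      qed
      moreover have "2 * (r - 1) \<in> {0..1}" using r by auto
      ultimately have "omega (\<phi> (2 * (r - 1))) p v (\<Phi> p v) > 0" using pos v(2) by blast
      moreover have "r\<^sup>2 > 0" using r by simp
      ultimately have "r\<^sup>2 * omega (\<phi> (2 * (r - 1))) p v (\<Phi> p v) > 0" by (rule mult_pos_pos[rotated])
      then show "- \<i> * cext2 (\<lambda>a b. Omega M \<xi> \<eta> \<Phi> \<psi> x (a, 0) (b, 0)) X (cvec_cnj X) \<in> \<real> \<and>
          0 < Re (- \<i> * cext2 (\<lambda>a b. Omega M \<xi> \<eta> \<Phi> \<psi> x (a, 0) (b, 0)) X (cvec_cnj X))"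
        unfolding pr v(1) val[OF r v(2)] by (simp only: Re_complex_of_real Reals_of_real)
    qed
  qed
qed

text \<open>\<open>Omega\<close> is real on real vectors, so its power is that of the real form
  \<open>B\<close> in dimension 2n + 2, where vanishing means having a kernel vector;
  \<open>geodesic_form_degenerate_iff\<close> then decides whether one exists.\<close>

lemma Omega_power_eq_0_iff:
  assumes dim: "DIM('e) = 2 * n + 1" and r: "r \<in> {1<..<3/2}"
  defines "t \<equiv> 2 * (r - 1)"
  assumes pos: "\<And>v. v \<noteq> 0 \<Longrightarrow> g' (\<phi> t) p v v > 0"
  shows "(\<forall>v. wedge_power (n + 1) (form2 (Omega M \<xi> \<eta> \<Phi> \<psi> (p, r))) v = 0) \<longleftrightarrow>
    acceleration \<phi> t p - 1 / 4 * (covector_norm (g' (\<phi> t) p) (velocity \<phi> t p))\<^sup>2 = 0"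
proof -
  define c where "c = acceleration \<phi> t p"
  define \<alpha> where "\<alpha> = velocity \<phi> t p"
  define Q where "Q = geodesic_form (\<phi> t) p r c \<alpha>"
  define B where "B = (\<lambda>x y :: 'e \<times> real. r\<^sup>2 / 2 * Q (fst x) (snd x) (fst y) (snd y))"
  have p: "p \<in> pts M" by (simp add: UNIV)
  have "t \<in> {0..1}" using r by (auto simp: t_def)
  then have f: "\<phi> t \<in> basic_funs M \<xi>" by (rule path_basic)
  have rp: "r > 0" using r by simp
  have \<alpha>: "linear \<alpha>" "\<alpha> (\<xi> p) = 0"
    using Omega_interior(2,3)[OF r, of p] by (simp_all add: \<alpha>_def t_def)
  have O: "Omega M \<xi> \<eta> \<Phi> \<psi> (p, r) = (\<lambda>x y. complex_of_real (B x y))"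
  proof (intro ext)
    fix x y :: "'e \<times> real"
    show "Omega M \<xi> \<eta> \<Phi> \<psi> (p, r) x y = complex_of_real (B x y)"
      using Omega_interior(1)[OF r, of p "fst x" "snd x" "fst y" "snd y"]
      unfolding B_def Q_def \<alpha>_def c_def t_def by (simp only: prod.collapse)
  qed
  note bl = bilinear_omega[OF f p]
  have anti: "B x y = - B y x" for x y
    unfolding B_def Q_def geodesic_form_def using ext_deriv_antisym[of "eta' (\<phi> t)" p "fst x" "fst y"] by (simp add: algebra_simps)
  have lin: "linear (B x)" for x
    unfolding B_def Q_def geodesic_form_def
    by (simp add: linear_iff bilinear_radd[OF bl] bilinear_rmul[OF bl] linear_add[OF \<alpha>(1)] linear_scale[OF \<alpha>(1)]
        linear_add[OF linear_eta[OF p]] linear_scale[OF linear_eta[OF p]]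
        linear_add[OF linear_Phi[OF p]] linear_scale[OF linear_Phi[OF p]] algebra_simps add_divide_distrib)
  have "bilinear B"
    unfolding bilinear_def
  proof (intro conjI allI)
    fix y
    have "(\<lambda>x. B x y) = (\<lambda>x. - B y x)" using anti[of _ y] by (rule ext)
    then show "linear (\<lambda>x. B x y)" using linear_compose_neg[OF lin[of y]] by simp
  qed (rule lin)
  moreover have "DIM('e \<times> real) = 2 * (n + 1)" using dim by simp
  ultimately have "(\<forall>v. wedge_power (n + 1) (form2 B) v = 0) \<longleftrightarrow> (\<exists>x. x \<noteq> 0 \<and> (\<forall>y. B x y = 0))"
    using anti by (intro wedge_power_eq_0_iff)
  also have "\<dots> \<longleftrightarrow> (\<exists>v a. (v \<noteq> 0 \<or> a \<noteq> 0) \<and> (\<forall>w b. Q v a w b = 0))"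
    using rp by (simp add: B_def zero_prod_def)
  also have "\<dots> \<longleftrightarrow> c - 1 / 4 * (covector_norm (g' (\<phi> t) p) \<alpha>)\<^sup>2 = 0"
    unfolding Q_def by (rule geodesic_form_degenerate_iff[OF f p pos \<alpha> rp])
  finally show ?thesis
    unfolding O wedge_power_of_real of_real_eq_0_iff \<alpha>_def c_def .
qed

lemma geodesic_iff_cone_equation:
  assumes compact: "compact (UNIV :: 'm set)" and connected: "connected (UNIV :: 'm set)"
    and dim: "DIM('e) = 2 * n + 1"
  shows "(\<forall>t\<in>{0..1}. \<phi> t \<in> potentials n M \<xi> \<eta> \<Phi>) \<and> geodesic_equation M \<xi> \<eta> \<Phi> \<phi> \<longleftrightarrow>
    (\<forall>p. \<forall>r\<in>{1<..<3/2}. \<forall>v. wedge_power (n + 1) (form2 (Omega M \<xi> \<eta> \<Phi> \<psi> (p, r))) v = 0) \<and>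
    Omega_positive M \<xi> \<eta> \<Phi> \<psi>"
proof -
  have p: "p \<in> pts M" for p by (simp add: UNIV)
  have f: "\<phi> t \<in> basic_funs M \<xi>" if "t \<in> {0..1}" for t by (rule path_basic[OF that])
  define pos where "pos \<longleftrightarrow> (\<forall>t\<in>{0..1}. \<forall>p v. v \<noteq> 0 \<longrightarrow> g' (\<phi> t) p v v > 0)"
  have pot: "(\<forall>t\<in>{0..1}. \<phi> t \<in> potentials n M \<xi> \<eta> \<Phi>) \<longleftrightarrow> pos"
  proof
    assume "\<forall>t\<in>{0..1}. \<phi> t \<in> potentials n M \<xi> \<eta> \<Phi>"
    then show pos unfolding pos_def using potential_metric_pos[OF UNIV compact connected dim] by blast
  next
    assume pos
    then have "\<exists>v. wedge 1 (2 * n) (form1 (eta' (\<phi> t) p)) (wedge_power n (form2 (omega (\<phi> t) p))) v \<noteq> 0"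
      if "t \<in> {0..1}" for t p
      by (intro potential_contact_volume[OF f[OF that] p dim]) (use that in \<open>auto simp: pos_def\<close>)
    then show "\<forall>t\<in>{0..1}. \<phi> t \<in> potentials n M \<xi> \<eta> \<Phi>"
      unfolding potentials_def using f by blast
  qed
  have "Omega_positive M \<xi> \<eta> \<Phi> \<psi> \<longleftrightarrow> pos"
    unfolding Omega_positive_iff pos_def using metric_pot_pos_iff[OF f p] by blast
  \<comment> \<open>Stated under \<open>pos\<close> because the dual vector taken by
    \<open>THE\<close> in \<open>covector_norm\<close> is meaningful for a definite metric. Each
    side of the equivalence to be shown implies \<open>pos\<close>, so this is enough.\<close>
  moreover have "geodesic_equation M \<xi> \<eta> \<Phi> \<phi> \<longleftrightarrow>
      (\<forall>p. \<forall>r\<in>{1<..<3/2}. \<forall>v. wedge_power (n + 1) (form2 (Omega M \<xi> \<eta> \<Phi> \<psi> (p, r))) v = 0)" if pos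
  proof -
    let ?E = "\<lambda>p t. acceleration \<phi> t p - 1 / 4 * (covector_norm (g' (\<phi> t) p) (velocity \<phi> t p))\<^sup>2 = 0"
    have eq: "(\<forall>v. wedge_power (n + 1) (form2 (Omega M \<xi> \<eta> \<Phi> \<psi> (p, r))) v = 0) \<longleftrightarrow> ?E p (2 * (r - 1))"
      if r: "r \<in> {1<..<3/2}" for p r
    proof (rule Omega_power_eq_0_iff[OF dim r])
      have "2 * (r - 1) \<in> {0..1}" using r by auto
      then show "g' (\<phi> (2 * (r - 1))) p v v > 0" if "v \<noteq> 0" for v
        using \<open>pos\<close> that unfolding pos_def by blast
    qed
    have "(\<forall>r\<in>{1<..<3/2}. ?E p (2 * (r - 1))) \<longleftrightarrow> (\<forall>t\<in>{0<..<1}. ?E p t)" for p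
    proof (intro iffI ballI)
      fix t :: real assume E: "\<forall>r\<in>{1<..<3/2}. ?E p (2 * (r - 1))" and t: "t \<in> {0<..<1}"
      have "1 + t / 2 \<in> {1<..<3/2}" "2 * (1 + t / 2 - 1) = t" using t by auto
      with E show "?E p t" by metis
    next
      fix r :: real assume E: "\<forall>t\<in>{0<..<1}. ?E p t" and r: "r \<in> {1<..<3/2}"
      have "2 * (r - 1) \<in> {0<..<1}" using r by auto
      with E show "?E p (2 * (r - 1))" by blast
    qed
    then show ?thesis
      unfolding geodesic_equation_def UNIV using eq by simp
  qed
  ultimately show ?thesis using pot by blast
qed

end

end

theorem proposition1:
  fixes M :: "('m::t2_space, 'e::euclidean_space) mfd"
    and \<xi> :: "'m \<Rightarrow> 'e" and \<eta> :: "'m \<Rightarrow> 'e \<Rightarrow> real" and \<Phi> :: "'m \<Rightarrow> 'e \<Rightarrow> 'e"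
    and g :: "'m \<Rightarrow> 'e \<Rightarrow> 'e \<Rightarrow> real" and n :: nat
    and \<phi>0 \<phi>1 :: "'m \<Rightarrow> real" and \<phi> :: "real \<Rightarrow> 'm \<Rightarrow> real" and \<psi> :: "'m \<times> real \<Rightarrow> real"
  assumes "smooth_manifold M" and "pts M = UNIV"
    and "compact (UNIV :: 'm set)" and "connected (UNIV :: 'm set)"
    and "DIM('e) = 2 * n + 1"
    and "sasakian M \<xi> \<eta> \<Phi> g"
    and "\<phi>0 \<in> potentials n M \<xi> \<eta> \<Phi>" and "\<phi>1 \<in> potentials n M \<xi> \<eta> \<Phi>"
    and "smooth_basic_path M \<xi> \<phi>"
    and "\<And>p r. r \<in> {1..3/2} \<Longrightarrow> \<psi> (p, r) = \<phi> (2 * (r - 1)) p + 4 * ln r"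
  shows "(\<forall>t\<in>{0..1}. \<phi> t \<in> potentials n M \<xi> \<eta> \<Phi>) \<and> \<phi> 0 = \<phi>0 \<and> \<phi> 1 = \<phi>1 \<and>
           geodesic_equation M \<xi> \<eta> \<Phi> \<phi>
     \<longleftrightarrow>
         (\<forall>p. \<forall>r\<in>{1<..<3/2}. \<forall>v. wedge_power (n + 1) (form2 (Omega M \<xi> \<eta> \<Phi> \<psi> (p, r))) v = 0) \<and>
         Omega_positive M \<xi> \<eta> \<Phi> \<psi> \<and>
         (\<forall>p. \<psi> (p, 1) = \<phi>0 p) \<and> (\<forall>p. \<psi> (p, 3/2) = \<phi>1 p + 4 * ln (3/2))"
proof -
  interpret sasakian_mfd M \<xi> \<eta> \<Phi> g
    by unfold_locales (use assms in auto)
  have "\<psi> (p, 1) = \<phi> 0 p" "\<psi> (p, 3/2) = \<phi> 1 p + 4 * ln (3/2)" for p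
    using assms(10)[of 1 p] assms(10)[of "3/2" p] by simp_all
  then have "(\<forall>p. \<psi> (p, 1) = \<phi>0 p) \<longleftrightarrow> \<phi> 0 = \<phi>0"
    and "(\<forall>p. \<psi> (p, 3/2) = \<phi>1 p + 4 * ln (3/2)) \<longleftrightarrow> \<phi> 1 = \<phi>1"
    by (auto simp: fun_eq_iff)
  then show ?thesis
    using geodesic_iff_cone_equation[OF assms(2,9,10,3,4,5)] by blast
qed

end
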